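(* There is an absolute constant $C>0$ such that, writing $D(x)=\exp[C(\log x)^{1/2}]$, the following holds for each $\eta\in\{-1,1\}$. Fix $\epsilon>0$. For all sufficiently large $x$ there exist at least $D(x)^{1-\epsilon}$ positive integers $d\le D(x)$, each admitting a quadratic Dirichlet character $\chi_d$ of conductor $d$, for which $$\frac{\#\{pq\le x:\ \chi_d(p)=\chi_d(q)=\eta\}}{\frac14\,\#\{pq\le x:\ (pq,d)=1\}}\ \ \ge\ \ 1+\frac{\log\log\log x+O(1)}{\log\log x},$$ where the implied constant in $O(1)$ is independent of $x$ and $d$.
   Context: In the counts, $p$ and $q$ denote primes (possibly equal), and $\#\{pq\le x:\dots\}$ counts the integers at most $x$ that are a product $pq$ of two primes satisfying the stated condition. A quadratic character $\chi_d$ of conductor $d$ is a primitive, real, non-principal Dirichlet character modulo $d$. $(m,n)$ denotes the greatest common divisor. *)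

theory Defs
  imports Complex_Main "HOL-Number_Theory.Number_Theory"
begin

definition dirichlet_char :: "nat \<Rightarrow> (int \<Rightarrow> complex) \<Rightarrow> bool" where
  "dirichlet_char d \<chi> \<longleftrightarrow>
     d > 0 \<and>
     (\<forall>a b. \<chi> (a * b) = \<chi> a * \<chi> b) \<and>
     (\<forall>a. \<chi> (a + int d) = \<chi> a) \<and>
     (\<forall>a. \<chi> a \<noteq> 0 \<longleftrightarrow> coprime a (int d))"

definition principal_char :: "nat \<Rightarrow> (int \<Rightarrow> complex) \<Rightarrow> bool" where
  "principal_char d \<chi> \<longleftrightarrow> (\<forall>a. \<chi> a = (if coprime a (int d) then 1 else 0))"

definition real_char :: "(int \<Rightarrow> complex) \<Rightarrow> bool" where
  "real_char \<chi> \<longleftrightarrow> (\<forall>a. \<chi> a \<in> \<real>)"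

definition primitive_char :: "nat \<Rightarrow> (int \<Rightarrow> complex) \<Rightarrow> bool" where
  "primitive_char d \<chi> \<longleftrightarrow>
     dirichlet_char d \<chi> \<and>
     (\<nexists>m \<psi>. m dvd d \<and> m < d \<and> dirichlet_char m \<psi> \<and>
             (\<forall>a. coprime a (int d) \<longrightarrow> \<chi> a = \<psi> a))"

definition quadratic_char :: "nat \<Rightarrow> (int \<Rightarrow> complex) \<Rightarrow> bool" where
  "quadratic_char d \<chi> \<longleftrightarrow>
     primitive_char d \<chi> \<and> real_char \<chi> \<and> \<not> principal_char d \<chi>"

text \<open>The integers \<open>p q\<close> are counted, not the pairs \<open>(p, q)\<close>; \<open>p = q\<close> is allowed.\<close>

definition semiprime_count :: "real \<Rightarrow> (nat \<Rightarrow> nat \<Rightarrow> bool) \<Rightarrow> nat" where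
  "semiprime_count x P =
     card {n. \<exists>p q. prime p \<and> prime q \<and> n = p * q \<and> real n \<le> x \<and> P p q}"

definition D :: "real \<Rightarrow> real \<Rightarrow> real" where
  "D C x = exp (C * ln x powr (1 / 2))"

end

theory Submission
  imports Defs "HOL-Complex_Analysis.Complex_Analysis" "HOL-Combinatorics.Multiset_Permutations"
    "HOL-Computational_Algebra.Squarefree" "HOL-Real_Asymp.Real_Asymp"
begin

text \<open>
  Take \<open>C = 1\<close> and let \<open>d \<le> D(x)\<close> run over the squarefree \<open>d \<equiv> 1\<close> mod \<open>4\<close> for which the Jacobi symbol
  \<open>\<chi>\<close> modulo \<open>d\<close> takes the value \<open>\<eta>\<close> at every odd prime \<open>p \<le> (log x)^(1/4)\<close>; by reciprocity this is a condition
  modulo a number of size \<open>D(x)^o(1)\<close>. Expanding \<open>(1 + \<eta> \<chi>(p)) (1 + \<eta> \<chi>(q))\<close> over the products \<open>pq \<le> x\<close>, the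
  linear term is \<open>\<Sum> \<eta> \<chi>(p) \<pi>(x/p)\<close>. Its small primes contribute \<open>(x / log x) (log log log x + O(1))\<close>; the primes
  up to a power of \<open>log x\<close> contribute \<open>O(x / log x)\<close>. Beyond that, a duality argument of Halasz--Montgomery type,
  applied to high moments over dyadic blocks, shows that the character sums are negligible for all but
  \<open>D(x)^(\<epsilon>/2 + o(1))\<close> of the \<open>d\<close>, and likewise the quadratic term \<open>\<Sum> \<chi>(p) \<chi>(q)\<close>. The count of all \<open>pq \<le> x\<close> is
  \<open>(x / log x) (log log x + O(1))\<close>. These estimates use \<open>\<pi>(z) = z / log z + O(z / (log z log log z))\<close>, which
  Chebyshev-type bounds do not give; it comes from quantitative nonvanishing of zeta on \<open>Re s = 1\<close> and
  smoothing with the Fejer kernel.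
\<close>

text \<open>The ratio in question exceeds 1 only by about log log log x / log log x, so every count
  has to be known up to O(x / log x). A relative error 1 / log log z in the count of primes,
  multiplied by the log log x of Mertens' theorem, is exactly affordable; this fixes the quality of
  the prime number theorem proved below. The cutoff (log x)^(1/4) stays low because prescribing the
  character at all primes up to w costs a modulus of size up to exp(w log w), which must remain
  D(x)^o(1) while log D(x) is only (log x)^(1/2). Cancellation, in turn, sets in only beyond (log
  x)^(A/2): for primes of size P the moment k is about 5 (log x)^(1/2) / log P, and it loses a
  factor (log x)^(6k). Between the two cutoffs the trivial bound is good enough, since the sum of
  1/p there is a difference of two iterated logarithms, which is bounded. Orthogonality of two
  characters rests on periodicity alone: their product has period at most D(x)^2, which is short
  beside the length of the sums.\<close>

unbundle no vec_syntax \<comment> \<open>frees \<open>\<chi>\<close> for characters\<close>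

section \<open>Legendre and Jacobi symbols as primitive quadratic characters\<close>

lemma Legendre_cong: "[a = b] (mod p) \<Longrightarrow> Legendre a p = Legendre b p"
  unfolding Legendre_def QuadRes_def by (simp add: unique_euclidean_semiring_class.cong_def)

lemma Legendre_0_iff: "Legendre a p = 0 \<longleftrightarrow> p dvd a"
  by (auto simp: Legendre_def cong_0_iff)

lemma Legendre_values: "Legendre a p \<in> {-1, 0, 1}"
  by (auto simp: Legendre_def)

text \<open>Euler's criterion gives the identity modulo p. Both sides lie in {-1, 0, 1}, so they
  differ by at most 2, and p > 2 turns the congruence into an equality.\<close>

lemma Legendre_mult:
  assumes "prime (p::nat)" "p > 2"
  shows "Legendre (a * b) (int p) = Legendre a (int p) * Legendre b (int p)"
proof -
  have "[Legendre (a * b) (int p) = (a * b) ^ ((p - 1) div 2)] (mod int p)"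
    using euler_criterion assms by blast
  moreover have "[Legendre a (int p) * Legendre b (int p) = (a * b) ^ ((p - 1) div 2)] (mod int p)"
    unfolding power_mult_distrib using assms by (intro cong_mult euler_criterion)
  ultimately have "[Legendre (a * b) (int p) = Legendre a (int p) * Legendre b (int p)] (mod int p)"
    using cong_sym cong_trans by blast
  hence "int p dvd Legendre (a * b) (int p) - Legendre a (int p) * Legendre b (int p)"
    by (simp add: cong_iff_dvd_diff)
  moreover have "\<bar>Legendre (a * b) (int p) - Legendre a (int p) * Legendre b (int p)\<bar> < int p"
  proof -
    have "x \<in> {-1, 0, 1} \<Longrightarrow> y \<in> {-1, 0, 1} \<Longrightarrow> z \<in> {-1, 0, 1} \<Longrightarrow> \<bar>x - y * z\<bar> \<le> 2" for x y z :: int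
      by auto
    from this[OF Legendre_values Legendre_values Legendre_values] show ?thesis
      by (rule le_less_trans) (use assms in simp)
  qed
  ultimately have "Legendre (a * b) (int p) - Legendre a (int p) * Legendre b (int p) = 0"
    using dvd_imp_le_int[of "Legendre (a * b) (int p) - Legendre a (int p) * Legendre b (int p)" "int p"]
    by linarith
  thus ?thesis by simp
qed

lemma Legendre_1: "prime (p::nat) \<Longrightarrow> Legendre 1 (int p) = 1"
  unfolding Legendre_def QuadRes_def
  by (auto simp: cong_0_iff dest: prime_gt_1_nat intro: exI[of _ 1])

text \<open>If every residue were a square, squaring would map the finite set of residues onto
  itself and hence be injective; but 1 and p - 1 have the same square.\<close>

lemma Legendre_minus_one_exists:
  assumes "prime (p::nat)" "p > 2"
  shows "\<exists>a. Legendre a (int p) = -1"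
proof (rule ccontr)
  assume "\<not> ?thesis"
  hence *: "QuadRes (int p) a" for a
    by (metis Legendre_def QuadRes_def cong_sym power_zero_numeral)
  define S where "S = {0..<int p}"
  let ?f = "\<lambda>y. y\<^sup>2 mod int p"
  have "S \<subseteq> ?f ` S"
  proof
    fix a assume a: "a \<in> S"
    obtain y where y: "[y\<^sup>2 = a] (mod int p)" using * unfolding QuadRes_def by blast
    have "a = ?f (y mod int p)" using y a
      by (simp add: unique_euclidean_semiring_class.cong_def S_def power_mod)
    moreover have "y mod int p \<in> S" using assms by (auto simp: S_def)
    ultimately show "a \<in> ?f ` S" by blast
  qed
  moreover have "?f ` S \<subseteq> S" using assms by (auto simp: S_def)
  moreover have "finite S" by (simp add: S_def)
  ultimately have "inj_on ?f S" by (metis eq_card_imp_inj_on order_antisym)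
  moreover have "?f 1 = ?f (int p - 1)"
  proof -
    have "(int p - 1)\<^sup>2 = 1 + int p * (int p - 2)" by (simp add: power2_eq_square algebra_simps)
    thus ?thesis by (metis mod_mult_self2 one_power2)
  qed
  moreover have "1 \<in> S" "int p - 1 \<in> S" using assms by (auto simp: S_def)
  ultimately have "1 = int p - 1" by (meson inj_onD)
  thus False using assms by auto
qed

text \<open>For squarefree \<open>d\<close> this is the Jacobi symbol; multiplicities in \<open>d\<close> are ignored.\<close>

definition jac :: "nat \<Rightarrow> int \<Rightarrow> int" where
  "jac d a = (\<Prod>r\<in>prime_factors d. Legendre a (int r))"

lemma odd_prime_factor: "odd (d::nat) \<Longrightarrow> r \<in> prime_factors d \<Longrightarrow> prime r \<and> r > 2"
  by (metis dvd_trans in_prime_factors_iff order_neq_le_trans prime_ge_2_nat)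

lemma jac_mult: "odd d \<Longrightarrow> jac d (a * b) = jac d a * jac d b"
  unfolding jac_def prod.distrib[symmetric]
  by (intro prod.cong refl Legendre_mult) (auto dest: odd_prime_factor)

lemma jac_cong: "[a = b] (mod int d) \<Longrightarrow> jac d a = jac d b"
  unfolding jac_def
  by (intro prod.cong refl Legendre_cong) (auto elim!: cong_dvd_modulus)

lemma jac_1 [simp]: "jac d 1 = 1"
  unfolding jac_def by (intro prod.neutral ballI Legendre_1) (auto)

lemma jac_eq_0_iff:
  assumes "d > 0"
  shows "jac d a = 0 \<longleftrightarrow> \<not> coprime a (int d)"
proof -
  have "jac d a = 0 \<longleftrightarrow> (\<exists>r\<in>prime_factors d. int r dvd a)"
    unfolding jac_def by (simp add: Legendre_0_iff)
  also have "\<dots> \<longleftrightarrow> \<not> coprime a (int d)"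
  proof
    assume "\<exists>r\<in>prime_factors d. int r dvd a"
    then obtain r where r: "prime r" "r dvd d" "int r dvd a" by auto
    thus "\<not> coprime a (int d)"
      by (meson coprime_common_divisor int_dvd_int_iff not_prime_unit prime_int_nat_transfer
          prime_nat_int_transfer)
  next
    assume "\<not> coprime a (int d)"
    hence "\<not> coprime (nat \<bar>a\<bar>) d"
      by (metis coprime_abs_left_iff coprime_int_iff nat_0_le abs_ge_zero)
    hence "gcd (nat \<bar>a\<bar>) d \<noteq> 1" by (simp only: coprime_iff_gcd_eq_1 not_False_eq_True)
    then obtain r where r: "prime r" "r dvd gcd (nat \<bar>a\<bar>) d"
      using prime_factor_nat by blast
    have "prime r" "r dvd nat \<bar>a\<bar>" "r dvd d"
      using r(1) dvd_trans[OF r(2) gcd_dvd1] dvd_trans[OF r(2) gcd_dvd2] by auto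
    thus "\<exists>r\<in>prime_factors d. int r dvd a"
      using assms by (auto intro!: bexI[of _ r] simp: in_prime_factors_iff)
  qed
  finally show ?thesis .
qed

lemma jac_values: "jac d a \<in> {-1, 0, 1}"
proof -
  have "finite A \<Longrightarrow> (\<Prod>r\<in>A. Legendre a (int r)) \<in> {-1, 0, 1}" for A
  proof (induction rule: finite_induct)
    case (insert r A)
    thus ?case using Legendre_values[of a "int r"] by auto
  qed auto
  thus ?thesis unfolding jac_def by blast
qed

text \<open>The Chinese remainder theorem combines a nonresidue modulo r with 1 modulo everything
  else, so that only the factor at r changes sign; squarefreeness makes r coprime to
  \<open>d div r\<close>. The extra modulus m is a candidate for a smaller conductor in
  \<open>quadratic_char_jac\<close> and a second discriminant in
  \<open>jac_orthogonal\<close>.\<close>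

lemma jac_witness:
  assumes "odd d" "squarefree d" "r \<in> prime_factors d" "\<not> r dvd m"
  shows "\<exists>a. jac d a = -1 \<and> [a = 1] (mod int (d div r)) \<and> [a = 1] (mod int m)"
proof -
  have r: "prime r" "r > 2" "r dvd d" using odd_prime_factor assms by auto
  have "\<not> r dvd d div r"
  proof
    assume "r dvd d div r"
    hence "r * r dvd r * (d div r)" by (intro mult_dvd_mono) auto
    hence "r\<^sup>2 dvd d" using r by (simp add: power2_eq_square)
    thus False using assms(2) r(1) squarefreeD not_prime_unit by blast
  qed
  hence "coprime (int r) (int (m * (d div r)))"
    using r assms(4) by (simp add: prime_imp_coprime coprime_int_iff prime_dvd_mult_iff
        del: of_nat_mult)
  moreover obtain b where b: "Legendre b (int r) = -1"
    using Legendre_minus_one_exists r by blast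
  ultimately obtain a where a: "[a = b] (mod int r)" "[a = 1] (mod int (m * (d div r)))"
    using binary_chinese_remainder_int by blast
  have 1: "[a = 1] (mod int m)" "[a = 1] (mod int (d div r))"
    by (rule cong_dvd_modulus[OF a(2)], simp)+
  have "jac d a = Legendre a (int r) * (\<Prod>s\<in>prime_factors d - {r}. Legendre a (int s))"
    unfolding jac_def using assms(3) by (intro prod.remove) auto
  also have "(\<Prod>s\<in>prime_factors d - {r}. Legendre a (int s)) = 1"
  proof (intro prod.neutral ballI)
    fix s assume s: "s \<in> prime_factors d - {r}"
    hence "prime s" "s dvd d" by auto
    moreover have "d = r * (d div r)" using r by simp
    ultimately have "s dvd d div r"
      using s r(1) by (metis DiffE insertI1 prime_dvd_multD primes_dvd_imp_eq)
    hence "[a = 1] (mod int s)" using 1(2) cong_dvd_modulus int_dvd_int_iff by blast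
    thus "Legendre a (int s) = 1" using Legendre_cong Legendre_1[OF \<open>prime s\<close>] by metis
  qed
  also have "Legendre a (int r) = -1" using a(1) b Legendre_cong by metis
  finally show ?thesis using 1 by auto
qed

text \<open>If the symbol came from a proper divisor m, a prime r dividing \<open>d div m\<close>
  would not divide m, as d is squarefree. The witness a is then 1 modulo m but has symbol -1,
  against \<psi>(a) = \<psi>(1) = 1.\<close>

lemma quadratic_char_jac:
  assumes "odd d" "squarefree d" "d > 1"
  shows "quadratic_char d (\<lambda>a. of_int (jac d a))"
proof -
  have dc: "dirichlet_char d (\<lambda>a. of_int (jac d a))"
    unfolding dirichlet_char_def using assms
    by (auto simp: jac_mult jac_eq_0_iff intro!: jac_cong) (simp add: unique_euclidean_semiring_class.cong_def)
  have "\<not> (m dvd d \<and> m < d \<and> dirichlet_char m \<psi> \<and>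
      (\<forall>a. coprime a (int d) \<longrightarrow> of_int (jac d a) = \<psi> a))" for m \<psi>
  proof
    assume *: "m dvd d \<and> m < d \<and> dirichlet_char m \<psi> \<and>
      (\<forall>a. coprime a (int d) \<longrightarrow> of_int (jac d a) = \<psi> a)"
    have "d div m \<noteq> 1" using * by auto
    then obtain r where r: "prime r" "r dvd d div m" using prime_factor_nat by blast
    have "r * m dvd (d div m) * m" using r by (intro mult_dvd_mono) auto
    hence rm: "r * m dvd d" using * by simp
    have "\<not> r dvd m"
    proof
      assume "r dvd m"
      hence "r * r dvd r * m" by (intro mult_dvd_mono) auto
      hence "r\<^sup>2 dvd d" using rm unfolding power2_eq_square by (rule dvd_trans)
      thus False using assms(2) r(1) squarefreeD not_prime_unit by blast
    qed
    moreover have "r \<in> prime_factors d"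
      using r rm assms by (auto simp: in_prime_factors_iff intro: dvd_trans dvd_mult_left)
    ultimately obtain a where a: "jac d a = -1" "[a = 1] (mod int m)"
      using jac_witness assms by blast
    have per: "\<psi> (b + int m) = \<psi> b" for b using * by (auto simp: dirichlet_char_def)
    \<comment> \<open>\<open>dirichlet_char\<close> speaks of a shift by one period. Iteration gives
      nonnegative multiples; a negative k is handled below by starting from a instead of 1.\<close>
    have per2: "\<psi> (b + int n * int m) = \<psi> b" for b n
    proof (induction n)
      case (Suc n)
      have "\<psi> (b + int (Suc n) * int m) = \<psi> ((b + int n * int m) + int m)"
        by (simp add: algebra_simps)
      thus ?case using per Suc by simp
    qed auto
    obtain k where k: "a = 1 + int m * k" using a(2) by (metis cong_iff_lin cong_sym)
    have "\<psi> a = \<psi> 1"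
    proof (cases "k \<ge> 0")
      case True
      thus ?thesis using per2[of 1 "nat k"] k by (simp add: mult.commute)
    next
      case False
      thus ?thesis using per2[of a "nat (- k)"] k by (simp add: mult.commute algebra_simps)
    qed
    moreover have "coprime a (int d)" using a(1) jac_eq_0_iff[of d a] assms by auto
    hence "\<psi> a = -1" using * a(1) by (metis of_int_1 of_int_minus)
    moreover have "\<psi> 1 = 1" using * by (metis coprime_1_left jac_1 of_int_1)
    ultimately show False by simp
  qed
  moreover have "\<not> principal_char d (\<lambda>a. of_int (jac d a))"
  proof -
    obtain r where r: "r \<in> prime_factors d"
      using assms by (metis in_prime_factors_iff nat_neq_iff not_one_less_zero prime_factor_nat)
    then obtain a where "jac d a = -1"
      using jac_witness[OF assms(1,2) r, of 1] r odd_prime_factor[OF assms(1) r] by auto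
    hence "(of_int (jac d a) :: complex) = -1" by simp
    thus ?thesis unfolding principal_char_def by (metis one_neq_neg_one zero_neq_neg_one)
  qed
  ultimately show ?thesis
    unfolding quadratic_char_def primitive_char_def real_char_def using dc by auto
qed

subsection \<open>Large values of real character sums\<close>

text \<open>Multiplication by a permutes the residues modulo M and multiplies the sum by -1.\<close>

lemma sum_multiplicative_period:
  fixes f :: "int \<Rightarrow> int"
  assumes mult: "\<And>a b. f (a * b) = f a * f b"
    and per: "\<And>a b. [a = b] (mod int M) \<Longrightarrow> f a = f b"
    and a: "f a = -1" "coprime a (int M)" and "M > 0"
  shows "(\<Sum>n<M. f (int n)) = 0"
proof -
  let ?h = "\<lambda>n. nat ((a * int n) mod int M)"
  have inj: "inj_on ?h {..<M}"
  proof (rule inj_onI)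
    fix x y assume xy: "x \<in> {..<M}" "y \<in> {..<M}" "?h x = ?h y"
    hence "(a * int x) mod int M = (a * int y) mod int M"
      using assms(5) by (simp add: nat_eq_iff)
    hence "[int x = int y] (mod int M)" using a(2)
      by (simp flip: unique_euclidean_semiring_class.cong_def add: cong_mult_lcancel)
    thus "x = y" using xy by (simp add: cong_int_iff unique_euclidean_semiring_class.cong_def)
  qed
  moreover have sub: "?h ` {..<M} \<subseteq> {..<M}" using assms(5) by (auto simp: nat_less_iff)
  ultimately have "?h ` {..<M} = {..<M}"
    by (simp add: endo_inj_surj)
  hence "(\<Sum>n<M. f (int n)) = (\<Sum>n\<in>?h ` {..<M}. f (int n))" by simp
  also have "\<dots> = (\<Sum>n<M. f (int (?h n)))" using inj by (simp add: sum.reindex)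
  also have "\<dots> = (\<Sum>n<M. f (a * int n))" using assms(5)
    by (intro sum.cong refl per) (simp add: unique_euclidean_semiring_class.cong_def)
  also have "\<dots> = - (\<Sum>n<M. f (int n))" by (simp add: mult a sum_negf)
  finally show ?thesis by simp
qed

text \<open>Complete periods contribute nothing, so they can be peeled off until fewer than M terms
  remain, and these are bounded trivially.\<close>

lemma sum_multiplicative_bound:
  fixes f :: "int \<Rightarrow> int"
  assumes mult: "\<And>a b. f (a * b) = f a * f b"
    and per: "\<And>a b. [a = b] (mod int M) \<Longrightarrow> f a = f b"
    and a: "f a = -1" "coprime a (int M)" and "M > 0" and le: "\<And>n. \<bar>f n\<bar> \<le> 1"
  shows "\<bar>\<Sum>n<N. f (int n)\<bar> \<le> int M"
proof (induction N rule: less_induct)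
  case (less N)
  show ?case
  proof (cases "N < M")
    case True
    have "\<bar>\<Sum>n<N. f (int n)\<bar> \<le> (\<Sum>n<N. 1)" by (rule order_trans[OF sum_abs sum_mono]) (rule le)
    thus ?thesis using True by simp
  next
    case False
    have "(\<Sum>n<N. f (int n)) = (\<Sum>n<M. f (int n)) + (\<Sum>n=M..<N. f (int n))"
      using False sum.atLeastLessThan_concat[of 0 M N "\<lambda>n. f (int n)"]
      by (simp add: atLeast0LessThan)
    also have "(\<Sum>n=M..<N. f (int n)) = (\<Sum>n<N-M. f (int (n + M)))"
      using False sum.shift_bounds_nat_ivl[of "\<lambda>n. f (int n)" 0 M "N - M"]
      by (simp add: atLeast0LessThan)
    also have "\<dots> = (\<Sum>n<N-M. f (int n))" by (intro sum.cong refl per) (simp add: unique_euclidean_semiring_class.cong_def)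
    finally show ?thesis using less[of "N - M"] False assms(5)
        sum_multiplicative_period[OF mult per a assms(5)] by simp
  qed
qed

lemma squarefree_eq_prod_prime_factors:
  assumes "squarefree (n::nat)"
  shows "n = \<Prod>(prime_factors n)"
proof -
  have "n > 0" using assms by (auto intro!: Nat.gr0I)
  hence "n = (\<Prod>p\<in>prime_factors n. p ^ multiplicity p n)"
    by (rule prime_factorization_nat)
  also have "\<dots> = (\<Prod>p\<in>prime_factors n. p)"
    using assms \<open>n > 0\<close> by (intro prod.cong) (auto simp: squarefree_factorial_semiring')
  finally show ?thesis .
qed

text \<open>Distinct squarefree numbers have different sets of prime factors. A prime dividing
  exactly one of them yields a residue where one symbol is -1 and the other is 1, so the product of
  the symbols cancels over its period d e.\<close>

lemma jac_orthogonal: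
  assumes "odd d" "squarefree d" "odd e" "squarefree e" "d \<noteq> e"
  shows "\<bar>\<Sum>n<N. jac d (int n) * jac e (int n)\<bar> \<le> int (d * e)"
proof -
  have *: "\<bar>\<Sum>n<N. jac d (int n) * jac e (int n)\<bar> \<le> int (d * e)"
    if h: "odd d" "squarefree d" "odd e" "squarefree e" "r \<in> prime_factors d" "\<not> r dvd e" for d e r
  proof -
    obtain a where a: "jac d a = -1" "[a = 1] (mod int e)" using jac_witness[OF h(1,2,5,6)] by blast
    have [simp]: "d > 0" "e > 0" using h by (auto intro!: Nat.gr0I)
    have "jac e a = 1" using jac_cong[OF a(2)] by simp
    show ?thesis
    proof (rule sum_multiplicative_bound[where a = a and f = "\<lambda>n. jac d n * jac e n"])
      show "jac d a * jac e a = -1" using a \<open>jac e a = 1\<close> by simp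
      show "coprime a (int (d * e))"
        using a(1) \<open>jac e a = 1\<close> jac_eq_0_iff[of d a] jac_eq_0_iff[of e a] by auto
      show "jac d n * jac e n = jac d m * jac e m" if "[n = m] (mod int (d * e))" for n m
      proof -
        have "[n = m] (mod int d)" "[n = m] (mod int e)"
          by (rule cong_dvd_modulus[OF that]; simp)+
        thus ?thesis using jac_cong by metis
      qed
      show "\<bar>jac d n * jac e n\<bar> \<le> 1" for n
        using jac_values[of d n] jac_values[of e n] by auto
    qed (use h in \<open>auto simp: jac_mult\<close>)
  qed
  have "prime_factors d \<noteq> prime_factors e" using squarefree_eq_prod_prime_factors assms
    by metis
  then consider r where "r \<in> prime_factors d" "r \<notin> prime_factors e"
    | r where "r \<in> prime_factors e" "r \<notin> prime_factors d" by blast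
  thus ?thesis
  proof cases
    case 1
    hence "\<not> r dvd e" using assms by (auto simp: in_prime_factors_iff)
    thus ?thesis using * assms 1 by blast
  next
    case 2
    hence "\<not> r dvd d" using assms by (auto simp: in_prime_factors_iff)
    from *[OF assms(3,4,1,2) 2(1) this] show ?thesis by (simp add: mult.commute)
  qed
qed

text \<open>Duality: the absolute values become signs \<open>s d\<close>, the sums are interchanged,
  and Cauchy-Schwarz in n followed by opening the square leaves correlations of two symbols. Writing
  e for the number of d and A for the sum of squares, this gives (e V)^2 <= A (e N + e^2 M^2);
  \<open>cond\<close> says that the part with M^2 is at most half of the left side, so it is
  absorbed.\<close>

lemma large_values:
  fixes a :: "nat \<Rightarrow> real" and V :: real
  assumes E: "finite E" "\<And>d. d \<in> E \<Longrightarrow> odd d \<and> squarefree d \<and> real d \<le> M"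
    and V: "V > 0" "\<And>d. d \<in> E \<Longrightarrow> V \<le> \<bar>\<Sum>n<N. a n * of_int (jac d (int n))\<bar>"
    and cond: "2 * (\<Sum>n<N. (a n)\<^sup>2) * M\<^sup>2 \<le> V\<^sup>2"
  shows "real (card E) * V\<^sup>2 \<le> 2 * (\<Sum>n<N. (a n)\<^sup>2) * real N"
proof -
  define S where "S = (\<lambda>d. \<Sum>n<N. a n * of_int (jac d (int n)))"
  define s where "s = (\<lambda>d. sgn (S d))"
  define A where "A = (\<Sum>n<N. (a n)\<^sup>2)"
  define e where "e = real (card E)"
  define G where "G = (\<lambda>d f. \<Sum>n<N. real_of_int (jac d (int n) * jac f (int n)))"
  have s1: "\<bar>s d\<bar> \<le> 1" for d by (simp add: s_def sgn_if)
  have A0: "A \<ge> 0" unfolding A_def by (intro sum_nonneg) auto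
  have "e * V = (\<Sum>d\<in>E. V)" by (simp add: e_def)
  also have "\<dots> \<le> (\<Sum>d\<in>E. \<bar>S d\<bar>)" unfolding S_def by (intro sum_mono V)
  also have "\<dots> = (\<Sum>d\<in>E. s d * S d)" by (simp add: s_def abs_sgn mult.commute)
  also have "\<dots> = (\<Sum>d\<in>E. \<Sum>n<N. a n * (s d * of_int (jac d (int n))))"
    by (simp add: S_def sum_distrib_left mult_ac)
  also have "\<dots> = (\<Sum>n<N. a n * (\<Sum>d\<in>E. s d * of_int (jac d (int n))))"
    by (subst sum.swap) (simp add: sum_distrib_left)
  finally have 1: "e * V \<le> (\<Sum>n<N. a n * (\<Sum>d\<in>E. s d * of_int (jac d (int n))))" .
  have "(e * V)\<^sup>2 \<le> (\<Sum>n<N. a n * (\<Sum>d\<in>E. s d * of_int (jac d (int n))))\<^sup>2"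
    using 1 V by (intro power_mono) (auto simp: e_def)
  also have "\<dots> \<le> A * (\<Sum>n<N. (\<Sum>d\<in>E. s d * of_int (jac d (int n)))\<^sup>2)"
    unfolding A_def by (rule Cauchy_Schwarz_ineq_sum)
  also have "(\<Sum>n<N. (\<Sum>d\<in>E. s d * of_int (jac d (int n)))\<^sup>2)
      = (\<Sum>n<N. \<Sum>d\<in>E. \<Sum>f\<in>E. s d * s f * real_of_int (jac d (int n) * jac f (int n)))"
    by (simp add: power2_eq_square sum_product mult_ac)
  also have "\<dots> = (\<Sum>d\<in>E. \<Sum>f\<in>E. s d * s f * G d f)"
    by (subst sum.swap, rule sum.cong, rule refl, subst sum.swap) (simp add: G_def sum_distrib_left)
  \<comment> \<open>N bounds the diagonal correlations and M^2 all others; granting M^2 to the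
    diagonal as well keeps the right side uniform.\<close>
  also have "\<dots> \<le> (\<Sum>d\<in>E. \<Sum>f\<in>E. (if d = f then real N else 0) + M\<^sup>2)"
  proof (intro sum_mono)
    fix d f assume df: "d \<in> E" "f \<in> E"
    have M0: "M \<ge> 0" using E(2)[OF df(1)] by (meson of_nat_0_le_iff order_trans)
    have "\<bar>s d * s f\<bar> \<le> 1" using s1 by (simp only: abs_mult mult_le_one abs_ge_zero)
    hence "\<bar>s d * s f\<bar> * \<bar>G d f\<bar> \<le> 1 * \<bar>G d f\<bar>" by (rule mult_right_mono) simp
    hence "s d * s f * G d f \<le> \<bar>G d f\<bar>"
      using abs_ge_self[of "s d * s f * G d f"] by (simp only: abs_mult mult_1_left)
    also have "\<dots> \<le> (if d = f then real N else 0) + M\<^sup>2"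
    proof (cases "d = f")
      case True
      have "\<bar>G d f\<bar> \<le> (\<Sum>n<N. 1)" unfolding G_def
      proof (rule order_trans[OF sum_abs sum_mono])
        fix n show "\<bar>real_of_int (jac d (int n) * jac f (int n))\<bar> \<le> 1"
          using jac_values[of d n] jac_values[of f n] by auto
      qed
      thus ?thesis using True by (simp add: add_increasing2)
    next
      case False
      have "\<bar>G d f\<bar> = real_of_int \<bar>\<Sum>n<N. jac d (int n) * jac f (int n)\<bar>"
        unfolding G_def by simp
      also have "\<dots> \<le> real_of_int (int (d * f))"
        unfolding of_int_le_iff using E(2)[OF df(1)] E(2)[OF df(2)] False by (intro jac_orthogonal) auto
      also have "\<dots> = real d * real f" by simp
      also have "\<dots> \<le> M * M" using E(2)[OF df(1)] E(2)[OF df(2)] M0 by (intro mult_mono) auto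
      finally show ?thesis using False by (simp add: power2_eq_square)
    qed
    finally show "s d * s f * G d f \<le> (if d = f then real N else 0) + M\<^sup>2" .
  qed
  also have "\<dots> = e * real N + e\<^sup>2 * M\<^sup>2"
    using E(1) by (simp add: sum.distrib e_def power2_eq_square algebra_simps)
  finally have "(e * V)\<^sup>2 \<le> A * (e * real N + e\<^sup>2 * M\<^sup>2)" using A0 by (simp add: mult_left_mono)
  moreover have "e\<^sup>2 * (2 * A * M\<^sup>2) \<le> e\<^sup>2 * V\<^sup>2" using cond
    unfolding A_def by (intro mult_left_mono) auto
  ultimately have *: "e * (e * V\<^sup>2) \<le> e * (2 * A * real N)"
    by (simp add: power2_eq_square algebra_simps)
  show ?thesis
  proof (cases "e = 0")
    case False
    hence "e > 0" by (simp add: e_def)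
    thus ?thesis using * unfolding e_def A_def by simp
  qed (use A0 in \<open>simp add: e_def A_def\<close>)
qed

lemma sum_power_lists:
  fixes f :: "'a \<Rightarrow> 'b::comm_semiring_1"
  assumes "finite B"
  shows "(\<Sum>x\<in>B. f x) ^ k = (\<Sum>xs | set xs \<subseteq> B \<and> length xs = k. prod_list (map f xs))"
proof (induction k)
  case 0
  have "{xs. set xs \<subseteq> B \<and> length xs = 0} = {[]}" by auto
  thus ?case by simp
next
  case (Suc k)
  let ?L = "{xs. set xs \<subseteq> B \<and> length xs = k}"
  have "(\<Sum>xs | set xs \<subseteq> B \<and> length xs = Suc k. prod_list (map f xs))
      = (\<Sum>xs\<in>(\<lambda>(xs, n). n # xs) ` (?L \<times> B). prod_list (map f xs))"
    by (simp only: lists_length_Suc_eq)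
  also have "\<dots> = (\<Sum>(xs, x)\<in>?L \<times> B. f x * prod_list (map f xs))"
    by (subst sum.reindex) (auto intro!: inj_onI sum.cong)
  also have "\<dots> = (\<Sum>xs\<in>?L. \<Sum>x\<in>B. f x * prod_list (map f xs))"
    by (simp add: sum.cartesian_product)
  also have "\<dots> = (\<Sum>x\<in>B. f x) * (\<Sum>xs\<in>?L. prod_list (map f xs))"
    by (subst sum.swap) (simp add: sum_product)
  finally show ?case using Suc by simp
qed

text \<open>All lists of primes with product n are orderings of one multiset, the prime
  factorization of n.\<close>

lemma card_prime_lists_prod_le:
  assumes "\<And>p. p \<in> B \<Longrightarrow> prime p"
  shows "card {xs. set xs \<subseteq> B \<and> length xs = k \<and> prod_list xs = (n::nat)} \<le> fact k"
proof -
  have mset: "mset xs = prime_factorization n"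
    if "set xs \<subseteq> B" "length xs = k" "prod_list xs = n" for xs
  proof -
    have "prime_factorization (prod_mset (mset xs)) = mset xs"
      using that(1) assms by (intro prime_factorization_prod_mset_primes) auto
    thus ?thesis using that(3) by (simp add: prod_mset_prod_list)
  qed
  show ?thesis
  proof (cases "{xs. set xs \<subseteq> B \<and> length xs = k \<and> prod_list xs = n} = {}")
    case False
    then obtain xs where "set xs \<subseteq> B" "length xs = k" "prod_list xs = n" by auto
    from mset[OF this] this have size: "size (prime_factorization n) = k"
      by (metis size_mset)
    have "card {xs. set xs \<subseteq> B \<and> length xs = k \<and> prod_list xs = n}
        \<le> card (permutations_of_multiset (prime_factorization n))"
      using mset by (intro card_mono) (auto intro: permutations_of_multisetI)
    also have "\<dots> \<le> fact k" by (simp add: card_permutations_of_multiset size)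
    finally show ?thesis .
  next
    case True
    show ?thesis unfolding True by simp
  qed
qed

text \<open>The large values inequality needs long sums, so a short sum over primes is raised to its
  \<open>k\<close>-th power; unique factorisation bounds the new coefficients.\<close>

lemma large_values_primes:
  fixes c :: "nat \<Rightarrow> real" and V c0 R :: real
  assumes E: "finite E" "\<And>d. d \<in> E \<Longrightarrow> odd d \<and> squarefree d \<and> real d \<le> M"
    and B: "finite B" "\<And>p. p \<in> B \<Longrightarrow> prime p" "\<And>p. p \<in> B \<Longrightarrow> p \<le> R" "card B \<le> R"
    and c: "\<And>p. p \<in> B \<Longrightarrow> \<bar>c p\<bar> \<le> c0" "c0 \<ge> 0"
    and V: "V > 0" "\<And>d. d \<in> E \<Longrightarrow> V \<le> \<bar>\<Sum>p\<in>B. c p * of_int (jac d (int p))\<bar>"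
    and cond: "2 * (fact k * R ^ k * c0 ^ (2 * k)) * M\<^sup>2 \<le> V ^ (2 * k)"
  shows "real (card E) * V ^ (2 * k) \<le> 2 * (fact k * R ^ k * c0 ^ (2 * k)) * (R ^ k + 1)"
proof -
  define L where "L = {xs. set xs \<subseteq> B \<and> length xs = k}"
  define N where "N = nat \<lfloor>R ^ k\<rfloor> + 1"
  define a where "a = (\<lambda>n. \<Sum>xs | xs \<in> L \<and> prod_list xs = n. prod_list (map c xs))"
  have finL: "finite L" unfolding L_def using B(1) by (rule finite_lists_length_eq)
  have R0: "R \<ge> 0" using B(4) by (meson of_nat_0_le_iff order_trans)
  have NR: "real N \<le> R ^ k + 1" unfolding N_def using R0 by simp
  have prod_le: "real (prod_list xs) \<le> R ^ length xs" if "set xs \<subseteq> B" for xs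
    using that
  proof (induction xs)
    case (Cons x xs)
    thus ?case using B(3)[of x] by (auto intro!: mult_mono R0)
  qed auto
  have lt: "prod_list xs < N" if "xs \<in> L" for xs
  proof -
    have "real (prod_list xs) \<le> R ^ k" using prod_le that by (auto simp: L_def)
    hence "int (prod_list xs) \<le> \<lfloor>R ^ k\<rfloor>" by (simp add: le_floor_iff)
    thus ?thesis by (simp add: N_def)
  qed
  have c_le: "\<bar>prod_list (map c xs)\<bar> \<le> c0 ^ length xs" if "set xs \<subseteq> B" for xs
    using that
  proof (induction xs)
    case (Cons x xs)
    thus ?case using c by (auto simp: abs_mult intro!: mult_mono)
  qed auto
  have group: "(\<Sum>n<N. \<Sum>xs | xs \<in> L \<and> prod_list xs = n. g xs) = (\<Sum>xs\<in>L. g xs)"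
    for g :: "nat list \<Rightarrow> real"
    using sum.group[of L "{..<N}" prod_list g] finL lt by auto
  have pow: "(\<Sum>n<N. a n * of_int (jac d (int n))) = (\<Sum>p\<in>B. c p * of_int (jac d (int p))) ^ k"
    if "odd d" for d
  proof -
    have "(\<Sum>n<N. a n * of_int (jac d (int n))) =
      (\<Sum>n<N. \<Sum>xs | xs \<in> L \<and> prod_list xs = n. prod_list (map c xs) * of_int (jac d (int (prod_list xs))))"
      unfolding a_def by (auto simp: sum_distrib_right intro!: sum.cong)
    also have "\<dots> = (\<Sum>xs\<in>L. prod_list (map c xs) * of_int (jac d (int (prod_list xs))))"
      by (rule group)
    also have "\<dots> = (\<Sum>xs\<in>L. prod_list (map (\<lambda>p. c p * of_int (jac d (int p))) xs))"
    proof (intro sum.cong refl)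
      fix xs
      show "prod_list (map c xs) * of_int (jac d (int (prod_list xs)))
          = prod_list (map (\<lambda>p. c p * of_int (jac d (int p))) xs)"
        using that by (induction xs) (auto simp: jac_mult mult_ac)
    qed
    also have "\<dots> = (\<Sum>p\<in>B. c p * of_int (jac d (int p))) ^ k"
      unfolding L_def by (rule sum_power_lists[OF B(1), symmetric])
    finally show ?thesis .
  qed
  \<comment> \<open>The coefficient at n is at most c0^k times the number of lists with product n.
    In its square one such number is replaced by k!, while the other, summed over n, counts all
    lists, of which there are \<open>card B ^ k\<close>.\<close>
  have "(\<Sum>n<N. (a n)\<^sup>2) \<le> (\<Sum>n<N. fact k * c0 ^ (2 * k) * (\<Sum>xs | xs \<in> L \<and> prod_list xs = n. 1))"
  proof (intro sum_mono)
    fix n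
    define F where "F = {xs \<in> L. prod_list xs = n}"
    have "card F \<le> fact k" unfolding F_def L_def using card_prime_lists_prod_le[OF B(2)]
      by (simp add: conj_assoc)
    hence cF: "real (card F) \<le> fact k" by (metis of_nat_fact of_nat_le_iff)
    have "\<bar>a n\<bar> \<le> (\<Sum>xs\<in>F. c0 ^ k)" unfolding a_def F_def
      by (rule order_trans[OF sum_abs sum_mono]) (use c_le in \<open>auto simp: L_def\<close>)
    hence "\<bar>a n\<bar> \<le> real (card F) * c0 ^ k" by simp
    hence "(a n)\<^sup>2 \<le> (real (card F) * c0 ^ k)\<^sup>2" by (metis abs_ge_zero power2_abs power_mono)
    also have "\<dots> = real (card F) * (real (card F) * c0 ^ (2 * k))"
      unfolding power_even_eq by (simp add: power2_eq_square mult_ac)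
    also have "\<dots> \<le> fact k * (real (card F) * c0 ^ (2 * k))"
      using cF c(2) by (intro mult_right_mono) auto
    finally show "(a n)\<^sup>2 \<le> fact k * c0 ^ (2 * k) * (\<Sum>xs | xs \<in> L \<and> prod_list xs = n. 1)"
      by (simp add: F_def mult_ac)
  qed
  also have "\<dots> = fact k * c0 ^ (2 * k) * real (card L)"
    using group[of "\<lambda>_. 1"] by (simp flip: sum_distrib_left)
  also have "real (card L) = real (card B) ^ k"
    unfolding L_def using card_lists_length_eq[OF B(1)] by simp
  also have "fact k * c0 ^ (2 * k) * real (card B) ^ k \<le> fact k * c0 ^ (2 * k) * R ^ k"
    using B(4) c(2) by (intro mult_left_mono power_mono) auto
  finally have A: "(\<Sum>n<N. (a n)\<^sup>2) \<le> fact k * R ^ k * c0 ^ (2 * k)" by (simp add: mult_ac)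
  have "real (card E) * (V ^ k)\<^sup>2 \<le> 2 * (\<Sum>n<N. (a n)\<^sup>2) * real N"
  proof (rule large_values[OF E])
    show "V ^ k \<le> \<bar>\<Sum>n<N. a n * of_int (jac d (int n))\<bar>" if "d \<in> E" for d
      using V(2)[OF that] V(1) E(2)[OF that] pow[of d] by (simp add: power_abs power_mono)
    have "2 * (\<Sum>n<N. (a n)\<^sup>2) * M\<^sup>2 \<le> 2 * (fact k * R ^ k * c0 ^ (2 * k)) * M\<^sup>2"
      using A by (intro mult_right_mono mult_left_mono) auto
    also note cond
    finally show "2 * (\<Sum>n<N. (a n)\<^sup>2) * M\<^sup>2 \<le> (V ^ k)\<^sup>2"
      by (simp only: power_even_eq)
  qed (use V in auto)
  also have "\<dots> \<le> 2 * (fact k * R ^ k * c0 ^ (2 * k)) * (R ^ k + 1)"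
    using A NR R0 by (intro mult_mono) (auto intro!: mult_nonneg_nonneg sum_nonneg c)
  finally show ?thesis by (simp only: power_even_eq)
qed

subsection \<open>Discriminants with prescribed character values\<close>

text \<open>On odd numbers this is the nonprincipal character modulo 4; the value -1 at even numbers
  is a default.\<close>

definition sgn4 :: "nat \<Rightarrow> int" where "sgn4 n = (if n mod 4 = 1 then 1 else -1)"

lemma sgn4_mult: "odd m \<Longrightarrow> odd n \<Longrightarrow> sgn4 (m * n) = sgn4 m * sgn4 n"
proof -
  assume "odd m" "odd n"
  have aux: "x mod 4 = 1 \<or> x mod 4 = 3" if "odd x" for x :: nat using that by presburger
  obtain x y where xy: "x = m mod 4" "y = n mod 4" by blast
  have "x = 1 \<or> x = 3" "y = 1 \<or> y = 3"
    unfolding xy using aux \<open>odd m\<close> \<open>odd n\<close> by blast+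
  moreover have "(m * n) mod 4 = (x * y) mod 4" unfolding xy by (rule mod_mult_eq[symmetric])
  ultimately show ?thesis unfolding sgn4_def xy(1)[symmetric] xy(2)[symmetric] by auto
qed

lemma minus_one_power_half: "odd r \<Longrightarrow> (-1) ^ ((r - 1) div 2) = sgn4 r"
proof -
  assume "odd r"
  then obtain k where k: "r = 2 * k + 1" by (metis oddE)
  show ?thesis
  proof (cases "even k")
    case True
    then obtain j where "k = 2 * j" by blast
    thus ?thesis using k by (simp add: sgn4_def)
  next
    case False
    then obtain j where "k = 2 * j + 1" by (metis oddE)
    hence "r = 4 * j + 3" using k by simp
    thus ?thesis using k False by (simp add: sgn4_def)
  qed
qed

lemma Legendre_prod:
  assumes "prime (p::nat)" "p > 2" "finite A"
  shows "Legendre (int (\<Prod>A)) (int p) = (\<Prod>r\<in>A. Legendre (int r) (int p))"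
  using assms(3)
proof (induction rule: finite_induct)
  case empty
  thus ?case using Legendre_1[OF assms(1)] by simp
next
  case (insert r A)
  thus ?case using assms by (simp add: Legendre_mult)
qed

lemma sgn4_prod: "finite A \<Longrightarrow> (\<And>r. r \<in> A \<Longrightarrow> odd r) \<Longrightarrow> sgn4 (\<Prod>A) = (\<Prod>r\<in>A. sgn4 r) \<and> odd (\<Prod>A)"
proof (induction rule: finite_induct)
  case (insert r A)
  thus ?case by (simp add: sgn4_mult)
qed (simp add: sgn4_def)

text \<open>Each prime factor r of d contributes the reciprocity sign
  \<open>sgn4 r ^ ((p - 1) div 2)\<close>, and the product of these is a power of
  \<open>sgn4 d = 1\<close>. A condition on the value at p thus becomes a condition on d modulo
  p.\<close>

lemma jac_reciprocity:
  assumes "squarefree d" "d mod 4 = 1" "prime p" "p > 2" "\<not> p dvd d"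
  shows "jac d (int p) = Legendre (int d) (int p)"
proof -
  have odd: "odd d" using assms(2) by presburger
  have "jac d (int p) = (\<Prod>r\<in>prime_factors d. sgn4 r ^ ((p - 1) div 2) * Legendre (int r) (int p))"
    unfolding jac_def
  proof (intro prod.cong refl)
    fix r assume r: "r \<in> prime_factors d"
    have pr: "prime r" "r > 2" using odd_prime_factor[OF odd r] by auto
    have "r \<noteq> p" using r assms(5) by auto
    have or: "odd r" using pr prime_odd_nat by blast
    have "\<not> int p dvd int r"
      using primes_dvd_imp_eq[OF assms(3) pr(1)] \<open>r \<noteq> p\<close> by (auto simp: int_dvd_int_iff)
    hence 1: "Legendre (int r) (int p) \<in> {-1, 1}"
      using Legendre_values[of "int r" "int p"] Legendre_0_iff by auto
    have "Legendre (int p) (int r) * Legendre (int r) (int p) = (-1) ^ ((p - 1) div 2 * ((r - 1) div 2))"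
      using Quadratic_Reciprocity pr assms \<open>r \<noteq> p\<close> by blast
    also have "\<dots> = sgn4 r ^ ((p - 1) div 2)"
      by (subst mult.commute, subst power_mult, subst minus_one_power_half[OF or]) simp
    finally show "Legendre (int p) (int r) = sgn4 r ^ ((p - 1) div 2) * Legendre (int r) (int p)"
      using 1 by auto
  qed
  also have "\<dots> = (\<Prod>r\<in>prime_factors d. sgn4 r) ^ ((p - 1) div 2) *
      (\<Prod>r\<in>prime_factors d. Legendre (int r) (int p))"
    by (simp add: prod.distrib prod_power_distrib)
  also have "(\<Prod>r\<in>prime_factors d. sgn4 r) = sgn4 (\<Prod>(prime_factors d))"
    using sgn4_prod[of "prime_factors d"] odd_prime_factor[OF odd] prime_odd_nat by force
  also have "\<Prod>(prime_factors d) = d" using squarefree_eq_prod_prime_factors[OF assms(1)] by simp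
  also have "sgn4 d = 1" using assms by (simp add: sgn4_def)
  also have "(\<Prod>r\<in>prime_factors d. Legendre (int r) (int p)) = Legendre (int d) (int p)"
    using Legendre_prod[OF assms(3,4), of "prime_factors d"]
      squarefree_eq_prod_prime_factors[OF assms(1)] by simp
  finally show ?thesis by simp
qed

lemma odd_coprime_4: "odd (p::nat) \<Longrightarrow> coprime p 4"
proof -
  assume "odd p"
  have "4 = (2::nat) ^ 2" by simp
  show ?thesis unfolding \<open>4 = 2 ^ 2\<close> coprime_power_right_iff coprime_right_2_iff_odd using \<open>odd p\<close> by simp
qed

text \<open>Through \<open>jac_reciprocity\<close>, prescribing the character at the primes in P
  follows from placing d in a suitable class modulo 4 times their product. Many classes qualify; a
  single one already loses only a factor D(x)^o(1).\<close>

lemma residue_class_exists: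
  assumes "\<eta> \<in> {-1, 1}" "finite P" "\<And>p. p \<in> P \<Longrightarrow> prime p \<and> p > 2"
  shows "\<exists>a. [a = 1] (mod 4) \<and> (\<forall>p\<in>P. Legendre a (int p) = \<eta>)"
  using assms(2,3)
proof (induction rule: finite_induct)
  case (insert p P)
  then obtain a where a: "[a = 1] (mod 4)" "\<forall>p\<in>P. Legendre a (int p) = \<eta>" by auto
  have p: "prime p" "p > 2" using insert by auto
  obtain b where b: "Legendre b (int p) = \<eta>"
    using assms(1) Legendre_1 Legendre_minus_one_exists p by blast
  have "coprime p 4" using p prime_odd_nat[of p] by (intro odd_coprime_4) auto
  moreover have "coprime p q" if "q \<in> P" for q
    using that insert p by (intro primes_coprime) auto
  ultimately have "coprime p (4 * \<Prod>P)" by (auto intro!: prod_coprime_right)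
  hence "coprime (int p) (int (4 * \<Prod>P))" by (simp only: coprime_int_iff)
  then obtain x where x: "[x = b] (mod int p)" "[x = a] (mod int (4 * \<Prod>P))"
    using binary_chinese_remainder_int by blast
  have "[x = a] (mod int 4)" by (rule cong_dvd_modulus[OF x(2)]) simp
  hence "[x = 1] (mod 4)" using a(1) cong_trans by simp blast
  moreover have "Legendre x (int q) = \<eta>" if "q \<in> P" for q
  proof -
    have "q dvd 4 * \<Prod>P" using that insert by (intro dvd_mult dvd_prodI) auto
    hence "[x = a] (mod int q)" by (intro cong_dvd_modulus[OF x(2)]) (simp only: int_dvd_int_iff)
    thus ?thesis using a(2) that Legendre_cong by metis
  qed
  ultimately show ?case using b x(1) Legendre_cong by (metis insert_iff)
qed (auto intro: exI[of _ 1])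

lemma card_residue_class_ge:
  assumes "m > (0::nat)"
  shows "real (card {d\<in>{1..M}. [int d = a] (mod int m)}) \<ge> real M / real m - 2"
proof -
  define r where "r = nat (a mod int m)"
  have r: "r < m" "[a = int r] (mod int m)"
    using assms by (auto simp: r_def nat_less_iff unique_euclidean_semiring_class.cong_def)
  \<comment> \<open>Starting at k = 1 avoids the element 0 when r = 0, and stopping before
    \<open>M div m\<close> keeps k m + r below M. Together with the rounding this costs the
    2.\<close>
  have "{d\<in>{1..M}. [int d = a] (mod int m)} \<supseteq> (\<lambda>k. k * m + r) ` {1..<M div m}"
  proof
    fix x assume "x \<in> (\<lambda>k. k * m + r) ` {1..<M div m}"
    then obtain k where "x = k * m + r" "k \<in> {1..<M div m}" by blast
    hence k: "x = k * m + r" "k \<ge> 1" "k + 1 \<le> M div m" by auto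
    have "x \<le> (k + 1) * m" using k r by simp
    also have "\<dots> \<le> (M div m) * m" using k by (intro mult_right_mono) auto
    also have "\<dots> \<le> M" by simp
    finally have "x \<le> M" .
    moreover have "[int x = a] (mod int m)"
      using r(2) k(1) by (simp add: unique_euclidean_semiring_class.cong_def)
    moreover have "x \<ge> 1" using k assms by (simp add: Suc_le_eq add_pos_nonneg)
    ultimately show "x \<in> {d\<in>{1..M}. [int d = a] (mod int m)}" by auto
  qed
  hence "card ((\<lambda>k. k * m + r) ` {1..<M div m}) \<le> card {d\<in>{1..M}. [int d = a] (mod int m)}"
    by (intro card_mono) auto
  also have "card ((\<lambda>k. k * m + r) ` {1..<M div m}) = M div m - 1"
    using assms by (subst card_image) (auto intro!: inj_onI)
  finally have "real (M div m) - 1 \<le> real (card {d\<in>{1..M}. [int d = a] (mod int m)})" by linarith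
  moreover have "real M / real m < real (M div m) + 1"
    by (metis floor_divide_of_nat_eq of_int_of_nat_eq real_of_int_floor_add_one_gt)
  ultimately show ?thesis by linarith
qed

text \<open>The class modulo m together with divisibility by n fixes d modulo m n, so d is
  determined by \<open>d div (m * n)\<close>.\<close>

lemma card_residue_class_le:
  assumes "m > (0::nat)" "n > 0" "coprime m n"
  shows "real (card {d\<in>{1..M}. [int d = a] (mod int m) \<and> n dvd d}) \<le> real M / (real m * real n) + 1"
proof -
  let ?S = "{d\<in>{1..M}. [int d = a] (mod int m) \<and> n dvd d}"
  have "inj_on (\<lambda>d. d div (m * n)) ?S"
  proof (rule inj_onI)
    fix x y assume xy: "x \<in> ?S" "y \<in> ?S" "x div (m * n) = y div (m * n)"
    have "[int x = int y] (mod int m)" using xy by (metis (mono_tags, lifting) cong_sym cong_trans mem_Collect_eq)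
    hence 1: "[x = y] (mod m)" by (simp add: cong_int_iff)
    have "[x = y] (mod n)" using xy by (auto simp: unique_euclidean_semiring_class.cong_def)
    hence "[x = y] (mod (m * n))" using 1 assms(3) coprime_cong_mult_nat by blast
    hence "x mod (m * n) = y mod (m * n)" by (simp add: unique_euclidean_semiring_class.cong_def)
    thus "x = y" using xy(3) by (metis div_mult_mod_eq)
  qed
  hence "card ?S = card ((\<lambda>d. d div (m * n)) ` ?S)" by (simp add: card_image)
  also have "\<dots> \<le> card {..M div (m * n)}" by (intro card_mono) (auto intro: div_le_mono)
  also have "\<dots> = M div (m * n) + 1" by simp
  finally have "real (card ?S) \<le> real (M div (m * n)) + 1" by linarith
  also have "real (M div (m * n)) \<le> real M / (real m * real n)"
    using of_nat_div_le_of_nat[of M "m * n"] by simp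
  finally show ?thesis by simp
qed

lemma sum_inverse_squares_le:
  assumes "w > 0"
  shows "(\<Sum>n\<in>{w<..s}. 1 / (real n)\<^sup>2) \<le> 1 / real w"
proof -
  have "(\<Sum>n\<in>{w<..s}. 1 / (real n)\<^sup>2) \<le> 1 / real w - 1 / real s" if "s \<ge> w"
    using that
  proof (induction s rule: dec_induct)
    case (step s)
    have "{w<..Suc s} = insert (Suc s) {w<..s}" using step by auto
    hence "(\<Sum>n\<in>{w<..Suc s}. 1 / (real n)\<^sup>2) \<le> 1 / (real (Suc s))\<^sup>2 + (1 / real w - 1 / real s)"
      using step by simp
    also have "1 / (real (Suc s))\<^sup>2 \<le> 1 / real s - 1 / real (Suc s)"
      using step assms by (simp add: divide_simps power2_eq_square)
    finally show ?case by simp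
  qed (use assms in auto)
  moreover have "(\<Sum>n\<in>{w<..s}. 1 / (real n)\<^sup>2) = 0" if "s < w" using that by simp
  moreover have "0 \<le> 1 / real s" "0 \<le> 1 / real w" by simp_all
  ultimately show ?thesis by (cases "w \<le> s") linarith+
qed

text \<open>From one residue class modulo Q = 4 times the product of P the non-squarefree members
  are sieved out. A prime whose square divides d is neither 2 nor in P, since d is odd and its
  symbols there are nonzero; so it exceeds w. The sum of 1/p^2 beyond w is at most 1/w <= 1/3, which
  leaves 2/3 of the class, and the rounding errors for p up to sqrt M add up to sqrt M.\<close>

lemma card_discriminants_ge:
  assumes eta: "\<eta> \<in> {-1, 1}" and w: "w \<ge> 3" and M: "M \<ge> 1"
  defines "P \<equiv> {p. prime p \<and> 2 < p \<and> p \<le> w}"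
  shows "real (card {d\<in>{1..M}. odd d \<and> squarefree d \<and> (\<forall>p\<in>P. jac d (int p) = \<eta>)})
    \<ge> 2 / 3 * real M / real (4 * \<Prod>P) - 2 - sqrt (real M)"
proof -
  define Q where "Q = 4 * \<Prod>P"
  have P: "finite P" "\<And>p. p \<in> P \<Longrightarrow> prime p \<and> p > 2"
    by (auto simp: P_def intro: finite_subset[of _ "{..w}"])
  obtain a where a: "[a = 1] (mod 4)" "\<And>p. p \<in> P \<Longrightarrow> Legendre a (int p) = \<eta>"
    using residue_class_exists[OF eta P] by blast
  have Q0: "Q > 0" unfolding Q_def using P by (auto intro!: prod_pos dest: prime_gt_0_nat)
  define T where "T = {d\<in>{1..M}. [int d = a] (mod int Q)}"
  define s where "s = nat \<lfloor>sqrt (real M)\<rfloor>"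
  have T: "d mod 4 = 1 \<and> (\<forall>p\<in>P. Legendre (int d) (int p) = \<eta> \<and> \<not> p dvd d)" if "d \<in> T" for d
  proof -
    have da: "[int d = a] (mod int Q)" using that by (simp add: T_def)
    have "[int d = a] (mod int 4)" by (rule cong_dvd_modulus[OF da]) (simp add: Q_def)
    hence "[int d = int 1] (mod int 4)" using a(1) cong_trans by simp blast
    hence "d mod 4 = 1" by (simp only: cong_int_iff) (simp add: unique_euclidean_semiring_class.cong_def)
    moreover have "Legendre (int d) (int p) = \<eta>" if "p \<in> P" for p
    proof -
      have "p dvd Q" unfolding Q_def using that P by (intro dvd_mult dvd_prodI) auto
      hence "[int d = a] (mod int p)" by (intro cong_dvd_modulus[OF da]) (simp only: int_dvd_int_iff)
      thus ?thesis using a(2)[OF that] Legendre_cong by metis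
    qed
    moreover have "\<not> p dvd d" if "p \<in> P" for p
      using calculation(2)[OF that] eta Legendre_0_iff[of "int d" "int p"] by auto
    ultimately show ?thesis by blast
  qed
  let ?G = "{d\<in>{1..M}. odd d \<and> squarefree d \<and> (\<forall>p\<in>P. jac d (int p) = \<eta>)}"
  let ?B = "\<lambda>p. {d\<in>{1..M}. [int d = a] (mod int Q) \<and> p\<^sup>2 dvd d}"
  have "T \<subseteq> ?G \<union> (\<Union>p\<in>{p\<in>{w<..s}. prime p}. ?B p)"
  proof
    fix d assume d: "d \<in> T"
    have dM: "d \<ge> 1" "d \<le> M" using d by (auto simp: T_def)
    have "d mod 4 = 1" using T[OF d] by blast
    hence odd_d: "odd d" by presburger
    show "d \<in> ?G \<union> (\<Union>p\<in>{p\<in>{w<..s}. prime p}. ?B p)"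
    proof (cases "squarefree d")
      case True
      have "jac d (int p) = \<eta>" if "p \<in> P" for p
        using jac_reciprocity[OF True] T[OF d] P that by auto
      thus ?thesis using dM True odd_d by auto
    next
      case False
      then obtain p where p: "prime p" "p\<^sup>2 dvd d"
        using squarefree_factorial_semiring[of d] dM by auto
      hence pd: "p dvd d" by (metis dvd_trans dvd_triv_left power2_eq_square)
      have "p \<notin> P" using T[OF d] pd by auto
      moreover have "p \<noteq> 2" using odd_d pd by auto
      hence "p > 2" using p prime_ge_2_nat[of p] by simp
      ultimately have "p > w" using p by (auto simp: P_def)
      moreover have "p\<^sup>2 \<le> M" using p dM by (meson dvd_imp_le le_trans less_le_trans zero_less_one)
      hence "(real p)\<^sup>2 \<le> real M" by (metis of_nat_le_iff of_nat_power)
      hence "real p \<le> sqrt (real M)" by (simp add: real_le_rsqrt)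
      hence "p \<le> s" by (simp add: s_def le_nat_floor)
      ultimately show ?thesis using p d dM by (auto simp: T_def)
    qed
  qed
  hence "card T \<le> card (?G \<union> (\<Union>p\<in>{p\<in>{w<..s}. prime p}. ?B p))" by (intro card_mono) auto
  also have "\<dots> \<le> card ?G + card (\<Union>p\<in>{p\<in>{w<..s}. prime p}. ?B p)" by (rule card_Un_le)
  also have "card (\<Union>p\<in>{p\<in>{w<..s}. prime p}. ?B p) \<le> (\<Sum>p\<in>{p\<in>{w<..s}. prime p}. card (?B p))"
    by (rule card_UN_le) auto
  finally have 1: "real (card T) \<le> real (card ?G) + (\<Sum>p\<in>{p\<in>{w<..s}. prime p}. real (card (?B p)))"
    by (simp flip: of_nat_sum of_nat_add)
  have "(\<Sum>p\<in>{p\<in>{w<..s}. prime p}. real (card (?B p)))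
      \<le> (\<Sum>p\<in>{p\<in>{w<..s}. prime p}. real M / real Q * (1 / (real p)\<^sup>2) + 1)"
  proof (intro sum_mono)
    fix p assume p: "p \<in> {p\<in>{w<..s}. prime p}"
    have p': "prime p" "p > 2" using p w by auto
    have "coprime p 4" by (intro odd_coprime_4 prime_odd_nat p')
    moreover have "coprime p q" if "q \<in> P" for q
    proof (rule primes_coprime)
      show "p \<noteq> q" using that p unfolding P_def by auto
    qed (use P(2)[OF that] p' in auto)
    ultimately have "coprime p Q" unfolding Q_def by (auto intro!: prod_coprime_right)
    hence "coprime Q (p\<^sup>2)" by (metis coprime_commute coprime_power_right_iff)
    hence "real (card (?B p)) \<le> real M / (real Q * real (p\<^sup>2)) + 1"
      using Q0 p by (intro card_residue_class_le) (auto dest: prime_gt_0_nat)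
    thus "real (card (?B p)) \<le> real M / real Q * (1 / (real p)\<^sup>2) + 1" by simp
  qed
  also have "\<dots> \<le> (\<Sum>p\<in>{w<..s}. real M / real Q * (1 / (real p)\<^sup>2) + 1)"
    by (intro sum_mono2) auto
  also have "\<dots> \<le> real M / real Q * (\<Sum>p\<in>{w<..s}. 1 / (real p)\<^sup>2) + real s"
    by (simp add: sum.distrib sum_distrib_left)
  also have "\<dots> \<le> real M / real Q * (1 / 3) + sqrt (real M)"
  proof (intro add_mono mult_left_mono)
    have "(\<Sum>p\<in>{w<..s}. 1 / (real p)\<^sup>2) \<le> 1 / real w" using w by (intro sum_inverse_squares_le) auto
    also have "1 / real w \<le> 1 / 3" using w by (simp add: divide_simps)
    finally show "(\<Sum>p\<in>{w<..s}. 1 / (real p)\<^sup>2) \<le> 1 / 3" .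
    show "real s \<le> sqrt (real M)" unfolding s_def by simp
  qed auto
  finally have 2: "(\<Sum>p\<in>{p\<in>{w<..s}. prime p}. real (card (?B p)))
      \<le> real M / real Q * (1 / 3) + sqrt (real M)" .
  have 3: "real (card T) \<ge> real M / real Q - 2" unfolding T_def by (rule card_residue_class_ge[OF Q0])
  show ?thesis using 1 2 3 unfolding Q_def[symmetric] by (simp add: field_simps)
qed

subsection \<open>The zeta function near the line \<open>Re s = 1\<close>\<close>

lemma sum_divisors_swap:
  fixes F :: "nat \<Rightarrow> nat \<Rightarrow> 'a::comm_monoid_add"
  shows "(\<Sum>k=1..N. \<Sum>m | m dvd k. F m (k div m)) = (\<Sum>m=1..N. \<Sum>n=1..N div m. F m n)"
proof -
  have "(\<Sum>k=1..N. \<Sum>m | m dvd k. F m (k div m))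
      = (\<Sum>(k, m)\<in>Sigma {1..N} (\<lambda>k. {m. m dvd k}). F m (k div m))"
    by (intro sum.Sigma) auto
  also have "\<dots> = (\<Sum>(m, n)\<in>Sigma {1..N} (\<lambda>m. {1..N div m}). F m n)"
  proof (rule sum.reindex_bij_witness[of _ "\<lambda>(m, n). (m * n, m)" "\<lambda>(k, m). (m, k div m)"], goal_cases)
    case (1 a)
    thus ?case by auto
  next
    case (2 a)
    then obtain k m where a: "a = (k, m)" "k \<ge> 1" "k \<le> N" "m dvd k" by auto
    hence "m \<ge> 1" "m \<le> k" by (auto simp: Suc_le_eq intro: Nat.gr0I dvd_imp_le)
    moreover have "k div m \<ge> 1" using a \<open>m \<ge> 1\<close> \<open>m \<le> k\<close> by (simp add: Suc_le_eq div_greater_zero_iff)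
    ultimately show ?case using a by (auto intro: div_le_mono)
  next
    case (3 b)
    then obtain m n where b: "b = (m, n)" "m \<ge> 1" by auto
    thus ?case by auto
  next
    case (4 b)
    then obtain m n where b: "b = (m, n)" "m \<ge> 1" "n \<ge> 1" "n \<le> N div m" by auto
    hence "m * n \<le> m * (N div m)" by simp
    also have "\<dots> \<le> N" by simp
    finally show ?case using b by auto
  qed auto
  also have "\<dots> = (\<Sum>m=1..N. \<Sum>n=1..N div m. F m n)"
    by (intro sum.Sigma[symmetric]) auto
  finally show ?thesis .
qed

text \<open>For \<open>n > 0\<close> this is \<open>n\<close> to the power \<open>-s\<close>, but \<open>nps 0 s = 1\<close>, so coefficients vanish at \<open>0\<close>.\<close>

definition nps :: "nat \<Rightarrow> complex \<Rightarrow> complex" where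
  "nps n s = exp (- s * of_real (ln (real n)))"

lemma nps_1 [simp]: "nps (Suc 0) s = 1" by (simp add: nps_def)

lemma norm_nps: "n > 0 \<Longrightarrow> norm (nps n s) = real n powr (- Re s)"
  by (simp add: nps_def powr_def)

lemma nps_mult: "m > 0 \<Longrightarrow> n > 0 \<Longrightarrow> nps (m * n) s = nps m s * nps n s"
  by (simp add: nps_def ln_mult exp_add[symmetric] algebra_simps)

lemma nps_deriv: "(nps n has_field_derivative - of_real (ln (real n)) * nps n s) (at s within A)"
  unfolding nps_def by (auto intro!: derivative_eq_intros)

definition dseries :: "(nat \<Rightarrow> real) \<Rightarrow> complex \<Rightarrow> complex" where
  "dseries a s = (\<Sum>n. of_real (a n) * nps n s)"

text \<open>One growth class for the four coefficient sequences 1, log n, \<Lambda>(n) and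
  \<Lambda>(n)/log n, so that convergence and termwise differentiation are proved once.\<close>

definition log_bounded :: "(nat \<Rightarrow> real) \<Rightarrow> bool" where
  "log_bounded a \<longleftrightarrow> a 0 = 0 \<and> (\<forall>n>0. \<bar>a n\<bar> \<le> 1 + ln (real n))"

definition log_majorant :: "real \<Rightarrow> nat \<Rightarrow> real" where
  "log_majorant \<sigma> n = (if n = 0 then 0 else (1 + ln (real n)) * real n powr (- \<sigma>))"

lemma summable_log_majorant:
  assumes "\<sigma> > 1"
  shows "summable (log_majorant \<sigma>)"
proof (rule summable_comparison_test)
  \<comment> \<open>Half of the gap above 1 absorbs the logarithm, the other half keeps the series
    convergent.\<close>
  define \<delta> where "\<delta> = (\<sigma> - 1) / 2"
  have d: "\<delta> > 0" using assms by (simp add: \<delta>_def)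
  show "summable (\<lambda>n. (1 + 1 / \<delta>) * real n powr (\<delta> - \<sigma>))"
    using assms by (intro summable_mult) (simp add: summable_real_powr_iff \<delta>_def field_simps)
  show "\<exists>N. \<forall>n\<ge>N. norm (log_majorant \<sigma> n) \<le> (1 + 1 / \<delta>) * real n powr (\<delta> - \<sigma>)"
  proof (intro exI allI impI)
    fix n :: nat assume n: "n \<ge> 1"
    have "ln (real n) \<le> real n powr \<delta> / \<delta>" using n d by (intro ln_powr_bound) auto
    moreover have "1 \<le> real n powr \<delta>" using n d by (simp add: ge_one_powr_ge_zero)
    ultimately have "1 + ln (real n) \<le> (1 + 1 / \<delta>) * real n powr \<delta>" by (simp add: algebra_simps)
    hence "(1 + ln (real n)) * real n powr (- \<sigma>) \<le> (1 + 1 / \<delta>) * real n powr \<delta> * real n powr (- \<sigma>)"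
      by (intro mult_right_mono) auto
    thus "norm (log_majorant \<sigma> n) \<le> (1 + 1 / \<delta>) * real n powr (\<delta> - \<sigma>)"
      using n by (simp add: log_majorant_def powr_diff powr_minus field_simps)
  qed
qed

lemma norm_dseries_term_le:
  assumes "log_bounded a" "\<sigma> \<le> Re s"
  shows "norm (of_real (a n) * nps n s) \<le> log_majorant \<sigma> n"
proof (cases "n = 0")
  case False
  hence n: "n \<ge> 1" by simp
  have "\<bar>a n\<bar> * real n powr (- Re s) \<le> (1 + ln (real n)) * real n powr (- \<sigma>)"
    using assms n by (intro mult_mono powr_mono) (auto simp: log_bounded_def)
  thus ?thesis using n by (simp add: norm_mult norm_nps log_majorant_def)
qed (use assms in \<open>auto simp: log_bounded_def log_majorant_def\<close>)

lemma summable_dseries_norm: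
  assumes "log_bounded a" "Re s > 1"
  shows "summable (\<lambda>n. norm (of_real (a n) * nps n s))"
  by (rule summable_comparison_test[OF _ summable_log_majorant[OF assms(2)]])
    (use norm_dseries_term_le[OF assms(1), of "Re s" s] in auto)

lemma dseries_sums:
  assumes "log_bounded a" "Re s > 1"
  shows "(\<lambda>n. of_real (a n) * nps n s) sums dseries a s"
  unfolding dseries_def using summable_norm_cancel[OF summable_dseries_norm[OF assms]]
  by (rule summable_sums)

lemma dseries_deriv:
  assumes "log_bounded a" "Re s > 1"
  shows "((\<lambda>n. of_real (a n) * (- of_real (ln (real n)) * nps n s)) sums deriv (dseries a) s \<and>
    (dseries a has_field_derivative deriv (dseries a) s) (at s))"
proof -
  let ?S = "{s. Re s > 1}"
  have op: "open ?S" by (simp add: open_halfspace_Re_gt)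
  have "\<exists>g g'. \<forall>x\<in>?S. (\<lambda>n. of_real (a n) * nps n x) sums g x \<and>
      (\<lambda>n. of_real (a n) * (- of_real (ln (real n)) * nps n x)) sums g' x \<and> (g has_field_derivative g' x) (at x)"
  proof (rule series_and_derivative_comparison_local[OF op])
    fix x :: complex assume x: "x \<in> ?S"
    define \<sigma> where "\<sigma> = (1 + Re x) / 2"
    have "ball x (Re x - \<sigma>) \<inter> ?S \<subseteq> {s. Re s \<ge> \<sigma>}"
    proof
      fix y assume "y \<in> ball x (Re x - \<sigma>) \<inter> ?S"
      hence "norm (x - y) < Re x - \<sigma>" by (simp add: dist_norm)
      thus "y \<in> {s. Re s \<ge> \<sigma>}" using complex_Re_le_cmod[of "x - y"] by simp
    qed
    thus "\<exists>d h. 0 < d \<and> summable h \<and>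
        (\<forall>\<^sub>F n in sequentially. \<forall>y\<in>ball x d \<inter> ?S. cmod (of_real (a n) * nps n y) \<le> h n)"
      using x norm_dseries_term_le[OF assms(1)]
      by (intro exI[of _ "Re x - \<sigma>"] exI[of _ "log_majorant \<sigma>"] conjI summable_log_majorant always_eventually)
        (auto simp: \<sigma>_def)
  qed (auto intro!: derivative_eq_intros nps_deriv)
  then obtain g g' where g: "\<And>x. Re x > 1 \<Longrightarrow> (\<lambda>n. of_real (a n) * nps n x) sums g x"
    "\<And>x. Re x > 1 \<Longrightarrow> (\<lambda>n. of_real (a n) * (- of_real (ln (real n)) * nps n x)) sums g' x"
    "\<And>x. Re x > 1 \<Longrightarrow> (g has_field_derivative g' x) (at x)" by auto
  have eq: "g x = dseries a x" if "Re x > 1" for x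
    using g(1)[OF that] dseries_sums[OF assms(1) that] sums_unique2 by blast
  have "(dseries a has_field_derivative g' s) (at s)"
    by (rule has_field_derivative_transform_within_open[OF g(3)[OF assms(2)] op])
      (use assms eq in auto)
  thus ?thesis using g(2)[OF assms(2)] DERIV_imp_deriv by metis
qed

text \<open>Every term with n >= 2 decays, so only the coefficient at 1 survives. The limit fixes
  the constant of integration in \<open>zeta_eq_exp\<close>.\<close>

lemma dseries_tendsto_at_top:
  assumes "log_bounded a"
  shows "((\<lambda>\<sigma>. dseries a (of_real \<sigma>)) \<longlongrightarrow> of_real (a 1)) at_top"
proof -
  let ?b = "\<lambda>n. if n = 1 then complex_of_real (a 1) else 0"
  have "(\<forall>\<^sub>F \<sigma> in at_top. summable (\<lambda>n. norm (of_real (a n) * nps n (of_real \<sigma>)))) \<and>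
      summable (\<lambda>n. norm (?b n)) \<and>
      ((\<lambda>\<sigma>. \<Sum>n. of_real (a n) * nps n (of_real \<sigma>)) \<longlongrightarrow> suminf ?b) at_top"
  proof (rule tannerys_theorem)
    fix n
    show "((\<lambda>\<sigma>. of_real (a n) * nps n (of_real \<sigma>)) \<longlongrightarrow> ?b n) at_top"
    proof (cases "n \<le> 1")
      case True
      hence "n = 0 \<or> n = 1" by auto
      thus ?thesis using assms by (auto simp: log_bounded_def)
    next
      case False
      have "((\<lambda>\<sigma>. \<bar>a n\<bar> * real n powr (- \<sigma>)) \<longlongrightarrow> \<bar>a n\<bar> * 0) at_top"
        using False by (intro tendsto_intros) real_asymp
      hence "((\<lambda>\<sigma>. norm (of_real (a n) * nps n (of_real \<sigma>))) \<longlongrightarrow> 0) at_top"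
        using False by (simp add: norm_mult norm_nps)
      thus ?thesis using False by (simp add: tendsto_norm_zero_iff)
    qed
  next
    show "\<forall>\<^sub>F (n, \<sigma>) in sequentially \<times>\<^sub>F at_top. norm (of_real (a n) * nps n (of_real \<sigma>)) \<le> log_majorant 2 n"
      unfolding eventually_prod_filter
      by (intro exI[of _ "\<lambda>_. True"] exI[of _ "\<lambda>\<sigma>. \<sigma> \<ge> (2::real)"])
        (auto intro!: norm_dseries_term_le assms eventually_ge_at_top)
  qed (auto intro: summable_log_majorant)
  moreover have "suminf ?b = of_real (a 1)"
    using suminf_finite[of "{1}" ?b] by auto
  ultimately show ?thesis by (simp add: dseries_def)
qed

definition one_coeff :: "nat \<Rightarrow> real" where "one_coeff n = (if n = 0 then 0 else 1)"

definition ln_coeff :: "nat \<Rightarrow> real" where "ln_coeff n = ln (real n)"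

lemma mangoldt_le_ln: "n > 0 \<Longrightarrow> (mangoldt n :: real) \<le> ln (real n)"
proof -
  assume n: "n > 0"
  have "(mangoldt n :: real) \<le> (\<Sum>d | d dvd n. mangoldt d)"
    using n by (intro member_le_sum) (auto simp: mangoldt_nonneg)
  also have "\<dots> = ln (real n)" using n mangoldt_sum[of n, where 'a = real] by simp
  finally show ?thesis .
qed

text \<open>These are the coefficients of log \<zeta>, namely 1/k at a prime power p^k; the quotient
  is 0 for n <= 1.\<close>

definition mangoldt_ln :: "nat \<Rightarrow> real" where "mangoldt_ln n = mangoldt n / ln (real n)"

lemma mangoldt_ln_bounds: "0 \<le> mangoldt_ln n" "mangoldt_ln n \<le> 1"
proof -
  have "0 \<le> mangoldt_ln n \<and> mangoldt_ln n \<le> 1"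
  proof (cases "n \<le> 1")
    case True
    hence "n = 0 \<or> n = 1" by auto
    thus ?thesis by (auto simp: mangoldt_ln_def)
  next
    case False
    thus ?thesis using mangoldt_le_ln[of n]
      by (auto simp: mangoldt_ln_def mangoldt_nonneg divide_simps)
  qed
  thus "0 \<le> mangoldt_ln n" "mangoldt_ln n \<le> 1" by auto
qed

lemma log_bounded_coeffs [simp, intro]:
  "log_bounded one_coeff" "log_bounded ln_coeff" "log_bounded mangoldt" "log_bounded mangoldt_ln"
proof -
  have "\<bar>mangoldt n :: real\<bar> \<le> 1 + ln (real n)" if "n > 0" for n
    using mangoldt_le_ln[OF that] by simp
  moreover have "\<bar>mangoldt_ln n\<bar> \<le> 1 + ln (real n)" if "n > 0" for n
    using mangoldt_ln_bounds[of n] that by (simp add: add_increasing2)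
  ultimately show "log_bounded one_coeff" "log_bounded ln_coeff" "log_bounded mangoldt" "log_bounded mangoldt_ln"
    by (auto simp: log_bounded_def one_coeff_def ln_coeff_def mangoldt_ln_def)
qed

text \<open>This is \<Lambda> * 1 = log for Dirichlet convolution. Sorting a partial sum by the
  divisor m produces the partial sums \<open>G (N div m)\<close> of \<zeta>; they are bounded by B
  and converge for each fixed m, so Tannery's theorem passes to the limit.\<close>

lemma dseries_convolution:
  assumes s: "Re s > 1"
  shows "dseries mangoldt s * dseries one_coeff s = dseries ln_coeff s"
proof -
  let ?f = "\<lambda>m. of_real (mangoldt m) * nps m s"
  let ?g = "\<lambda>n. of_real (one_coeff n) * nps n s"
  define G where "G = (\<lambda>N. \<Sum>n\<le>N. ?g n)"
  have G: "G \<longlonglongrightarrow> dseries one_coeff s"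
    unfolding G_def using dseries_sums[OF log_bounded_coeffs(1) s] by (simp add: sums_def_le)
  define B where "B = (\<Sum>n. norm (?g n))"
  have GB: "norm (G N) \<le> B" for N
  proof -
    have "norm (G N) \<le> (\<Sum>n\<le>N. norm (?g n))" unfolding G_def by (rule norm_sum)
    also have "\<dots> \<le> B" unfolding B_def
      by (intro sum_le_suminf summable_dseries_norm s log_bounded_coeffs) auto
    finally show ?thesis .
  qed
  have fin: "(\<Sum>k\<le>N. of_real (ln_coeff k) * nps k s) = (\<Sum>m. if m \<in> {1..N} then ?f m * G (N div m) else 0)" for N
  proof -
    have "(\<Sum>k\<le>N. of_real (ln_coeff k) * nps k s) = (\<Sum>k=1..N. of_real (ln_coeff k) * nps k s)"
      by (rule sum.mono_neutral_right) (auto simp: ln_coeff_def not_less_eq_eq)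
    also have "\<dots> = (\<Sum>k=1..N. \<Sum>m | m dvd k. ?f m * nps (k div m) s)"
    proof (intro sum.cong refl)
      fix k assume k: "k \<in> {1..N}"
      have "of_real (ln_coeff k) * nps k s = (\<Sum>m | m dvd k. of_real (mangoldt m) * nps k s)"
        using mangoldt_sum[of k, where 'a = complex] k
        by (simp add: ln_coeff_def flip: sum_distrib_right)
      also have "\<dots> = (\<Sum>m | m dvd k. ?f m * nps (k div m) s)"
      proof (intro sum.cong refl)
        fix m assume "m \<in> {m. m dvd k}"
        hence m: "m dvd k" by simp
        have "m > 0" using m k by (auto intro!: Nat.gr0I)
        moreover have "k div m > 0" using m k by (auto intro!: Nat.gr0I simp: dvd_div_eq_0_iff)
        ultimately have "nps (m * (k div m)) s = nps m s * nps (k div m) s" by (rule nps_mult)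
        thus "of_real (mangoldt m) * nps k s = ?f m * nps (k div m) s" using m by simp
      qed
      finally show "of_real (ln_coeff k) * nps k s = (\<Sum>m | m dvd k. ?f m * nps (k div m) s)" .
    qed
    also have "\<dots> = (\<Sum>m=1..N. \<Sum>n=1..N div m. ?f m * nps n s)"
      by (rule sum_divisors_swap)
    also have "\<dots> = (\<Sum>m=1..N. ?f m * G (N div m))"
    proof (intro sum.cong refl)
      fix m
      have "G (N div m) = (\<Sum>n=1..N div m. ?g n)" unfolding G_def
        by (rule sum.mono_neutral_right) (auto simp: one_coeff_def)
      also have "\<dots> = (\<Sum>n=1..N div m. nps n s)" by (intro sum.cong) (auto simp: one_coeff_def)
      finally show "(\<Sum>n=1..N div m. ?f m * nps n s) = ?f m * G (N div m)"
        by (simp add: sum_distrib_left)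
    qed
    also have "\<dots> = (\<Sum>m. if m \<in> {1..N} then ?f m * G (N div m) else 0)"
      by (subst suminf_finite[of "{1..N}"]) auto
    finally show ?thesis .
  qed
  have "(\<lambda>N. \<Sum>m. if m \<in> {1..N} then ?f m * G (N div m) else 0) \<longlonglongrightarrow> (\<Sum>m. ?f m * dseries one_coeff s)"
  proof (rule conjunct2[OF conjunct2[OF tannerys_theorem]])
    fix m
    show "(\<lambda>N. if m \<in> {1..N} then ?f m * G (N div m) else 0) \<longlonglongrightarrow> ?f m * dseries one_coeff s"
    proof (cases "m = 0")
      case False
      have "filterlim (\<lambda>N. N div m) at_top sequentially"
        unfolding filterlim_at_top
      proof
        fix Z
        show "\<forall>\<^sub>F N in sequentially. Z \<le> N div m"
          using eventually_ge_at_top[of "Z * m"]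
          by eventually_elim (use False in \<open>simp add: less_eq_div_iff_mult_less_eq\<close>)
      qed
      hence "(\<lambda>N. ?f m * G (N div m)) \<longlonglongrightarrow> ?f m * dseries one_coeff s"
        by (intro tendsto_intros filterlim_compose[OF G])
      moreover have "\<forall>\<^sub>F N in sequentially. ?f m * G (N div m) = (if m \<in> {1..N} then ?f m * G (N div m) else 0)"
        using eventually_ge_at_top[of m] by eventually_elim (use False in auto)
      ultimately show ?thesis by (rule Lim_transform_eventually)
    qed auto
  next
    have "norm (if m \<in> {1..N} then ?f m * G (N div m) else 0) \<le> norm (?f m) * B" for m N
      using GB[of "N div m"] order_trans[OF norm_ge_zero GB[of 0]]
      by (auto simp: norm_mult mangoldt_nonneg intro!: mult_left_mono mult_nonneg_nonneg)
    thus "\<forall>\<^sub>F (m, N) in sequentially \<times>\<^sub>F sequentially.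
        norm (if m \<in> {1..N} then ?f m * G (N div m) else 0) \<le> norm (?f m) * B"
      by (intro always_eventually) auto
    show "summable (\<lambda>m. norm (?f m) * B)"
      by (intro summable_mult2 summable_dseries_norm s log_bounded_coeffs)
  qed auto
  moreover have "(\<lambda>N. \<Sum>k\<le>N. of_real (ln_coeff k) * nps k s) \<longlonglongrightarrow> dseries ln_coeff s"
    using dseries_sums[OF log_bounded_coeffs(2) s] by (simp add: sums_def_le)
  ultimately have "dseries ln_coeff s = (\<Sum>m. ?f m * dseries one_coeff s)"
    unfolding fin using LIMSEQ_unique by blast
  also have "\<dots> = dseries mangoldt s * dseries one_coeff s"
    unfolding dseries_def[of mangoldt]
    by (intro suminf_mult2[symmetric] sums_summable[OF dseries_sums] s log_bounded_coeffs)
  finally show ?thesis ..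
qed

text \<open>The quotient of the two sides has derivative 0 by \<open>dseries_convolution\<close>,
  hence is constant on the half plane, and it tends to 1 along the real axis. In this form \<zeta>
  visibly has no zero there and log |\<zeta>| is the real part of an explicit series.\<close>

lemma zeta_eq_exp:
  assumes s: "Re s > 1"
  shows "dseries one_coeff s = exp (dseries mangoldt_ln s)"
proof -
  let ?S = "{s. Re s > 1}"
  define F where "F = (\<lambda>s. dseries one_coeff s * exp (- dseries mangoldt_ln s))"
  have d1: "deriv (dseries one_coeff) x = - dseries ln_coeff x" if "Re x > 1" for x
  proof -
    have "(\<lambda>n. - (of_real (ln_coeff n) * nps n x)) sums (- dseries ln_coeff x)"
      by (intro sums_minus dseries_sums that log_bounded_coeffs)
    moreover have "(\<lambda>n. - (of_real (ln_coeff n) * nps n x)) = (\<lambda>n. of_real (one_coeff n) * (- of_real (ln (real n)) * nps n x))"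
      by (auto simp: one_coeff_def ln_coeff_def)
    ultimately show ?thesis using dseries_deriv[OF log_bounded_coeffs(1) that] sums_unique2 by metis
  qed
  have d2: "deriv (dseries mangoldt_ln) x = - dseries mangoldt x" if "Re x > 1" for x
  proof -
    have "(\<lambda>n. - (of_real (mangoldt n) * nps n x)) sums (- dseries mangoldt x)"
      by (intro sums_minus dseries_sums that log_bounded_coeffs)
    moreover have "of_real (mangoldt n) = of_real (mangoldt_ln n) * complex_of_real (ln (real n))" for n
    proof (cases "n \<le> 1")
      case True
      hence "n = 0 \<or> n = 1" by auto
      thus ?thesis by auto
    qed (simp add: mangoldt_ln_def flip: of_real_mult)
    hence "(\<lambda>n. - (of_real (mangoldt n) * nps n x)) = (\<lambda>n. of_real (mangoldt_ln n) * (- of_real (ln (real n)) * nps n x))"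
      by auto
    ultimately show ?thesis using dseries_deriv[OF log_bounded_coeffs(4) that] sums_unique2 by metis
  qed
  have dF: "(F has_field_derivative 0) (at x)" if "Re x > 1" for x
    unfolding F_def
    using dseries_deriv[OF log_bounded_coeffs(1) that] dseries_deriv[OF log_bounded_coeffs(4) that]
    by (auto intro!: derivative_eq_intros simp: d1[OF that] d2[OF that] algebra_simps
        dseries_convolution[OF that, symmetric])
  have const: "F x = F s" if "Re x > 1" for x
  proof (rule has_field_derivative_zero_constant[of ?S F, THEN exE])
    show "convex ?S" by (simp add: convex_halfspace_Re_gt)
    show "(F has_field_derivative 0) (at x within ?S)" if "x \<in> ?S" for x
      using dF that by (auto intro: has_field_derivative_at_within)
    fix c assume "\<forall>x\<in>?S. F x = c"
    thus "F x = F s" using that s by auto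
  qed
  have "((\<lambda>\<sigma>. F (of_real \<sigma>)) \<longlongrightarrow> of_real (one_coeff 1) * exp (- of_real (mangoldt_ln 1))) at_top"
    unfolding F_def by (intro tendsto_intros dseries_tendsto_at_top log_bounded_coeffs)
  moreover have "((\<lambda>\<sigma>. F (of_real \<sigma>)) \<longlongrightarrow> F s) at_top"
  proof (rule tendsto_eventually)
    show "\<forall>\<^sub>F \<sigma> in at_top. F (of_real \<sigma>) = F s"
      using eventually_gt_at_top[of "1::real"] by eventually_elim (use const in auto)
  qed
  ultimately have "F s = of_real (one_coeff 1) * exp (- of_real (mangoldt_ln 1))"
    using tendsto_unique trivial_limit_at_top_linorder by blast
  hence "F s = 1" by (simp add: one_coeff_def mangoldt_ln_def)
  thus ?thesis by (simp add: F_def exp_minus field_simps)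
qed

text \<open>The inequality 3 + 4 cos x + cos 2x = 2 (1 + cos x)^2 >= 0 is applied termwise to the
  real part of log \<zeta>, whose coefficients are nonnegative.\<close>

lemma zeta_3_4_1:
  assumes "\<sigma> > 1"
  shows "norm (dseries one_coeff (of_real \<sigma>)) ^ 3 * norm (dseries one_coeff (Complex \<sigma> t)) ^ 4 *
    norm (dseries one_coeff (Complex \<sigma> (2 * t))) \<ge> 1"
proof -
  let ?l = "dseries mangoldt_ln"
  have Re_sums: "(\<lambda>n. mangoldt_ln n * (if n = 0 then 0 else real n powr (-\<sigma>) * cos (u * ln (real n)))) sums Re (?l (Complex \<sigma> u))" for u
  proof -
    have "(\<lambda>n. Re (of_real (mangoldt_ln n) * nps n (Complex \<sigma> u))) sums Re (?l (Complex \<sigma> u))"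
      using assms by (intro sums_Re dseries_sums) auto
    moreover have "Re (of_real (mangoldt_ln n) * nps n (Complex \<sigma> u)) =
        mangoldt_ln n * (if n = 0 then 0 else real n powr (-\<sigma>) * cos (u * ln (real n)))" for n
      by (auto simp: nps_def Re_exp powr_def mangoldt_ln_def)
    ultimately show ?thesis by (simp only:)
  qed
  have "(\<lambda>n. 3 * (mangoldt_ln n * (if n = 0 then 0 else real n powr (-\<sigma>) * cos (0 * ln (real n)))) +
     4 * (mangoldt_ln n * (if n = 0 then 0 else real n powr (-\<sigma>) * cos (t * ln (real n)))) +
     (mangoldt_ln n * (if n = 0 then 0 else real n powr (-\<sigma>) * cos ((2 * t) * ln (real n)))))
     sums (3 * Re (?l (Complex \<sigma> 0)) + 4 * Re (?l (Complex \<sigma> t)) + Re (?l (Complex \<sigma> (2 * t))))"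
    by (intro sums_add sums_mult Re_sums)
  note sums1 = this
  have nonneg: "0 \<le> 3 * (mangoldt_ln n * (if n = 0 then 0 else real n powr (-\<sigma>) * cos (0 * ln (real n)))) +
     4 * (mangoldt_ln n * (if n = 0 then 0 else real n powr (-\<sigma>) * cos (t * ln (real n)))) +
     (mangoldt_ln n * (if n = 0 then 0 else real n powr (-\<sigma>) * cos ((2 * t) * ln (real n))))" for n
  proof -
    define x where "x = t * ln (real n)"
    have "3 + 4 * cos x + cos (2 * x) = 2 * (1 + cos x)\<^sup>2"
      unfolding cos_double_cos by (simp add: power2_eq_square algebra_simps)
    hence "0 \<le> 3 + 4 * cos x + cos (2 * x)" by simp
    hence "0 \<le> mangoldt_ln n * real n powr (-\<sigma>) * (3 + 4 * cos x + cos (2 * x))"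
      using mangoldt_ln_bounds by (intro mult_nonneg_nonneg) auto
    thus ?thesis by (simp add: x_def algebra_simps)
  qed
  have "0 \<le> 3 * Re (?l (Complex \<sigma> 0)) + 4 * Re (?l (Complex \<sigma> t)) + Re (?l (Complex \<sigma> (2 * t)))"
    by (rule sums_le[OF nonneg sums_zero sums1])
  hence "1 \<le> exp (3 * Re (?l (Complex \<sigma> 0)) + 4 * Re (?l (Complex \<sigma> t)) + Re (?l (Complex \<sigma> (2 * t))))"
    by simp
  also have "\<dots> = exp (Re (?l (Complex \<sigma> 0))) ^ 3 * exp (Re (?l (Complex \<sigma> t))) ^ 4 * exp (Re (?l (Complex \<sigma> (2 * t))))"
    by (simp only: exp_add exp_of_nat_mult[symmetric] of_nat_numeral)
  also have "\<dots> = norm (dseries one_coeff (of_real \<sigma>)) ^ 3 * norm (dseries one_coeff (Complex \<sigma> t)) ^ 4 *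
      norm (dseries one_coeff (Complex \<sigma> (2 * t)))"
    using assms by (simp add: zeta_eq_exp complex_of_real_def del: exp_of_real)
  finally show ?thesis .
qed

text \<open>\<open>zeta_reg\<close> is \<open>(s - 1) \<zeta>(s)\<close>: subtracting the telescoping terms
  \<open>(n+1)^(1-s) - (n+2)^(1-s)\<close>, which sum to \<open>1\<close>, makes the series converge for \<open>Re s > 0\<close>.\<close>

definition zeta_reg_term :: "nat \<Rightarrow> complex \<Rightarrow> complex" where
  "zeta_reg_term n s = (s - 1) * nps (Suc n) s -
     (of_nat (Suc n) * nps (Suc n) s - of_nat (Suc (Suc n)) * nps (Suc (Suc n)) s)"

definition zeta_reg :: "complex \<Rightarrow> complex" where
  "zeta_reg s = 1 + (\<Sum>n. zeta_reg_term n s)"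

text \<open>The term is the error of a linear approximation to w^(1-s) over a unit step starting at
  m = n + 1: the auxiliary g vanishes at m, equals the term at m + 1 and has derivative (s - 1)
  (\<phi>(m) - \<phi>(w)), where \<phi>(w) = w^(-s). Bounding first the variation of \<phi> and then
  that of g gains one power of n and the two factors in s.\<close>

lemma norm_zeta_reg_term_le:
  assumes s: "Re s > 0"
  shows "norm (zeta_reg_term n s) \<le> norm s * norm (s - 1) * real (Suc n) powr (- Re s - 1)"
proof -
  let ?S = "closed_segment (of_real (real (Suc n))) (of_real (real (Suc (Suc n)))) :: complex set"
  let ?B = "norm s * real (Suc n) powr (- Re s - 1)"
  define \<phi> where "\<phi> = (\<lambda>w. exp (- s * Ln w))"
  have S: "\<exists>u. w = of_real u \<and> real (Suc n) \<le> u \<and> u \<le> real (Suc (Suc n))" if "w \<in> ?S" for w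
    using that unfolding closed_segment_of_real by (auto simp: closed_segment_eq_real_ivl)
  have nonpos: "w \<notin> \<real>\<^sub>\<le>\<^sub>0" if "w \<in> ?S" for w using S[OF that] by (auto simp: complex_nonpos_Reals_iff)
  have \<phi>': "(\<phi> has_field_derivative - s * \<phi> w / w) (at w within ?S)" if "w \<in> ?S" for w
  proof -
    have "w \<noteq> 0" using S[OF that] by auto
    thus ?thesis using nonpos[OF that] unfolding \<phi>_def
      by (auto intro!: derivative_eq_intros simp: field_simps)
  qed
  have \<phi>_nps: "\<phi> (of_real (real k)) = nps k s" if "k > 0" for k
    using that unfolding \<phi>_def nps_def by (subst Ln_of_real) auto
  have \<phi>_bound: "norm (- s * \<phi> w / w) \<le> ?B" if w: "w \<in> ?S" for w
  proof -
    obtain u where u: "w = of_real u" "real (Suc n) \<le> u" using S[OF w] by blast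
    have u0: "u > 0" using u(2) by simp
    have "norm (- s * \<phi> w / w) = norm s * (u powr (- Re s) / u)"
      using u u0 by (simp add: \<phi>_def Ln_of_real norm_mult norm_divide powr_def)
    also have "u powr (- Re s) / u = u powr (- Re s - 1)"
      using u0 by (simp add: powr_diff)
    also have "u powr (- Re s - 1) \<le> real (Suc n) powr (- Re s - 1)"
      using u s by (intro powr_mono2') auto
    finally show ?thesis by (simp add: mult_left_mono)
  qed
  have n_in: "of_real (real (Suc n)) \<in> ?S" "of_real (real (Suc (Suc n))) \<in> ?S" by auto
  define p where "p = \<phi> (of_real (real (Suc n)))"
  define m :: complex where "m = of_real (real (Suc n))"
  have \<phi>_lip: "norm (\<phi> w - p) \<le> ?B" if w: "w \<in> ?S" for w
  proof -
    have "norm (\<phi> w - p) \<le> ?B * norm (w - of_real (real (Suc n)))"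
      unfolding p_def
      by (rule field_differentiable_bound[OF convex_closed_segment \<phi>' \<phi>_bound w n_in(1)])
    also have "norm (w - of_real (real (Suc n))) \<le> 1"
    proof -
      obtain u where u: "w = of_real u" "real (Suc n) \<le> u" "u \<le> real (Suc (Suc n))" using S[OF w] by blast
      have "w - of_real (real (Suc n)) = of_real (u - real (Suc n))" using u by simp
      hence "norm (w - of_real (real (Suc n))) = \<bar>u - real (Suc n)\<bar>" by (simp only: norm_of_real)
      thus ?thesis using u by simp
    qed
    finally show ?thesis by (simp add: mult_left_mono)
  qed
  define g where "g = (\<lambda>w. w * \<phi> w - m * p + (s - 1) * (w - m) * p)"
  have "norm (g (of_real (real (Suc (Suc n)))) - g m)
      \<le> norm (s - 1) * ?B * norm (of_real (real (Suc (Suc n))) - m)"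
  proof (rule field_differentiable_bound[OF convex_closed_segment])
    fix w assume w: "w \<in> ?S"
    have "w \<noteq> 0" using S[OF w] by auto
    thus "(g has_field_derivative (s - 1) * (p - \<phi> w)) (at w within ?S)"
      unfolding g_def using \<phi>'[OF w] by (auto intro!: derivative_eq_intros simp: field_simps)
    show "norm ((s - 1) * (p - \<phi> w)) \<le> norm (s - 1) * ?B"
      using \<phi>_lip[OF w] by (simp add: norm_mult norm_minus_commute mult_left_mono)
  qed (auto simp: m_def)
  also have "of_real (real (Suc (Suc n))) - m = 1" by (simp add: m_def)
  also have "g m = 0" by (simp add: g_def m_def p_def)
  also have "g (of_real (real (Suc (Suc n)))) = zeta_reg_term n s"
    using \<phi>_nps[of "Suc n"] \<phi>_nps[of "Suc (Suc n)"]
    by (simp add: g_def m_def p_def zeta_reg_term_def algebra_simps)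
  finally show ?thesis by (simp add: mult_ac)
qed

lemma summable_Suc_powr: "\<sigma> > 0 \<Longrightarrow> summable (\<lambda>n. real (Suc n) powr (- \<sigma> - 1))"
  using summable_Suc_iff[of "\<lambda>n. real n powr (- \<sigma> - 1)"] summable_real_powr_iff[of "- \<sigma> - 1"] by simp

lemma zeta_reg_term_norm_summable:
  assumes "Re s > 0" shows "summable (\<lambda>n. norm (zeta_reg_term n s))"
proof (rule summable_comparison_test)
  show "summable (\<lambda>n. norm s * norm (s - 1) * real (Suc n) powr (- Re s - 1))"
    using assms by (intro summable_mult summable_Suc_powr)
qed (use norm_zeta_reg_term_le[OF assms] in auto)

lemma zeta_reg_holomorphic: "zeta_reg holomorphic_on {s. Re s > 0}"
proof -
  let ?S = "{s. Re s > 0}"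
  have op: "open ?S" by (simp add: open_halfspace_Re_gt)
  have "\<exists>g g'. \<forall>x\<in>?S. (\<lambda>n. zeta_reg_term n x) sums g x \<and>
      (\<lambda>n. deriv (zeta_reg_term n) x) sums g' x \<and> (g has_field_derivative g' x) (at x)"
  proof (rule series_and_derivative_comparison_local[OF op])
    fix n x
    have [derivative_intros]: "nps k field_differentiable at x" for k
      unfolding field_differentiable_def using nps_deriv by blast
    have "zeta_reg_term n field_differentiable at x" unfolding zeta_reg_term_def
      by (intro derivative_intros)
    thus "(zeta_reg_term n has_field_derivative deriv (zeta_reg_term n) x) (at x)"
      by (simp add: DERIV_deriv_iff_field_differentiable)
  next
    fix x :: complex assume x: "x \<in> ?S"
    define \<sigma> where "\<sigma> = Re x / 2"
    define R where "R = norm x + 1"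
    have sub: "Re y \<ge> \<sigma> \<and> norm y \<le> R + \<sigma> \<and> norm (y - 1) \<le> R + \<sigma>" if "y \<in> ball x \<sigma>" for y
    proof -
      have d: "norm (x - y) < \<sigma>" using that by (simp add: dist_norm)
      have "Re x - Re y \<le> norm (x - y)" using complex_Re_le_cmod[of "x - y"] by simp
      moreover have "norm y \<le> norm x + norm (x - y)"
        by (metis norm_triangle_sub norm_minus_commute)
      moreover have "norm (y - 1) \<le> norm y + 1" using norm_triangle_ineq4[of y 1] by simp
      ultimately show ?thesis using d x by (auto simp: \<sigma>_def R_def)
    qed
    have "norm (zeta_reg_term n y) \<le> (R + \<sigma>) * (R + \<sigma>) * real (Suc n) powr (- \<sigma> - 1)"
      if "y \<in> ball x \<sigma>" for n y
    proof -
      have "norm (zeta_reg_term n y) \<le> norm y * norm (y - 1) * real (Suc n) powr (- Re y - 1)"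
        using sub[OF that] x by (intro norm_zeta_reg_term_le) (auto simp: \<sigma>_def)
      also have "\<dots> \<le> (R + \<sigma>) * (R + \<sigma>) * real (Suc n) powr (- \<sigma> - 1)"
        using sub[OF that] order_trans[OF norm_ge_zero, of y "R + \<sigma>"] by (intro mult_mono powr_mono) auto
      finally show ?thesis .
    qed
    thus "\<exists>d h. 0 < d \<and> summable h \<and>
        (\<forall>\<^sub>F n in sequentially. \<forall>y\<in>ball x d \<inter> ?S. cmod (zeta_reg_term n y) \<le> h n)"
      using x by (intro exI[of _ \<sigma>] exI[of _ "\<lambda>n. (R + \<sigma>) * (R + \<sigma>) * real (Suc n) powr (- \<sigma> - 1)"]
          conjI summable_mult summable_Suc_powr always_eventually) (auto simp: \<sigma>_def)
  qed
  then obtain g g' where g: "\<And>x. Re x > 0 \<Longrightarrow> (\<lambda>n. zeta_reg_term n x) sums g x"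
    "\<And>x. Re x > 0 \<Longrightarrow> (g has_field_derivative g' x) (at x)" by auto
  have "(\<lambda>s. 1 + g s) holomorphic_on ?S"
    using g(2) by (intro holomorphic_intros) (auto simp: holomorphic_on_open[OF op])
  moreover have "1 + g s = zeta_reg s" if "s \<in> ?S" for s
    using g(1) that by (auto simp: zeta_reg_def sums_iff)
  ultimately show ?thesis by (rule holomorphic_transform)
qed

lemma zeta_reg_eq:
  assumes s: "Re s > 1"
  shows "zeta_reg s = (s - 1) * dseries one_coeff s"
proof -
  have "(\<lambda>n. of_real (one_coeff (Suc n)) * nps (Suc n) s) sums dseries one_coeff s"
    using dseries_sums[OF log_bounded_coeffs(1) s] by (subst sums_Suc_iff) (simp add: one_coeff_def)
  hence 1: "(\<lambda>n. (s - 1) * nps (Suc n) s) sums ((s - 1) * dseries one_coeff s)"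
    by (intro sums_mult) (simp add: one_coeff_def)
  have "(\<lambda>n. real (Suc n) powr (1 - Re s)) \<longlonglongrightarrow> 0" using s by real_asymp
  moreover have "real (Suc n) powr (1 - Re s) = norm (of_nat (Suc n) * nps (Suc n) s)" for n
    by (simp add: norm_mult norm_nps powr_diff powr_minus field_simps del: of_nat_Suc)
  ultimately have "(\<lambda>n. of_nat (Suc n) * nps (Suc n) s) \<longlonglongrightarrow> 0"
    using tendsto_norm_zero_iff[of "\<lambda>n. of_nat (Suc n) * nps (Suc n) s"] by simp
  from telescope_sums'[OF this]
  have "(\<lambda>n. of_nat (Suc n) * nps (Suc n) s - of_nat (Suc (Suc n)) * nps (Suc (Suc n)) s) sums 1" by simp
  from sums_diff[OF 1 this] have "(\<lambda>n. zeta_reg_term n s) sums ((s - 1) * dseries one_coeff s - 1)"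
    unfolding zeta_reg_term_def .
  thus ?thesis by (simp add: zeta_reg_def sums_iff)
qed

text \<open>The factor \<open>norm (s - 1)\<close> is kept for three uses: it gives the value 1 at s
  = 1, bounds the difference quotient near 1, and keeps \<open>zeta_reg\<close> away from 0 near
  1.\<close>

lemma zeta_reg_minus_1_bound:
  obtains C where "C > 0" "\<And>s. Re s \<ge> 1/2 \<Longrightarrow> norm (zeta_reg s - 1) \<le> C * norm s * norm (s - 1)"
proof -
  define C where "C = (\<Sum>n. real (Suc n) powr (- (1/2) - 1)) "
  have sm: "summable (\<lambda>n. real (Suc n) powr (- (1/2) - 1))" by (rule summable_Suc_powr) simp
  have "C > 0" unfolding C_def by (intro suminf_pos sm) auto
  moreover have "norm (zeta_reg s - 1) \<le> C * norm s * norm (s - 1)" if "Re s \<ge> 1/2" for s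
  proof -
    have s: "Re s > 0" using that by simp
    have "norm (zeta_reg s - 1) \<le> (\<Sum>n. norm (zeta_reg_term n s))"
      using summable_norm[OF zeta_reg_term_norm_summable[OF s]] by (simp add: zeta_reg_def)
    also have "\<dots> \<le> (\<Sum>n. norm s * norm (s - 1) * real (Suc n) powr (- (1/2) - 1))"
    proof (intro suminf_le zeta_reg_term_norm_summable s summable_mult sm)
      fix n
      show "norm (zeta_reg_term n s) \<le> norm s * norm (s - 1) * real (Suc n) powr (- (1/2) - 1)"
        using that by (intro order_trans[OF norm_zeta_reg_term_le[OF s]] mult_left_mono powr_mono) auto
    qed
    also have "\<dots> = C * norm s * norm (s - 1)"
      using suminf_mult[OF sm, of "norm s * norm (s - 1)"] by (simp add: C_def mult_ac)
    finally show ?thesis .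
  qed
  ultimately show ?thesis using that by blast
qed

text \<open>Since \<open>zeta_reg 1 = 1\<close>, this is \<zeta>(s) - 1/(s - 1), continued through s
  = 1.\<close>

definition zeta_reg_quot :: "complex \<Rightarrow> complex" where
  "zeta_reg_quot s = (if s = 1 then deriv zeta_reg 1 else (zeta_reg s - zeta_reg 1) / (s - 1))"

lemma zeta_reg_1 [simp]: "zeta_reg 1 = 1"
proof -
  obtain C where "\<And>s. Re s \<ge> 1/2 \<Longrightarrow> norm (zeta_reg s - 1) \<le> C * norm s * norm (s - 1)"
    using zeta_reg_minus_1_bound by blast
  from this[of 1] show ?thesis by simp
qed

lemma zeta_reg_quot_holomorphic: "zeta_reg_quot holomorphic_on {s. Re s > 0}"
  unfolding zeta_reg_quot_def by (intro pole_lemma_open zeta_reg_holomorphic) (simp add: open_halfspace_Re_gt)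

lemma zeta_reg_has_deriv: "Re s > 0 \<Longrightarrow> (zeta_reg has_field_derivative deriv zeta_reg s) (at s)"
  using holomorphic_derivI[OF zeta_reg_holomorphic] by (simp add: open_halfspace_Re_gt)

lemma deriv_zeta_reg_has_deriv: "Re s > 0 \<Longrightarrow> (deriv zeta_reg has_field_derivative deriv (deriv zeta_reg) s) (at s)"
  using holomorphic_derivI[OF holomorphic_deriv[OF zeta_reg_holomorphic]] by (simp add: open_halfspace_Re_gt)

lemma zeta_reg_quot_has_deriv: "Re s > 0 \<Longrightarrow> (zeta_reg_quot has_field_derivative deriv zeta_reg_quot s) (at s)"
  using holomorphic_derivI[OF zeta_reg_quot_holomorphic] by (simp add: open_halfspace_Re_gt)

lemma half_ball_bounds:
  assumes "1 \<le> Re s" "Re s \<le> 2" "\<bar>Im s\<bar> \<le> T" "T \<ge> 1" "norm (s - w) \<le> 1 / 2"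
  shows "Re w \<ge> 1/2" "norm w \<le> 4 * T" "norm (w - 1) \<le> 5 * T"
proof -
  have "\<bar>Re (s - w)\<bar> \<le> 1/2" using abs_Re_le_cmod assms(5) order_trans by blast
  hence "Re s - Re w \<le> 1/2" unfolding minus_complex.simps by linarith
  thus "Re w \<ge> 1/2" using assms by linarith
  have "norm s \<le> \<bar>Re s\<bar> + \<bar>Im s\<bar>" by (rule cmod_le)
  hence "norm s \<le> 3 * T" using assms by simp
  moreover have "norm w \<le> norm s + norm (s - w)" by (metis norm_minus_commute norm_triangle_sub)
  ultimately show "norm w \<le> 4 * T" using assms by simp
  thus "norm (w - 1) \<le> 5 * T" using norm_triangle_ineq4[of w 1] assms by simp
qed

lemma half_ball_holo:
  assumes "1 \<le> Re s" "f holomorphic_on {s. Re s > 0}"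
  shows "f holomorphic_on ball s (1/2)" "continuous_on (cball s (1/2)) f"
proof -
  have sub: "cball s (1/2) \<subseteq> {s. Re s > 0}"
  proof
    fix w assume "w \<in> cball s (1/2)"
    hence "norm (s - w) \<le> 1/2" by (simp add: dist_norm)
    hence "Re (s - w) \<le> 1/2" using complex_Re_le_cmod order_trans by blast
    thus "w \<in> {s. Re s > 0}" using assms by simp
  qed
  hence "f holomorphic_on cball s (1/2)" using assms(2) holomorphic_on_subset by blast
  thus "f holomorphic_on ball s (1/2)" "continuous_on (cball s (1/2)) f"
    using holomorphic_on_subset ball_subset_cball holomorphic_on_imp_continuous_on by blast+
qed

text \<open>Discs of radius 1/2 about s stay in Re >= 1/2, where the growth of
  \<open>zeta_reg\<close> is known, so Cauchy's inequality bounds the derivatives by the same power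
  of T.\<close>

lemma zeta_reg_bounds:
  obtains C where "C \<ge> 1"
    "\<And>s T. 1 \<le> Re s \<Longrightarrow> Re s \<le> 2 \<Longrightarrow> \<bar>Im s\<bar> \<le> T \<Longrightarrow> T \<ge> 1 \<Longrightarrow>
      norm (zeta_reg s) \<le> C * T\<^sup>2 \<and> norm (deriv zeta_reg s) \<le> C * T\<^sup>2 \<and> norm (deriv (deriv zeta_reg) s) \<le> C * T\<^sup>2 \<and>
      norm (zeta_reg_quot s) \<le> C * T \<and> norm (deriv zeta_reg_quot s) \<le> C * T"
    "\<And>s. Re s \<ge> 1/2 \<Longrightarrow> norm (zeta_reg s - 1) \<le> C * norm s * norm (s - 1)"
proof -
  obtain C0 where C0: "C0 > 0" "\<And>s. Re s \<ge> 1/2 \<Longrightarrow> norm (zeta_reg s - 1) \<le> C0 * norm s * norm (s - 1)"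
    using zeta_reg_minus_1_bound by blast
  define C1 where "C1 = 1 + 20 * C0"
  have C1: "C1 \<ge> 1" using C0 by (simp add: C1_def)
  have zeta_reg_ball: "norm (zeta_reg w) \<le> C1 * T\<^sup>2"
    if "1 \<le> Re s" "Re s \<le> 2" "\<bar>Im s\<bar> \<le> T" "T \<ge> 1" "norm (s - w) \<le> 1 / 2" for s w T
  proof -
    note b = half_ball_bounds[OF that]
    have "norm (zeta_reg w) \<le> norm (zeta_reg w - 1) + 1" using norm_triangle_ineq2[of "zeta_reg w" 1] by simp
    also have "norm (zeta_reg w - 1) \<le> C0 * norm w * norm (w - 1)" by (rule C0(2)[OF b(1)])
    also have "\<dots> \<le> C0 * (4 * T) * (5 * T)" using b C0(1) that by (intro mult_mono) auto
    also have "C0 * (4 * T) * (5 * T) + 1 \<le> C0 * (4 * T) * (5 * T) + T\<^sup>2"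
      using that by (simp add: one_le_power)
    finally show ?thesis by (simp add: C1_def power2_eq_square algebra_simps)
  qed
  have d1: "norm (deriv zeta_reg s) \<le> 2 * C1 * T\<^sup>2" if "1 \<le> Re s" "Re s \<le> 2" "\<bar>Im s\<bar> \<le> T" "T \<ge> 1" for s T
    using Cauchy_inequality[OF half_ball_holo[OF that(1) zeta_reg_holomorphic], of "C1 * T\<^sup>2" 1] zeta_reg_ball[OF that]
    by simp
  have d2: "norm (deriv (deriv zeta_reg) s) \<le> 8 * C1 * T\<^sup>2" if "1 \<le> Re s" "Re s \<le> 2" "\<bar>Im s\<bar> \<le> T" "T \<ge> 1" for s T
    using Cauchy_inequality[OF half_ball_holo[OF that(1) zeta_reg_holomorphic], of "C1 * T\<^sup>2" 2] zeta_reg_ball[OF that]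
    by (simp add: numeral_2_eq_2 power2_eq_square)
  have q: "norm (zeta_reg_quot w) \<le> (4 * C0 + 2 * C1) * T"
    if h: "1 \<le> Re s" "Re s \<le> 2" "\<bar>Im s\<bar> \<le> T" "T \<ge> 1" "norm (s - w) \<le> 1 / 2" for s w T
  proof (cases "w = 1")
    case True
    have "norm (deriv zeta_reg 1) \<le> 2 * C1 * 1\<^sup>2" using d1[of 1 1] by simp
    also have "\<dots> \<le> 2 * C1 * T" using C1 h by simp
    also have "\<dots> \<le> (4 * C0 + 2 * C1) * T" using C0 h by (intro mult_right_mono) auto
    finally show ?thesis using True by (simp add: zeta_reg_quot_def)
  next
    case False
    note b = half_ball_bounds[OF h]
    have "norm (zeta_reg w - 1) / norm (w - 1) \<le> C0 * norm w"
      using C0(2)[OF b(1)] False by (simp add: divide_simps)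
    also have "\<dots> \<le> C0 * (4 * T)" using b C0 by (intro mult_left_mono) auto
    also have "C0 * (4 * T) \<le> (4 * C0 + 2 * C1) * T"
      using mult_nonneg_nonneg[of C1 T] C1 h by (simp add: algebra_simps)
    finally show ?thesis using False by (simp add: zeta_reg_quot_def norm_divide)
  qed
  have q1: "norm (deriv zeta_reg_quot s) \<le> 2 * (4 * C0 + 2 * C1) * T"
    if "1 \<le> Re s" "Re s \<le> 2" "\<bar>Im s\<bar> \<le> T" "T \<ge> 1" for s T
    using Cauchy_inequality[OF half_ball_holo[OF that(1) zeta_reg_quot_holomorphic], of "(4 * C0 + 2 * C1) * T" 1]
      q[OF that] by (simp add: algebra_simps)
  define C where "C = 8 * C0 + 8 * C1"
  have CC: "C \<ge> C0" "C \<ge> C1" "C \<ge> 2 * C1" "C \<ge> 8 * C1" "C \<ge> 4 * C0 + 2 * C1" "C \<ge> 2 * (4 * C0 + 2 * C1)"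
    using C0 C1 by (auto simp: C_def)
  have mono: "x \<le> C * y" if "x \<le> c * y" "c \<le> C" "y \<ge> 0" for x y c
    using that by (meson mult_right_mono order_trans)
  show ?thesis
  proof (rule that[of C])
    show "C \<ge> 1" using CC C1 by linarith
    fix s T assume h: "1 \<le> Re s" "Re s \<le> 2" "\<bar>Im s\<bar> \<le> T" "T \<ge> (1::real)"
    show "norm (zeta_reg s) \<le> C * T\<^sup>2 \<and> norm (deriv zeta_reg s) \<le> C * T\<^sup>2 \<and> norm (deriv (deriv zeta_reg) s) \<le> C * T\<^sup>2 \<and>
      norm (zeta_reg_quot s) \<le> C * T \<and> norm (deriv zeta_reg_quot s) \<le> C * T"
      using mono[OF zeta_reg_ball[OF h, of s] CC(2)] mono[OF d1[OF h] CC(3)] mono[OF d2[OF h] CC(4)]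
        mono[OF q[OF h, of s] CC(5)] mono[OF q1[OF h] CC(6)] h by auto
  next
    fix s assume "Re s \<ge> 1/2"
    from C0(2)[OF this] show "norm (zeta_reg s - 1) \<le> C * norm s * norm (s - 1)"
      by (rule order_trans) (intro mult_right_mono CC; simp)
  qed
qed

text \<open>Close to s = 1 the function is near 1. Elsewhere the 3-4-1 inequality at distance a from
  the line gives |zeta_reg|^4 >= a^3 c1 / T^2, whereas moving horizontally by at most a changes
  \<open>zeta_reg\<close> by at most C a T^2. For a of size T^(-10) the first quantity dominates,
  and what remains is of size a T^2 = T^(-8).\<close>

lemma zeta_reg_lower_bound:
  obtains c where "c > 0" "\<And>T. T \<ge> 1 \<Longrightarrow> \<exists>\<delta>>0. \<delta> \<le> 1 \<and>
    (\<forall>s. 1 < Re s \<and> Re s \<le> 1 + \<delta> \<and> \<bar>Im s\<bar> \<le> T \<longrightarrow> norm (zeta_reg s) \<ge> c / T ^ 8)"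
proof -
  obtain C where C: "C \<ge> 1"
    "\<And>s T. 1 \<le> Re s \<Longrightarrow> Re s \<le> 2 \<Longrightarrow> \<bar>Im s\<bar> \<le> T \<Longrightarrow> T \<ge> 1 \<Longrightarrow>
      norm (zeta_reg s) \<le> C * T\<^sup>2 \<and> norm (deriv zeta_reg s) \<le> C * T\<^sup>2 \<and> norm (deriv (deriv zeta_reg) s) \<le> C * T\<^sup>2 \<and>
      norm (zeta_reg_quot s) \<le> C * T \<and> norm (deriv zeta_reg_quot s) \<le> C * T"
    "\<And>s. Re s \<ge> 1/2 \<Longrightarrow> norm (zeta_reg s - 1) \<le> C * norm s * norm (s - 1)"
    using zeta_reg_bounds by blast
  \<comment> \<open>Within this distance of 1 one has |s| <= 2, so the bound C |s| |s - 1| on the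
    deviation from 1 is at most 1/2.\<close>
  define \<rho> where "\<rho> = 1 / (4 * C)"
  have \<rho>: "0 < \<rho>" "\<rho> \<le> 1/4" using C(1) by (auto simp: \<rho>_def divide_simps)
  have near: "norm (zeta_reg s) \<ge> 1/2" if "1 < Re s" "norm (s - 1) \<le> \<rho>" for s
  proof -
    have "norm s \<le> norm (s - 1) + 1" using norm_triangle_ineq2[of s 1] by simp
    hence "norm s \<le> 2" using that \<rho> by simp
    hence "C * norm s * norm (s - 1) \<le> C * 2 * \<rho>" using C(1) that \<rho> by (intro mult_mono) auto
    also have "\<dots> = 1/2" using C(1) by (simp add: \<rho>_def)
    finally have "norm (zeta_reg s - 1) \<le> 1/2" using C(3)[of s] that by simp
    moreover have "norm (1 - zeta_reg s) + norm (zeta_reg s) \<ge> 1" using norm_triangle_ineq[of "1 - zeta_reg s" "zeta_reg s"] by simp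
    ultimately show ?thesis by (simp add: norm_minus_commute)
  qed
  define c1 where "c1 = (\<rho> / 2) ^ 5 / (4 * C ^ 4)"
  have c1: "c1 > 0" using \<rho> C(1) by (simp add: c1_def)
  have c1_le: "c1 \<le> \<rho> / 2"
  proof -
    have "1 \<le> C ^ 4" using C(1) by (rule one_le_power)
    hence "1 \<le> 4 * C ^ 4" by linarith
    hence "c1 \<le> (\<rho> / 2) ^ 5 / 1" unfolding c1_def using \<rho>
      by (intro divide_left_mono) auto
    also have "\<dots> \<le> (\<rho> / 2) ^ 1" unfolding div_by_1 using \<rho> by (intro power_decreasing) auto
    finally show ?thesis by simp
  qed
  have far: "norm (zeta_reg (Complex (1 + a) t)) ^ 4 \<ge> a ^ 3 * c1 / T\<^sup>2"
    if a: "0 < a" "a \<le> 1" and t: "\<rho> / 2 \<le> \<bar>t\<bar>" "\<bar>t\<bar> \<le> T" and T: "T \<ge> 1" for a t T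
  proof -
    let ?x = "norm (zeta_reg (of_real (1 + a)))" and ?y = "norm (zeta_reg (Complex (1 + a) t))"
    let ?z = "norm (zeta_reg (Complex (1 + a) (2 * t)))"
    have z1: "norm (dseries one_coeff s) = norm (zeta_reg s) / norm (s - 1)" if "Re s > 1" for s
    proof -
      have "norm (s - 1) > 0" using that by auto
      thus ?thesis using zeta_reg_eq[OF that] by (simp add: norm_mult)
    qed
    have n1: "norm (of_real (1 + a) - 1 :: complex) = a" using a by simp
    have n2: "norm (Complex (1 + a) t - 1) \<ge> \<bar>t\<bar>" "norm (Complex (1 + a) t - 1) > 0"
    proof -
      show "norm (Complex (1 + a) t - 1) \<ge> \<bar>t\<bar>"
        using abs_Im_le_cmod[of "Complex (1 + a) t - 1"] by simp
      thus "norm (Complex (1 + a) t - 1) > 0" using t \<rho> by linarith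
    qed
    have n3: "norm (Complex (1 + a) (2 * t) - 1) \<ge> \<bar>t\<bar>" "norm (Complex (1 + a) (2 * t) - 1) > 0"
    proof -
      have "norm (Complex (1 + a) (2 * t) - 1) \<ge> \<bar>2 * t\<bar>"
        using abs_Im_le_cmod[of "Complex (1 + a) (2 * t) - 1"] by simp
      thus "norm (Complex (1 + a) (2 * t) - 1) \<ge> \<bar>t\<bar>" by linarith
      thus "norm (Complex (1 + a) (2 * t) - 1) > 0" using t \<rho> by linarith
    qed
    have "1 \<le> (?x / a) ^ 3 * (?y / norm (Complex (1 + a) t - 1)) ^ 4 *
        (?z / norm (Complex (1 + a) (2 * t) - 1))"
      using zeta_3_4_1[of "1 + a" t] a z1[of "of_real (1 + a)"] z1[of "Complex (1 + a) t"]
        z1[of "Complex (1 + a) (2 * t)"] n1 by simp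
    hence "a ^ 3 * norm (Complex (1 + a) t - 1) ^ 4 * norm (Complex (1 + a) (2 * t) - 1) \<le> ?x ^ 3 * ?y ^ 4 * ?z"
      using a n2 n3 by (simp add: power_divide field_simps)
    moreover have "a ^ 3 * (\<rho> / 2) ^ 4 * (\<rho> / 2) \<le>
        a ^ 3 * norm (Complex (1 + a) t - 1) ^ 4 * norm (Complex (1 + a) (2 * t) - 1)"
      using a n2 n3 t \<rho> by (intro mult_mono power_mono) auto
    moreover have "?x ^ 3 * ?y ^ 4 * ?z \<le> C ^ 3 * ?y ^ 4 * (C * (2 * T)\<^sup>2)"
      using a t T C(2)[of "of_real (1 + a)" 1] C(2)[of "Complex (1 + a) (2 * t)" "2 * T"]
      by (intro mult_mono power_mono) (use C(1) in \<open>auto simp: abs_mult\<close>)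
    ultimately have "a ^ 3 * (\<rho> / 2) ^ 5 \<le> ?y ^ 4 * (4 * C ^ 4 * T\<^sup>2)"
      by (simp add: eval_nat_numeral mult_ac)
    hence "a ^ 3 * (\<rho> / 2) ^ 5 / (4 * C ^ 4 * T\<^sup>2) \<le> ?y ^ 4"
      using C(1) T by (subst pos_divide_le_eq) auto
    thus ?thesis by (simp add: c1_def mult_ac)
  qed
  define c2 where "c2 = c1 / (256 * C ^ 4)"
  have C4: "C ^ 4 \<ge> 1" using C(1) by (rule one_le_power)
  have c2: "c2 > 0" "c2 \<le> c1"
  proof -
    show "c2 > 0" using c1 C(1) by (simp add: c2_def)
    have "c2 \<le> c1 / 1" unfolding c2_def using c1 C4 by (intro divide_left_mono) auto
    thus "c2 \<le> c1" by simp
  qed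
  define c where "c = min (1/2) (C * c2)"
  have "c > 0" using C(1) c2 by (simp add: c_def)
  moreover have "\<exists>\<delta>>0. \<delta> \<le> 1 \<and>
    (\<forall>s. 1 < Re s \<and> Re s \<le> 1 + \<delta> \<and> \<bar>Im s\<bar> \<le> T \<longrightarrow> norm (zeta_reg s) \<ge> c / T ^ 8)" if T: "T \<ge> 1" for T
  proof -
    \<comment> \<open>This a solves (4 C a T^2)^4 = a^3 c1 / T^2; the factor 4 leaves room for the
      horizontal variation C a T^2.\<close>
    define a where "a = c2 / T ^ 10"
    have T10: "T ^ 10 \<ge> 1" and T8: "T ^ 8 \<ge> 1" using T by (auto intro: one_le_power)
    have a0: "a > 0" using c2 T by (simp add: a_def)
    have "a \<le> c2 / 1" unfolding a_def using T10 c2 by (intro divide_left_mono) auto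
    hence a1: "a \<le> \<rho> / 2" "a \<le> 1" using c2 c1_le \<rho> by auto
    have "norm (zeta_reg s) \<ge> c / T ^ 8" if s: "1 < Re s" "Re s \<le> 1 + a" "\<bar>Im s\<bar> \<le> T" for s
    proof (cases "\<bar>Im s\<bar> < \<rho> / 2")
      case True
      have "norm (s - 1) \<le> \<bar>Re (s - 1)\<bar> + \<bar>Im (s - 1)\<bar>" by (rule cmod_le)
      hence "norm (s - 1) \<le> \<rho>" using True s a1 by simp
      hence "norm (zeta_reg s) \<ge> 1/2" using near s by blast
      moreover have "c / T ^ 8 \<le> c / 1" using \<open>c > 0\<close> T8 by (intro divide_left_mono) auto
      moreover have "c \<le> 1/2" by (simp add: c_def)
      ultimately show ?thesis unfolding div_by_1 by linarith
    next
      case False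
      define u where "u = Complex (1 + a) (Im s)"
      have "a ^ 3 * c1 / T\<^sup>2 \<le> norm (zeta_reg u) ^ 4"
        unfolding u_def using False s a0 a1 T by (intro far) auto
      moreover have "(4 * C * a * T\<^sup>2) ^ 4 = a ^ 3 * c1 / T\<^sup>2"
      proof -
        have "(4 * C * a * T\<^sup>2) ^ 4 = a ^ 3 * (256 * C ^ 4 * a * T ^ 8)"
          by (simp add: power_mult_distrib flip: power_mult) (simp add: eval_nat_numeral mult_ac)
        also have "256 * C ^ 4 * a * T ^ 8 = c1 / T\<^sup>2"
          using C(1) T by (simp add: a_def c2_def field_simps flip: power_add)
        finally show ?thesis by simp
      qed
      ultimately have "(4 * C * a * T\<^sup>2) ^ 4 \<le> norm (zeta_reg u) ^ 4" by simp
      hence u: "4 * C * a * T\<^sup>2 \<le> norm (zeta_reg u)" by (rule power_le_imp_le_base[of _ 3, simplified]) simp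
      have seg: "1 \<le> Re w \<and> Re w \<le> 2 \<and> Im w = Im s" if w: "w \<in> closed_segment s u" for w
      proof -
        obtain v where v: "0 \<le> v" "v \<le> 1" "w = (1 - v) *\<^sub>R s + v *\<^sub>R u"
          using w by (auto simp: closed_segment_def)
        have Re_w: "Re w = (1 - v) * Re s + v * Re u" and Im_w: "Im w = (1 - v) * Im s + v * Im s"
          using v(3) by (simp_all add: u_def)
        have u1: "1 \<le> Re u" "Re u \<le> 2" "1 \<le> Re s" "Re s \<le> 2" using a0 a1 s by (auto simp: u_def)
        have "1 \<le> (1 - v) * Re s + v * Re u" "(1 - v) * Re s + v * Re u \<le> 2"
        proof -
          have "(1 - v) * 1 \<le> (1 - v) * Re s" "(1 - v) * Re s \<le> (1 - v) * 2"
            "v * 1 \<le> v * Re u" "v * Re u \<le> v * 2"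
            using u1 v by (intro mult_left_mono; simp)+
          thus "1 \<le> (1 - v) * Re s + v * Re u" "(1 - v) * Re s + v * Re u \<le> 2" by (simp_all add: algebra_simps)
        qed
        thus ?thesis using Re_w Im_w by (simp add: algebra_simps)
      qed
      have "norm (zeta_reg u - zeta_reg s) \<le> C * T\<^sup>2 * norm (u - s)"
      proof (rule field_differentiable_bound[OF convex_closed_segment])
        fix w assume "w \<in> closed_segment s u"
        note w = seg[OF this]
        show "(zeta_reg has_field_derivative deriv zeta_reg w) (at w within closed_segment s u)"
          using w by (intro has_field_derivative_at_within[OF zeta_reg_has_deriv]) auto
        show "norm (deriv zeta_reg w) \<le> C * T\<^sup>2" using C(2)[of w T] w s T by auto
      qed auto
      also have "norm (u - s) \<le> a"
      proof -
        have "u - s = of_real (1 + a - Re s)" by (simp add: u_def complex_eq_iff)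
        hence "norm (u - s) = \<bar>1 + a - Re s\<bar>" by (simp only: norm_of_real)
        thus ?thesis using s by simp
      qed
      finally have "norm (zeta_reg u - zeta_reg s) \<le> C * T\<^sup>2 * a" using C(1) by (simp add: mult_left_mono)
      moreover have "norm (zeta_reg u) \<le> norm (zeta_reg u - zeta_reg s) + norm (zeta_reg s)"
        using norm_triangle_ineq[of "zeta_reg u - zeta_reg s" "zeta_reg s"] by simp
      moreover have "0 \<le> C * T\<^sup>2 * a" using C(1) a0 by simp
      ultimately have "C * T\<^sup>2 * a \<le> norm (zeta_reg s)" using u by (simp add: mult_ac)
      moreover have "C * T\<^sup>2 * a = C * c2 / T ^ 8"
        using T by (simp add: a_def field_simps flip: power_add)
      moreover have "c / T ^ 8 \<le> C * c2 / T ^ 8" using T8 by (intro divide_right_mono) (auto simp: c_def)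
      ultimately show ?thesis by simp
    qed
    thus ?thesis using a0 a1 by (intro exI[of _ a]) auto
  qed
  ultimately show ?thesis using that by blast
qed

text \<open>\<open>-\<zeta>'/\<zeta> - \<zeta>\<close> on the line \<open>Re s = 1 + a\<close>. The poles at \<open>s = 1\<close> cancel, so the bounds hold uniformly
  as \<open>a\<close> tends to \<open>0\<close>.\<close>

definition prime_defect :: "real \<Rightarrow> real \<Rightarrow> complex" where
  "prime_defect a t = dseries mangoldt (Complex (1 + a) t) - dseries one_coeff (Complex (1 + a) t)"

text \<open>The logarithmic derivative of \<open>zeta_reg\<close> is 1/(s - 1) + \<zeta>'/\<zeta>,
  and \<zeta> = 1/(s - 1) + \<open>zeta_reg_quot\<close>, so in the difference only the regular
  expression H remains. The exponent 20 comes from the square of zeta_reg'/zeta_reg in H', each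
  factor being of size T^2 divided by T^(-8).\<close>

lemma prime_defect_bounds:
  obtains C where "C > 0" "\<And>T. T \<ge> 1 \<Longrightarrow> \<exists>\<delta>>0. \<delta> \<le> 1 \<and> (\<forall>a. 0 < a \<and> a \<le> \<delta> \<longrightarrow> (\<exists>h'. \<forall>t. \<bar>t\<bar> \<le> T \<longrightarrow>
     (prime_defect a has_vector_derivative h' t) (at t) \<and> norm (prime_defect a t) \<le> C * T ^ 20 \<and>
     norm (h' t) \<le> C * T ^ 20))"
proof -
  obtain c where c: "c > 0" "\<And>T. T \<ge> 1 \<Longrightarrow> \<exists>\<delta>>0. \<delta> \<le> 1 \<and>
    (\<forall>s. 1 < Re s \<and> Re s \<le> 1 + \<delta> \<and> \<bar>Im s\<bar> \<le> T \<longrightarrow> norm (zeta_reg s) \<ge> c / T ^ 8)"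
    using zeta_reg_lower_bound by blast
  obtain C where C: "C \<ge> 1"
    "\<And>s T. 1 \<le> Re s \<Longrightarrow> Re s \<le> 2 \<Longrightarrow> \<bar>Im s\<bar> \<le> T \<Longrightarrow> T \<ge> 1 \<Longrightarrow>
      norm (zeta_reg s) \<le> C * T\<^sup>2 \<and> norm (deriv zeta_reg s) \<le> C * T\<^sup>2 \<and> norm (deriv (deriv zeta_reg) s) \<le> C * T\<^sup>2 \<and>
      norm (zeta_reg_quot s) \<le> C * T \<and> norm (deriv zeta_reg_quot s) \<le> C * T"
    "\<And>s. Re s \<ge> 1/2 \<Longrightarrow> norm (zeta_reg s - 1) \<le> C * norm s * norm (s - 1)"
    using zeta_reg_bounds by blast
  define K where "K = C / c + (C / c)\<^sup>2 + C"
  have K: "K > 0" using C(1) c(1) by (simp add: K_def add_pos_nonneg add_pos_pos)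
  define H where "H = (\<lambda>s. - deriv zeta_reg s / zeta_reg s - zeta_reg_quot s)"
  define H' where "H' = (\<lambda>s. - deriv (deriv zeta_reg) s / zeta_reg s + (deriv zeta_reg s / zeta_reg s)\<^sup>2 - deriv zeta_reg_quot s)"
  have H_eq: "dseries mangoldt s - dseries one_coeff s = H s" if s: "Re s > 1" for s
  proof -
    have op: "open {s. Re s > 1}" by (simp add: open_halfspace_Re_gt)
    have d1: "deriv (dseries one_coeff) s = - dseries ln_coeff s"
    proof -
      have "(\<lambda>n. - (of_real (ln_coeff n) * nps n s)) sums (- dseries ln_coeff s)"
        by (intro sums_minus dseries_sums s log_bounded_coeffs)
      moreover have "(\<lambda>n. - (of_real (ln_coeff n) * nps n s)) = (\<lambda>n. of_real (one_coeff n) * (- of_real (ln (real n)) * nps n s))"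
        by (auto simp: one_coeff_def ln_coeff_def)
      ultimately show ?thesis using dseries_deriv[OF log_bounded_coeffs(1) s] sums_unique2 by metis
    qed
    have nz: "dseries one_coeff s \<noteq> 0" using zeta_eq_exp[OF s] by simp
    have "((\<lambda>s. (s - 1) * dseries one_coeff s) has_field_derivative
        dseries one_coeff s - (s - 1) * dseries ln_coeff s) (at s)"
      using dseries_deriv[OF log_bounded_coeffs(1) s] d1 by (auto intro!: derivative_eq_intros)
    hence "(zeta_reg has_field_derivative dseries one_coeff s - (s - 1) * dseries ln_coeff s) (at s)"
      by (rule has_field_derivative_transform_within_open[OF _ op]) (use s zeta_reg_eq in auto)
    hence "deriv zeta_reg s = dseries one_coeff s - (s - 1) * dseries ln_coeff s" by (rule DERIV_imp_deriv)
    moreover have w: "s - 1 \<noteq> 0" using s by auto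
    ultimately have "deriv zeta_reg s / zeta_reg s = 1 / (s - 1) - dseries mangoldt s"
      using nz by (simp add: zeta_reg_eq[OF s] dseries_convolution[OF s, symmetric] diff_divide_distrib)
    moreover have "zeta_reg_quot s = dseries one_coeff s - 1 / (s - 1)"
      using w by (simp add: zeta_reg_quot_def zeta_reg_eq[OF s] diff_divide_distrib)
    ultimately show ?thesis by (simp add: H_def)
  qed
  have H'_deriv: "(H has_field_derivative H' s) (at s)" if "Re s > 0" "zeta_reg s \<noteq> 0" for s
    unfolding H_def H'_def
    by (rule derivative_eq_intros zeta_reg_has_deriv deriv_zeta_reg_has_deriv zeta_reg_quot_has_deriv that refl)+
      (use that in \<open>simp add: field_simps power2_eq_square\<close>)
  show ?thesis
  proof (rule that[OF K])
    fix T :: real assume T: "T \<ge> 1"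
    obtain \<delta> where \<delta>: "\<delta> > 0" "\<delta> \<le> 1"
      "\<And>s. 1 < Re s \<Longrightarrow> Re s \<le> 1 + \<delta> \<Longrightarrow> \<bar>Im s\<bar> \<le> T \<Longrightarrow> norm (zeta_reg s) \<ge> c / T ^ 8"
      using c(2)[OF T] by blast
    have "\<exists>h'. \<forall>t. \<bar>t\<bar> \<le> T \<longrightarrow> (prime_defect a has_vector_derivative h' t) (at t) \<and>
      norm (prime_defect a t) \<le> K * T ^ 20 \<and> norm (h' t) \<le> K * T ^ 20" if a: "0 < a" "a \<le> \<delta>" for a
    proof (intro exI[of _ "\<lambda>t. \<i> * H' (Complex (1 + a) t)"] allI impI conjI)
      fix t assume t: "\<bar>t\<bar> \<le> T"
      let ?s = "Complex (1 + a) t"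
      have z: "norm (zeta_reg ?s) \<ge> c / T ^ 8" using a t by (intro \<delta>(3)) auto
      have z0: "c / T ^ 8 > 0" using c T by simp
      hence nz: "zeta_reg ?s \<noteq> 0" using z by auto
      have b: "norm (deriv zeta_reg ?s) \<le> C * T\<^sup>2" "norm (deriv (deriv zeta_reg) ?s) \<le> C * T\<^sup>2"
        "norm (zeta_reg_quot ?s) \<le> C * T" "norm (deriv zeta_reg_quot ?s) \<le> C * T"
        using C(2)[of ?s T] a \<delta> t T by auto
      have div: "norm (w / zeta_reg ?s) \<le> C / c * T ^ 10" if "norm w \<le> C * T\<^sup>2" for w
      proof -
        have "norm (w / zeta_reg ?s) \<le> C * T\<^sup>2 / (c / T ^ 8)"
          unfolding norm_divide using that z z0 C(1) by (intro frac_le) auto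
        also have "\<dots> = C / c * T ^ 10" using T by (simp add: field_simps flip: power_add)
        finally show ?thesis .
      qed
      have T_le: "T \<le> T ^ 20" "T ^ 10 \<le> T ^ 20"
        using T power_increasing[of 1 20 T] power_increasing[of 10 20 T] by auto
      have q: "norm (deriv zeta_reg ?s / zeta_reg ?s) \<le> C / c * T ^ 10" by (rule div[OF b(1)])
      have "norm (prime_defect a t) = norm (H ?s)"
        unfolding prime_defect_def using a by (subst H_eq) auto
      also have "\<dots> \<le> norm (deriv zeta_reg ?s / zeta_reg ?s) + norm (zeta_reg_quot ?s)"
        unfolding H_def using norm_triangle_ineq4[of "- deriv zeta_reg ?s / zeta_reg ?s" "zeta_reg_quot ?s"] by simp
      also have "\<dots> \<le> C / c * T ^ 10 + C * T" using q b by (intro add_mono)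
      also have "\<dots> \<le> C / c * T ^ 20 + C * T ^ 20"
        using T_le C(1) c(1) by (intro add_mono mult_left_mono) auto
      also have "\<dots> \<le> K * T ^ 20" using T by (simp add: K_def algebra_simps)
      finally show "norm (prime_defect a t) \<le> K * T ^ 20" .
      have "norm (\<i> * H' ?s) = norm (- deriv (deriv zeta_reg) ?s / zeta_reg ?s + (deriv zeta_reg ?s / zeta_reg ?s)\<^sup>2 - deriv zeta_reg_quot ?s)"
        by (simp add: norm_mult H'_def)
      also have "\<dots> \<le> norm (- deriv (deriv zeta_reg) ?s / zeta_reg ?s) + norm ((deriv zeta_reg ?s / zeta_reg ?s)\<^sup>2) + norm (deriv zeta_reg_quot ?s)"
        by (intro order_trans[OF norm_triangle_ineq4] add_mono norm_triangle_ineq order_refl)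
      also have "\<dots> \<le> C / c * T ^ 10 + (C / c * T ^ 10)\<^sup>2 + C * T"
        unfolding norm_power using div[OF b(2)] q b by (intro add_mono power_mono) auto
      also have "\<dots> = C / c * T ^ 10 + (C / c)\<^sup>2 * T ^ 20 + C * T"
        by (simp add: power_mult_distrib power_divide flip: power_mult)
      also have "\<dots> \<le> C / c * T ^ 20 + (C / c)\<^sup>2 * T ^ 20 + C * T ^ 20"
        using T_le C(1) c(1) by (intro add_mono mult_left_mono) auto
      also have "\<dots> = K * T ^ 20" by (simp add: K_def algebra_simps)
      finally show "norm (\<i> * H' ?s) \<le> K * T ^ 20" .
      have 1: "((\<lambda>t. Complex (1 + a) t) has_vector_derivative \<i>) (at t)"
        by (auto simp: has_vector_derivative_def Complex_eq scaleR_conv_of_real mult.commute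
            intro!: derivative_eq_intros)
      have "(H has_field_derivative H' ?s) (at ?s)" using a nz by (intro H'_deriv) auto
      from field_vector_diff_chain_at[OF 1 this]
      have "((\<lambda>t. H (Complex (1 + a) t)) has_vector_derivative \<i> * H' ?s) (at t)" by (simp add: o_def)
      moreover have "prime_defect a = (\<lambda>t. H (Complex (1 + a) t))"
        unfolding prime_defect_def using a by (intro ext, subst H_eq) auto
      ultimately show "(prime_defect a has_vector_derivative \<i> * H' ?s) (at t)" by simp
    qed
    thus "\<exists>\<delta>>0. \<delta> \<le> 1 \<and> (\<forall>a. 0 < a \<and> a \<le> \<delta> \<longrightarrow> (\<exists>h'. \<forall>t. \<bar>t\<bar> \<le> T \<longrightarrow>
     (prime_defect a has_vector_derivative h' t) (at t) \<and> norm (prime_defect a t) \<le> K * T ^ 20 \<and>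
     norm (h' t) \<le> K * T ^ 20))" using \<delta> by blast
  qed
qed

subsection \<open>The Fejer kernel and prime windows\<close>

lemma sums_integral:
  fixes f :: "nat \<Rightarrow> real \<Rightarrow> real"
  assumes cont: "\<And>n. continuous_on {a..b} (f n)"
    and bound: "\<And>n t. t \<in> {a..b} \<Longrightarrow> \<bar>f n t\<bar> \<le> M n" and M: "summable M"
  shows "(\<lambda>n. integral {a..b} (f n)) sums integral {a..b} (\<lambda>t. \<Sum>n. f n t)"
    and "(\<lambda>t. \<Sum>n. f n t) integrable_on {a..b}"
proof -
  have u: "uniform_limit {a..b} (\<lambda>N t. \<Sum>n<N. f n t) (\<lambda>t. \<Sum>n. f n t) sequentially"
    using bound M by (intro Weierstrass_m_test) auto
  have c: "continuous_on {a..b} (\<lambda>t. \<Sum>n<N. f n t)" for N by (intro continuous_intros cont)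
  obtain I J where IJ: "\<And>N. ((\<lambda>t. \<Sum>n<N. f n t) has_integral I N) {a..b}"
    "((\<lambda>t. \<Sum>n. f n t) has_integral J) {a..b}" "I \<longlonglongrightarrow> J"
    using uniform_limit_integral[OF u c] by auto
  have "((\<lambda>t. \<Sum>n<N. f n t) has_integral (\<Sum>n<N. integral {a..b} (f n))) {a..b}" for N
    by (intro has_integral_sum integrable_integral integrable_continuous_interval cont) auto
  hence "I = (\<lambda>N. \<Sum>n<N. integral {a..b} (f n))"
    using IJ(1) has_integral_unique by blast
  hence "(\<lambda>n. integral {a..b} (f n)) sums J" using IJ(3) by (simp add: sums_def)
  thus "(\<lambda>n. integral {a..b} (f n)) sums integral {a..b} (\<lambda>t. \<Sum>n. f n t)"
    using IJ(2) integral_unique by metis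
  show "(\<lambda>t. \<Sum>n. f n t) integrable_on {a..b}" using IJ(2) by blast
qed

text \<open>The cosine transform of the triangle 1 - |t|/T on [-T, T], folded to [0, T]. Compact
  support in t is what allows bounds on \<zeta> up to height T to be used.\<close>

definition fejer :: "real \<Rightarrow> real \<Rightarrow> real" where
  "fejer T v = integral {0..T} (\<lambda>t. 2 * (1 - t / T) * cos (t * v))"

lemma fejer_eq:
  assumes "T > 0" "v \<noteq> 0"
  shows "fejer T v = 2 * (1 - cos (T * v)) / (T * v\<^sup>2)"
proof -
  let ?P = "\<lambda>t. 2 * ((1 - t / T) * sin (t * v) / v - cos (t * v) / (T * v\<^sup>2))"
  have "((\<lambda>t. 2 * (1 - t / T) * cos (t * v)) has_integral (?P T - ?P 0)) {0..T}"
  proof (rule fundamental_theorem_of_calculus)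
    fix t assume "t \<in> {0..T}"
    show "(?P has_vector_derivative 2 * (1 - t / T) * cos (t * v)) (at t within {0..T})"
      using assms unfolding has_real_derivative_iff_has_vector_derivative[symmetric]
      by (auto intro!: derivative_eq_intros simp: field_simps power2_eq_square)
  qed (use assms in auto)
  hence "fejer T v = ?P T - ?P 0" unfolding fejer_def by (rule integral_unique)
  also have "\<dots> = 2 * (1 - cos (T * v)) / (T * v\<^sup>2)" using assms by (simp add: field_simps)
  finally show ?thesis .
qed

lemma fejer_continuous:
  assumes "T > 0" shows "continuous_on A (fejer T)"
proof -
  have "continuous_on (A \<times> cbox 0 T) (\<lambda>(v, t). 2 * (1 - t / T) * cos (t * v))"
    using assms by (auto intro!: continuous_intros simp: case_prod_unfold)
  from integral_continuous_on_param[OF this] show ?thesis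
    unfolding fejer_def[abs_def] cbox_interval .
qed

lemma fejer_int_weight: "(T::real) > 0 \<Longrightarrow> ((\<lambda>t. 2 * (1 - t / T)) has_integral T) {0..T}"
proof -
  assume T: "T > 0"
  let ?P = "\<lambda>t. 2 * t - t\<^sup>2 / T"
  have "((\<lambda>t. 2 * (1 - t / T)) has_integral (?P T - ?P 0)) {0..T}"
  proof (rule fundamental_theorem_of_calculus)
    fix t assume "t \<in> {0..T}"
    show "(?P has_vector_derivative 2 * (1 - t / T)) (at t within {0..T})"
      using T unfolding has_real_derivative_iff_has_vector_derivative[symmetric]
      by (auto intro!: derivative_eq_intros simp: field_simps power2_eq_square)
  qed (use T in auto)
  thus ?thesis using T by (simp add: power2_eq_square)
qed

lemma fejer_has_integral: "T > 0 \<Longrightarrow> ((\<lambda>t. 2 * (1 - t / T) * cos (t * v)) has_integral fejer T v) {0..T}"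
  unfolding fejer_def by (intro integrable_integral integrable_continuous_interval continuous_intros) auto

lemma fejer_le: "T > 0 \<Longrightarrow> fejer T v \<le> T"
proof -
  assume T: "T > 0"
  have *: "2 * (1 - t / T) * cos (t * v) \<le> 2 * (1 - t / T)" if "t \<in> {0..T}" for t
    using that T mult_left_mono[of "cos (t * v)" 1 "2 * (1 - t / T)"] by (simp add: divide_simps)
  show ?thesis by (rule has_integral_le[OF fejer_has_integral[OF T] fejer_int_weight[OF T] *])
qed

lemma fejer_nonneg: "T > 0 \<Longrightarrow> fejer T v \<ge> 0"
proof (cases "v = 0")
  case True
  assume T: "T > 0"
  have "fejer T 0 = T" using integral_unique[OF fejer_int_weight[OF T]] by (simp add: fejer_def)
  thus ?thesis using T True by simp
next
  case False
  assume T: "T > 0"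
  show ?thesis unfolding fejer_eq[OF T False] using T by simp
qed

lemma fejer_le_tail: "T > 0 \<Longrightarrow> v \<noteq> 0 \<Longrightarrow> fejer T v \<le> 4 / (T * v\<^sup>2)"
proof -
  assume *: "T > 0" "v \<noteq> 0"
  have "c \<ge> -1 \<Longrightarrow> 2 * (1 - c) \<le> 4" for c :: real by simp
  from this[OF cos_ge_minus_one] show ?thesis
    unfolding fejer_eq[OF *] using * by (intro divide_right_mono) auto
qed

lemma fejer_minus: "fejer T (- v) = fejer T v" by (simp add: fejer_def)

text \<open>Here |t v| <= 1 < pi/3, so the cosine is at least 1/2. Over the interval of length 2/T
  this guarantees mass at least 1, the normalisation in \<open>fejer_integral_const\<close>.\<close>

lemma fejer_ge:
  assumes "T > 0" "\<bar>v\<bar> \<le> 1 / T"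
  shows "fejer T v \<ge> T / 2"
proof -
  have *: "(1 - t / T) \<le> 2 * (1 - t / T) * cos (t * v)" if t: "t \<in> {0..T}" for t
  proof -
    have "\<bar>t * v\<bar> \<le> T * (1 / T)" unfolding abs_mult using t assms by (intro mult_mono) auto
    hence tv: "\<bar>t * v\<bar> \<le> 1" using assms by simp
    have "cos (pi / 3) \<le> cos \<bar>t * v\<bar>" using tv pi_gt3 by (intro cos_monotone_0_pi_le) auto
    hence "1 / 2 \<le> cos (t * v)" by (simp add: cos_60)
    moreover have "0 \<le> 1 - t / T" using t assms by (simp add: divide_simps)
    ultimately have "(1 - t / T) * 1 \<le> (1 - t / T) * (2 * cos (t * v))" by (intro mult_left_mono) auto
    moreover have "2 * (1 - t / T) * cos (t * v) = (1 - t / T) * (2 * cos (t * v))" by (simp only: mult_ac)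
    ultimately show ?thesis by (simp only: mult_1_right)
  qed
  have "((\<lambda>t. 2 * (1 - t / T) * (1 / 2)) has_integral (T * (1 / 2))) {0..T}"
    by (intro has_integral_mult_left fejer_int_weight assms)
  moreover have "2 * (1 - t / T) * (1 / 2) = 1 - t / T" for t by simp
  ultimately have "((\<lambda>t. 1 - t / T) has_integral (T * (1 / 2))) {0..T}" by (simp only:)
  hence "((\<lambda>t. 1 - t / T) has_integral (T / 2)) {0..T}" by simp
  from has_integral_le[OF this fejer_has_integral[OF assms(1)] *] show ?thesis .
qed

lemma Re_mult_of_real: "Re (of_real c * z) = c * Re z" by simp

text \<open>One integration by parts against exp(i t u). The triangle weight kills the boundary term
  at T, the one at 0 is at most B T / u, and the remaining integral is at most 2 B T / u; the factor
  2 in the kernel gives 6.\<close>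

lemma riemann_lebesgue_bound:
  fixes h h' :: "real \<Rightarrow> complex"
  assumes T: "T \<ge> 1" and u: "u > 0"
    and d: "\<And>t. \<bar>t\<bar> \<le> T \<Longrightarrow> (h has_vector_derivative h' t) (at t)"
    and B: "\<And>t. \<bar>t\<bar> \<le> T \<Longrightarrow> norm (h t) \<le> B" "\<And>t. \<bar>t\<bar> \<le> T \<Longrightarrow> norm (h' t) \<le> B"
  shows "\<bar>integral {0..T} (\<lambda>t. 2 * (1 - t / T) * Re (exp (\<i> * of_real (t * u)) * h t))\<bar> \<le> 6 * B * T / u"
proof -
  define e where "e = (\<lambda>t::real. exp (\<i> * of_real (t * u)))"
  define w where "w = (\<lambda>t::real. complex_of_real (1 - t / T))"
  define P where "P = (\<lambda>t. w t * h t * e t / (\<i> * of_real u))"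
  define Q where "Q = (\<lambda>t. (- of_real (1 / T) * h t + w t * h' t) * e t / (\<i> * of_real u))"
  have "norm (h 0) \<le> B" using B(1)[of 0] T by simp
  hence B0: "B \<ge> 0" using norm_ge_zero[of "h 0"] by linarith
  have ne: "norm (e t) = 1" for t by (simp add: e_def)
  have dP: "(P has_vector_derivative (w t * h t * e t + Q t)) (at t within {0..T})" if t: "t \<in> {0..T}" for t
  proof -
    have 1: "(w has_vector_derivative - of_real (1 / T)) (at t within {0..T})"
      unfolding w_def using T
      by (auto intro!: derivative_eq_intros simp: has_vector_derivative_def scaleR_conv_of_real)
    have 2: "(e has_vector_derivative (\<i> * of_real u) * e t) (at t within {0..T})"
    proof -
      have "((\<lambda>z. exp (\<i> * (z * of_real u))) has_field_derivative (\<i> * of_real u) * e t) (at (of_real t))"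
        unfolding e_def by (auto intro!: derivative_eq_intros)
      from has_vector_derivative_real_field[OF this] show ?thesis
        unfolding e_def by (auto intro: has_vector_derivative_at_within)
    qed
    have 3: "(h has_vector_derivative h' t) (at t within {0..T})"
      using d[of t] t by (auto intro: has_vector_derivative_at_within)
    from has_vector_derivative_mult[OF has_vector_derivative_mult[OF 1 3] 2]
    have "((\<lambda>t. w t * h t * e t) has_vector_derivative
        (w t * h t * ((\<i> * of_real u) * e t) + (w t * h' t + - of_real (1 / T) * h t) * e t)) (at t within {0..T})" .
    from has_vector_derivative_divide[OF this, of "\<i> * of_real u"] show ?thesis
      using u unfolding P_def Q_def by (simp add: field_simps)
  qed
  have intP: "((\<lambda>t. w t * h t * e t + Q t) has_integral (P T - P 0)) {0..T}"
    using T dP by (intro fundamental_theorem_of_calculus) auto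
  have cont: "continuous_on {0..T} (\<lambda>t. w t * h t * e t)"
  proof -
    have "continuous_on {0..T} h"
      by (intro continuous_at_imp_continuous_on ballI has_vector_derivative_continuous[OF d]) auto
    thus ?thesis unfolding w_def e_def using T by (intro continuous_intros) auto
  qed
  hence intF: "((\<lambda>t. w t * h t * e t) has_integral integral {0..T} (\<lambda>t. w t * h t * e t)) {0..T}"
    by (intro integrable_integral integrable_continuous_interval)
  define F where "F = integral {0..T} (\<lambda>t. w t * h t * e t)"
  have intQ: "(Q has_integral (P T - P 0 - F)) {0..T}"
    using has_integral_diff[OF intP intF] by (simp add: F_def)
  have "norm (P T - P 0 - F) \<le> (2 * B / u) * measure lborel (cbox 0 T)"
  proof (rule has_integral_bound)
    show "(Q has_integral (P T - P 0 - F)) (cbox 0 T)" using intQ by simp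
    fix t assume "t \<in> cbox 0 T"
    hence t: "0 \<le> t" "t \<le> T" by auto
    have "norm (Q t) = norm (- of_real (1 / T) * h t + w t * h' t) / u"
      using u by (simp add: Q_def norm_mult norm_divide ne)
    also have "norm (- of_real (1 / T) * h t + w t * h' t) \<le> norm (- of_real (1 / T) * h t) + norm (w t * h' t)"
      by (rule norm_triangle_ineq)
    also have "norm (- of_real (1 / T) * h t) = (1 / T) * norm (h t)" using T by (simp add: norm_mult norm_divide)
    also have "norm (w t * h' t) = \<bar>1 - t / T\<bar> * norm (h' t)" unfolding w_def norm_mult norm_of_real ..
    also have "(1 / T) * norm (h t) + \<bar>1 - t / T\<bar> * norm (h' t) \<le> 1 * B + 1 * B"
      using t T B B0 by (intro add_mono mult_mono) (auto simp: divide_simps)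
    finally show "norm (Q t) \<le> 2 * B / u" using u by (simp add: divide_right_mono)
  qed (use B0 u in auto)
  hence 1: "norm (P T - P 0 - F) \<le> 2 * B * T / u" using T by simp
  have "P T = 0" using T by (simp add: P_def w_def)
  moreover have "norm (P 0) \<le> B * T / u"
  proof -
    have "norm (P 0) = norm (h 0) / u" using u by (simp add: P_def w_def norm_mult norm_divide ne)
    also have "norm (h 0) \<le> B * T" using B(1)[of 0] T B0 mult_left_mono[of 1 T B] by simp
    finally show ?thesis using u by (simp add: divide_right_mono)
  qed
  ultimately have F_le: "norm F \<le> 3 * B * T / u"
  proof -
    have "norm F \<le> norm (P T - P 0) + norm (P T - P 0 - F)"
      using norm_triangle_ineq4[of "P T - P 0" "P T - P 0 - F"] by simp
    also have "norm (P T - P 0) = norm (P 0)" using \<open>P T = 0\<close> by simp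
    also have "norm (P 0) + norm (P T - P 0 - F) \<le> B * T / u + 2 * B * T / u"
      using \<open>norm (P 0) \<le> B * T / u\<close> 1 by (rule add_mono)
    also have "\<dots> = 3 * B * T / u" by (simp add: add_divide_distrib[symmetric])
    finally show ?thesis .
  qed
  moreover have "integral {0..T} (\<lambda>t. 2 * (1 - t / T) * Re (exp (\<i> * of_real (t * u)) * h t)) = 2 * Re F"
  proof -
    have "((\<lambda>t. Re (w t * h t * e t)) has_integral Re F) {0..T}"
      using has_integral_linear[OF intF bounded_linear_Re] by (simp add: o_def F_def)
    hence "((\<lambda>t. 2 * Re (w t * h t * e t)) has_integral 2 * Re F) {0..T}" by (rule has_integral_mult_right)
    moreover have "2 * Re (w t * h t * e t) = 2 * (1 - t / T) * Re (exp (\<i> * of_real (t * u)) * h t)" for t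
    proof -
      have "w t * h t * e t = of_real (1 - t / T) * (e t * h t)" by (simp add: w_def mult_ac)
      thus ?thesis unfolding e_def by (simp only: Re_mult_of_real)
    qed
    ultimately show ?thesis by (simp add: integral_unique)
  qed
  ultimately show ?thesis using abs_Re_le_cmod[of F] F_le by simp
qed

definition fejer_int :: "real \<Rightarrow> real \<Rightarrow> real \<Rightarrow> real \<Rightarrow> real" where
  "fejer_int T \<alpha> \<beta> v = integral {\<alpha>..\<beta>} (\<lambda>u. fejer T (u - v))"

text \<open>For a > 0 the Dirichlet series converge absolutely, with majorant
  \<open>log_majorant (1 + a)\<close>, so they may be exchanged with the integrals over t and over
  u. Integration by parts in t turns the bound T^20 on \<open>prime_defect\<close> into T^21 / u.
  The bound does not depend on a, which permits a to tend to 0 later.\<close>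

lemma prime_defect_windows:
  obtains C where "C > 0" "\<And>T. T \<ge> 1 \<Longrightarrow> \<exists>\<delta>>0. \<forall>a \<alpha> \<beta>. 0 < a \<and> a \<le> \<delta> \<and> 0 < \<alpha> \<and> \<alpha> \<le> \<beta> \<longrightarrow>
    (\<exists>S. (\<lambda>n. (mangoldt n - one_coeff n) * real n powr (- 1 - a) * fejer_int T \<alpha> \<beta> (ln (real n))) sums S \<and>
     \<bar>S\<bar> \<le> C * T ^ 21 / \<alpha> * (\<beta> - \<alpha>))"
proof -
  obtain C where C: "C > 0" "\<And>T. T \<ge> 1 \<Longrightarrow> \<exists>\<delta>>0. \<delta> \<le> 1 \<and> (\<forall>a. 0 < a \<and> a \<le> \<delta> \<longrightarrow> (\<exists>h'. \<forall>t. \<bar>t\<bar> \<le> T \<longrightarrow>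
     (prime_defect a has_vector_derivative h' t) (at t) \<and> norm (prime_defect a t) \<le> C * T ^ 20 \<and>
     norm (h' t) \<le> C * T ^ 20))" using prime_defect_bounds by blast
  show ?thesis
  proof (rule that[of "6 * C"])
    fix T :: real assume T: "T \<ge> 1"
    obtain \<delta> where \<delta>: "\<delta> > 0" "\<And>a. 0 < a \<Longrightarrow> a \<le> \<delta> \<Longrightarrow> (\<exists>h'. \<forall>t. \<bar>t\<bar> \<le> T \<longrightarrow>
     (prime_defect a has_vector_derivative h' t) (at t) \<and> norm (prime_defect a t) \<le> C * T ^ 20 \<and>
     norm (h' t) \<le> C * T ^ 20)" using C(2)[OF T] by blast
    have "\<exists>S. (\<lambda>n. (mangoldt n - one_coeff n) * real n powr (- 1 - a) * fejer_int T \<alpha> \<beta> (ln (real n))) sums S \<and>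
     \<bar>S\<bar> \<le> 6 * C * T ^ 21 / \<alpha> * (\<beta> - \<alpha>)" if a: "0 < a" "a \<le> \<delta>" and \<alpha>: "0 < \<alpha>" "\<alpha> \<le> \<beta>" for a \<alpha> \<beta>
    proof -
      define k where "k = (\<lambda>n. (mangoldt n - one_coeff n) * real n powr (- 1 - a))"
      define M where "M = log_majorant (1 + a)"
      have M: "summable M" unfolding M_def using a by (intro summable_log_majorant) auto
      have kM: "\<bar>k n\<bar> \<le> M n" for n
      proof (cases "n = 0")
        case False
        have "\<bar>mangoldt n - one_coeff n\<bar> \<le> 1 + ln (real n)"
          using mangoldt_le_ln[of n] mangoldt_nonneg[of n] False by (auto simp: one_coeff_def abs_le_iff)
        thus ?thesis using False by (simp add: k_def M_def log_majorant_def abs_mult mult_right_mono)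
      qed (simp add: k_def M_def log_majorant_def one_coeff_def)
      have M0: "M n \<ge> 0" for n using kM[of n] by linarith
      have T0: "T > 0" using T by simp
      obtain h' where h': "\<And>t. \<bar>t\<bar> \<le> T \<Longrightarrow> (prime_defect a has_vector_derivative h' t) (at t)"
        "\<And>t. \<bar>t\<bar> \<le> T \<Longrightarrow> norm (prime_defect a t) \<le> C * T ^ 20"
        "\<And>t. \<bar>t\<bar> \<le> T \<Longrightarrow> norm (h' t) \<le> C * T ^ 20" using \<delta>(2)[OF a] by blast
      \<comment> \<open>Multiplying the n-th term by exp(i t u) shifts its phase from -t log n to t
        (u - log n), the argument of the cosine in the kernel.\<close>
      have series: "(\<lambda>n. k n * fejer T (u - ln (real n))) sums
        integral {0..T} (\<lambda>t. 2 * (1 - t / T) * Re (exp (\<i> * of_real (t * u)) * prime_defect a t))" for u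
      proof -
        define f where "f = (\<lambda>n t. k n * (2 * (1 - t / T) * cos (t * (u - ln (real n)))))"
        have f_bound: "\<bar>f n t\<bar> \<le> 2 * M n" if "t \<in> {0..T}" for n t
        proof -
          have "\<bar>f n t\<bar> = \<bar>k n\<bar> * (2 * \<bar>1 - t / T\<bar> * \<bar>cos (t * (u - ln (real n)))\<bar>)"
            by (simp only: f_def abs_mult abs_numeral)
          also have "\<dots> \<le> M n * (2 * 1 * 1)"
            using that T M0 kM by (intro mult_mono) (auto simp: divide_simps)
          finally show ?thesis by simp
        qed
        have "(\<lambda>n. integral {0..T} (f n)) sums integral {0..T} (\<lambda>t. \<Sum>n. f n t)"
          using T f_bound by (intro sums_integral[where M = "\<lambda>n. 2 * M n"])
            (auto simp: f_def intro!: continuous_intros summable_mult M)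
        moreover have "integral {0..T} (f n) = k n * fejer T (u - ln (real n))" for n
          unfolding f_def fejer_def by (rule integral_mult_right)
        moreover have "(\<Sum>n. f n t) = 2 * (1 - t / T) * Re (exp (\<i> * of_real (t * u)) * prime_defect a t)" for t
        proof -
          let ?s = "Complex (1 + a) t"
          have "(\<lambda>n. of_real (mangoldt n) * nps n ?s - of_real (one_coeff n) * nps n ?s) sums prime_defect a t"
            unfolding prime_defect_def using a by (intro sums_diff dseries_sums) auto
          hence "(\<lambda>n. 2 * (1 - t / T) * Re (exp (\<i> * of_real (t * u)) *
              (of_real (mangoldt n) * nps n ?s - of_real (one_coeff n) * nps n ?s))) sums
              (2 * (1 - t / T) * Re (exp (\<i> * of_real (t * u)) * prime_defect a t))"
            by (intro sums_mult sums_Re)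
          moreover have "2 * (1 - t / T) * Re (exp (\<i> * of_real (t * u)) *
              (of_real (mangoldt n) * nps n ?s - of_real (one_coeff n) * nps n ?s)) = f n t" for n
          proof (cases "n = 0")
            case False
            have "exp (\<i> * of_real (t * u)) * nps n ?s =
              exp (of_real (- (1 + a) * ln (real n)) + \<i> * of_real (t * (u - ln (real n))))"
              unfolding nps_def exp_add[symmetric]
              by (intro arg_cong[of _ _ exp]) (simp add: complex_eq_iff algebra_simps)
            also have "Re \<dots> = real n powr (- 1 - a) * cos (t * (u - ln (real n)))"
              using False by (simp add: Re_exp powr_def)
            finally have "Re (exp (\<i> * of_real (t * u)) * nps n ?s) = real n powr (- 1 - a) * cos (t * (u - ln (real n)))" .
            moreover have "exp (\<i> * of_real (t * u)) * (of_real (mangoldt n) * nps n ?s - of_real (one_coeff n) * nps n ?s)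
               = of_real (mangoldt n - one_coeff n) * (exp (\<i> * of_real (t * u)) * nps n ?s)"
              by (simp add: algebra_simps)
            ultimately show ?thesis unfolding f_def k_def by (simp only: Re_mult_of_real) simp
          qed (simp add: f_def k_def one_coeff_def)
          ultimately show ?thesis by (simp add: sums_iff)
        qed
        ultimately show ?thesis by simp
      qed
      define W where "W = (\<lambda>u. \<Sum>n. k n * fejer T (u - ln (real n)))"
      have W: "\<bar>W u\<bar> \<le> 6 * C * T ^ 21 / \<alpha>" if "u \<in> {\<alpha>..\<beta>}" for u
      proof -
        have u: "u > 0" "\<alpha> \<le> u" using that \<alpha> by auto
        have "\<bar>W u\<bar> \<le> 6 * (C * T ^ 20) * T / u"
          using riemann_lebesgue_bound[OF T u(1) h'] series[of u] by (simp add: W_def sums_iff)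
        also have "\<dots> = 6 * C * T ^ 21 / u" by (simp add: eval_nat_numeral)
        also have "\<dots> \<le> 6 * C * T ^ 21 / \<alpha>" using u \<alpha> C(1) T by (intro divide_left_mono) auto
        finally show ?thesis .
      qed
      have fj: "\<bar>k n * fejer T (u - ln (real n))\<bar> \<le> M n * T" for n u
        unfolding abs_mult using kM[of n] fejer_nonneg[OF T0] fejer_le[OF T0] M0 by (intro mult_mono) auto
      have cont: "continuous_on {\<alpha>..\<beta>} (\<lambda>u. k n * fejer T (u - ln (real n)))" for n
        by (intro continuous_intros continuous_on_compose2[OF fejer_continuous[OF T0, of UNIV]]) auto
      have x1: "(\<lambda>n. integral {\<alpha>..\<beta>} (\<lambda>u. k n * fejer T (u - ln (real n)))) sums integral {\<alpha>..\<beta>} W"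
        unfolding W_def by (rule sums_integral[OF cont fj summable_mult2[OF M]])
      have x2: "integral {\<alpha>..\<beta>} (\<lambda>u. k n * fejer T (u - ln (real n))) = k n * fejer_int T \<alpha> \<beta> (ln (real n))" for n
        unfolding fejer_int_def by (rule integral_mult_right)
      have x3: "\<bar>integral {\<alpha>..\<beta>} W\<bar> \<le> 6 * C * T ^ 21 / \<alpha> * measure lborel (cbox \<alpha> \<beta>)"
      proof -
        have "W integrable_on {\<alpha>..\<beta>}" unfolding W_def by (rule sums_integral[OF cont fj summable_mult2[OF M]])
        hence "(W has_integral integral {\<alpha>..\<beta>} W) (cbox \<alpha> \<beta>)" by (simp add: integrable_integral)
        hence "norm (integral {\<alpha>..\<beta>} W) \<le> 6 * C * T ^ 21 / \<alpha> * measure lborel (cbox \<alpha> \<beta>)"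
          by (intro has_integral_bound[of _ W]) (use W C(1) T \<alpha> in auto)
        thus ?thesis by simp
      qed
      show ?thesis using \<alpha> x3 by (intro exI[of _ "integral {\<alpha>..\<beta>} W"] conjI x1[unfolded x2, unfolded k_def]) simp
    qed
    thus "\<exists>\<delta>>0. \<forall>a \<alpha> \<beta>. 0 < a \<and> a \<le> \<delta> \<and> 0 < \<alpha> \<and> \<alpha> \<le> \<beta> \<longrightarrow>
    (\<exists>S. (\<lambda>n. (mangoldt n - one_coeff n) * real n powr (- 1 - a) * fejer_int T \<alpha> \<beta> (ln (real n))) sums S \<and>
     \<bar>S\<bar> \<le> 6 * C * T ^ 21 / \<alpha> * (\<beta> - \<alpha>))" using \<delta>(1) by blast
  qed (use C in auto)
qed

lemma fejer_int_eq: "fejer_int T \<alpha> \<beta> v = integral {\<alpha> - v..\<beta> - v} (fejer T)"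
  using integral_shift_real_ivl[of "\<alpha> - v" "- v" "\<beta> - v" "fejer T"] by (simp add: fejer_int_def)

lemma fejer_integrable: "T > 0 \<Longrightarrow> fejer T integrable_on {x..y}"
  by (intro integrable_continuous_interval fejer_continuous)

lemma fejer_integral_tail:
  assumes "T > 0" "0 < x"
  shows "integral {x..y} (fejer T) \<le> 4 / (T * x)"
proof (cases "x \<le> y")
  case True
  have "((\<lambda>v. 4 / (T * v\<^sup>2)) has_integral (- 4 / (T * y) - - 4 / (T * x))) {x..y}"
  proof (rule fundamental_theorem_of_calculus[OF True])
    fix v assume "v \<in> {x..y}"
    thus "((\<lambda>v. - 4 / (T * v)) has_vector_derivative 4 / (T * v\<^sup>2)) (at v within {x..y})"
      using assms unfolding has_real_derivative_iff_has_vector_derivative[symmetric]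
      by (auto intro!: derivative_eq_intros simp: field_simps power2_eq_square)
  qed
  hence "integral {x..y} (fejer T) \<le> - 4 / (T * y) - - 4 / (T * x)"
    by (rule has_integral_le[OF integrable_integral[OF fejer_integrable[OF assms(1)]]])
      (use assms in \<open>auto intro!: fejer_le_tail\<close>)
  moreover have "4 / (T * y) \<ge> 0" using assms True by (intro divide_nonneg_nonneg mult_nonneg_nonneg) auto
  ultimately show ?thesis unfolding minus_divide_left[symmetric] by linarith
qed (use assms in simp)

lemma fejer_integral_reflect: "integral {- y..- x} (fejer T) = integral {x..y} (fejer T)"
  using Henstock_Kurzweil_Integration.integral_reflect_real[of y x "fejer T"] by (simp add: fejer_minus)

lemma fejer_integral_mono:
  assumes "T > 0" "x' \<le> x" "y \<le> y'"
  shows "integral {x..y} (fejer T) \<le> integral {x'..y'} (fejer T)"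
  using assms by (intro integral_subset_le fejer_integrable) (auto intro: fejer_nonneg)

text \<open>The number c is the total mass of the kernel, obtained as a supremum of integrals over
  intervals; it cancels from both sides in \<open>window_transfer\<close>. The two tails beyond -z
  and z contribute 4/(T z) each.\<close>

lemma fejer_integral_const:
  assumes T: "T > 0"
  obtains c where "c \<ge> 1" "\<And>x y. integral {x..y} (fejer T) \<le> c"
    "\<And>x y z. 0 < z \<Longrightarrow> x \<le> -z \<Longrightarrow> z \<le> y \<Longrightarrow> c - 8 / (T * z) \<le> integral {x..y} (fejer T)"
proof -
  define S where "S = range (\<lambda>(x, y). integral {x..y} (fejer T))"
  have key: "integral {x..y} (fejer T) \<le> integral {-z..z} (fejer T) + 8 / (T * z)" if z: "z > 0" for x y z
  proof -
    define R where "R = Max {z, \<bar>x\<bar>, \<bar>y\<bar>}"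
    have R: "z \<le> R" "\<bar>x\<bar> \<le> R" "\<bar>y\<bar> \<le> R" by (auto simp: R_def)
    have "integral {x..y} (fejer T) \<le> integral {-R..R} (fejer T)"
      using R by (intro fejer_integral_mono T) auto
    also have "\<dots> = integral {-R..-z} (fejer T) + integral {-z..R} (fejer T)"
      using R z by (intro Henstock_Kurzweil_Integration.integral_combine[symmetric] fejer_integrable T) auto
    also have "integral {-z..R} (fejer T) = integral {-z..z} (fejer T) + integral {z..R} (fejer T)"
      using R z by (intro Henstock_Kurzweil_Integration.integral_combine[symmetric] fejer_integrable T) auto
    also have "integral {-R..-z} (fejer T) = integral {z..R} (fejer T)" by (rule fejer_integral_reflect)
    finally show ?thesis using fejer_integral_tail[OF T z, of R] by simp
  qed
  have bdd: "bdd_above S" unfolding S_def bdd_above_def using key[of 1] by auto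
  define c where "c = Sup S"
  have upper: "integral {x..y} (fejer T) \<le> c" for x y
    unfolding c_def by (intro cSup_upper bdd) (auto simp: S_def)
  have lower: "c - 8 / (T * z) \<le> integral {x..y} (fejer T)" if z: "0 < z" "x \<le> -z" "z \<le> y" for x y z
  proof -
    have "c \<le> integral {-z..z} (fejer T) + 8 / (T * z)"
      unfolding c_def using key[OF z(1)] by (intro cSup_least) (auto simp: S_def)
    moreover have "integral {-z..z} (fejer T) \<le> integral {x..y} (fejer T)"
      using z by (intro fejer_integral_mono T) auto
    ultimately show ?thesis by simp
  qed
  have "((\<lambda>v. T / 2) has_integral (T / 2 * (1 / T - - (1 / T)))) {- (1 / T)..1 / T}"
    using has_integral_const_real[of "T / 2" "- (1 / T)" "1 / T"] T by simp
  hence "T / 2 * (1 / T - - (1 / T)) \<le> integral {- (1 / T)..1 / T} (fejer T)"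
    by (rule has_integral_le[OF _ integrable_integral[OF fejer_integrable[OF T]]])
      (intro fejer_ge T, simp add: abs_le_iff)
  hence "1 \<le> integral {- (1 / T)..1 / T} (fejer T)" using T by simp
  also have "\<dots> \<le> c" by (rule upper)
  finally show ?thesis using that upper lower by blast
qed

text \<open>Bounds the mass in unit windows of log n, phrased over finite sets so that it makes
  sense before any summability is known.\<close>

definition mass_bounded :: "(nat \<Rightarrow> real) \<Rightarrow> real \<Rightarrow> bool" where
  "mass_bounded m B \<longleftrightarrow> (\<forall>n. m n \<ge> 0) \<and> m 0 = 0 \<and>
     (\<forall>u F. finite F \<and> (\<forall>n\<in>F. n > 0 \<and> u \<le> ln (real n) \<and> ln (real n) \<le> u + 1) \<longrightarrow> (\<Sum>n\<in>F. m n) \<le> B)"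

lemma mass_bounded_nonneg: "mass_bounded m B \<Longrightarrow> B \<ge> 0"
  unfolding mass_bounded_def by (metis empty_iff finite.emptyI sum.empty)

lemma weight_sum_le: "(\<Sum>k<K. 1 / (max 1 (real k - 1))\<^sup>2) \<le> 4"
proof -
  have "(\<Sum>k<K. 1 / (max 1 (real k - 1))\<^sup>2) \<le> 4 - 1 / (real K - 2)" if "K \<ge> 3" for K
    using that
  proof (induction K rule: dec_induct)
    case (step K)
    have "1 / (max 1 (real K - 1))\<^sup>2 \<le> 1 / (real K - 2) - 1 / (real K - 1)"
      using step by (simp add: divide_simps power2_eq_square)
    thus ?case using step by simp
  qed (simp add: eval_nat_numeral)
  from this[of "max K 3"] have "(\<Sum>k<max K 3. 1 / (max 1 (real k - 1))\<^sup>2) \<le> 4 - 1 / (real (max K 3) - 2)"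
    by simp
  also have "\<dots> \<le> 4" by simp
  finally have "(\<Sum>k<max K 3. 1 / (max 1 (real k - 1))\<^sup>2) \<le> 4" .
  moreover have "(\<Sum>k<K. 1 / (max 1 (real k - 1))\<^sup>2) \<le> (\<Sum>k<max K 3. 1 / (max 1 (real k - 1))\<^sup>2)"
    by (intro sum_mono2) auto
  ultimately show ?thesis by linarith
qed

text \<open>The n with |log n - c| between j and j + 1 lie in two unit windows, one on each side of
  c, of total mass at most 2 B; the weights decay quadratically in j and sum to at most 4.\<close>

lemma mass_tail:
  assumes m: "mass_bounded m B" and F: "finite F" "\<And>n. n \<in> F \<Longrightarrow> n > 0"
  shows "(\<Sum>n\<in>F. m n / (max 1 (\<bar>ln (real n) - c\<bar> - 1))\<^sup>2) \<le> 8 * B"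
proof -
  define k where "k = (\<lambda>n. nat \<lfloor>\<bar>ln (real n) - c\<bar>\<rfloor>)"
  have k: "real (k n) \<le> \<bar>ln (real n) - c\<bar>" "\<bar>ln (real n) - c\<bar> \<le> real (k n) + 1" for n
    unfolding k_def by (simp, linarith)
  define K where "K = Suc (Max (k ` F))"
  have kK: "k n < K" if "n \<in> F" for n using that F(1) by (simp add: K_def less_Suc_eq_le)
  have B0: "B \<ge> 0" using mass_bounded_nonneg[OF m] .
  have "(\<Sum>n\<in>F. m n / (max 1 (\<bar>ln (real n) - c\<bar> - 1))\<^sup>2)
     = (\<Sum>j<K. \<Sum>n | n \<in> F \<and> k n = j. m n / (max 1 (\<bar>ln (real n) - c\<bar> - 1))\<^sup>2)"
    using F(1) kK by (intro sum.group[symmetric]) auto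
  also have "\<dots> \<le> (\<Sum>j<K. 2 * B * (1 / (max 1 (real j - 1))\<^sup>2))"
  proof (intro sum_mono)
    fix j
    let ?w = "1 / (max 1 (real j - 1))\<^sup>2"
    let ?G = "{n. n \<in> F \<and> k n = j}"
    let ?G1 = "{n\<in>?G. ln (real n) \<ge> c}" and ?G2 = "{n\<in>?G. ln (real n) < c}"
    have "(\<Sum>n\<in>?G. m n / (max 1 (\<bar>ln (real n) - c\<bar> - 1))\<^sup>2) \<le> (\<Sum>n\<in>?G. m n * ?w)"
    proof (intro sum_mono)
      fix n assume "n \<in> ?G"
      hence "real j \<le> \<bar>ln (real n) - c\<bar>" using k(1)[of n] by auto
      hence "(max 1 (real j - 1))\<^sup>2 \<le> (max 1 (\<bar>ln (real n) - c\<bar> - 1))\<^sup>2"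
        by (intro power_mono) auto
      hence "1 / (max 1 (\<bar>ln (real n) - c\<bar> - 1))\<^sup>2 \<le> ?w" by (intro divide_left_mono) auto
      moreover have "m n \<ge> 0" using m by (auto simp: mass_bounded_def)
      ultimately have "m n * (1 / (max 1 (\<bar>ln (real n) - c\<bar> - 1))\<^sup>2) \<le> m n * ?w"
        by (rule mult_left_mono)
      thus "m n / (max 1 (\<bar>ln (real n) - c\<bar> - 1))\<^sup>2 \<le> m n * ?w" by simp
    qed
    also have "\<dots> = (\<Sum>n\<in>?G. m n) * ?w" by (rule sum_distrib_right[symmetric])
    also have "(\<Sum>n\<in>?G. m n) = (\<Sum>n\<in>?G1. m n) + (\<Sum>n\<in>?G2. m n)"
      using F(1) by (subst sum.union_disjoint[symmetric]) (auto intro!: sum.cong)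
    also have "(\<Sum>n\<in>?G1. m n) \<le> B"
    proof -
      have "finite ?G1 \<and> (\<forall>n\<in>?G1. n > 0 \<and> c + real j \<le> ln (real n) \<and> ln (real n) \<le> c + real j + 1)"
      proof (intro conjI ballI)
        fix n assume "n \<in> ?G1"
        thus "n > 0" "c + real j \<le> ln (real n)" "ln (real n) \<le> c + real j + 1"
          using k[of n] F(2)[of n] by auto
      qed (use F(1) in simp)
      thus ?thesis using m unfolding mass_bounded_def by blast
    qed
    also have "(\<Sum>n\<in>?G2. m n) \<le> B"
    proof -
      have "finite ?G2 \<and> (\<forall>n\<in>?G2. n > 0 \<and> c - real j - 1 \<le> ln (real n) \<and> ln (real n) \<le> c - real j - 1 + 1)"
      proof (intro conjI ballI)
        fix n assume "n \<in> ?G2"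
        thus "n > 0" "c - real j - 1 \<le> ln (real n)" "ln (real n) \<le> c - real j - 1 + 1"
          using k[of n] F(2)[of n] by auto
      qed (use F(1) in simp)
      thus ?thesis using m unfolding mass_bounded_def by blast
    qed
    finally show "(\<Sum>n\<in>?G. m n / (max 1 (\<bar>ln (real n) - c\<bar> - 1))\<^sup>2) \<le> 2 * B * ?w"
      by (simp add: mult_right_mono divide_right_mono)
  qed
  also have "\<dots> = 2 * B * (\<Sum>j<K. 1 / (max 1 (real j - 1))\<^sup>2)" by (simp add: sum_distrib_left)
  also have "\<dots> \<le> 2 * B * 4" using B0 by (intro mult_left_mono weight_sum_le) auto
  finally show ?thesis by simp
qed

text \<open>The window has length at most 1, so v is at distance at least |v - \<alpha>| - 1 from
  it, and at least \<eta>. Near the window the tail integral 4/(T x) is used, far away the pointwise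
  decay of the kernel. The right side has the shape required by \<open>mass_tail\<close>.\<close>

lemma fejer_int_tail:
  assumes T: "T > 0" and \<alpha>: "\<alpha> \<le> \<beta>" "\<beta> \<le> \<alpha> + 1" and \<eta>: "0 < \<eta>" "\<eta> \<le> 1"
    and v: "v < \<alpha> - \<eta> \<or> \<beta> + \<eta> < v"
  shows "fejer_int T \<alpha> \<beta> v \<le> 4 / (T * \<eta>) / (max 1 (\<bar>v - \<alpha>\<bar> - 1))\<^sup>2"
proof -
  obtain x y where xy: "\<eta> \<le> x" "x \<le> y" "y \<le> x + 1" "\<bar>v - \<alpha>\<bar> - 1 \<le> x"
    "fejer_int T \<alpha> \<beta> v = integral {x..y} (fejer T)"
    using v
  proof
    assume "v < \<alpha> - \<eta>"
    thus ?thesis using that[of "\<alpha> - v" "\<beta> - v"] \<alpha> \<eta> by (simp add: fejer_int_eq abs_if)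
  next
    assume "\<beta> + \<eta> < v"
    thus ?thesis using that[of "v - \<beta>" "v - \<alpha>"] \<alpha> fejer_integral_reflect[of "v - \<alpha>" "v - \<beta>" T]
      \<eta> by (simp add: fejer_int_eq abs_if)
  qed
  have x0: "x > 0" using xy \<eta> by simp
  have 1: "integral {x..y} (fejer T) \<le> 4 / (T * \<eta>)"
    using fejer_integral_tail[OF T x0, of y] T \<eta> xy
    by (elim order_trans) (auto intro!: divide_left_mono mult_left_mono mult_pos_pos)
  show ?thesis
  proof (cases "\<bar>v - \<alpha>\<bar> - 1 \<le> 1")
    case True
    thus ?thesis using 1 xy by simp
  next
    case False
    let ?s = "\<bar>v - \<alpha>\<bar> - 1"
    have s: "1 \<le> ?s" "?s \<le> x" using False xy by auto
    have "((\<lambda>_. 4 / (T * ?s\<^sup>2)) has_integral (4 / (T * ?s\<^sup>2) * (y - x))) {x..y}"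
      using has_integral_const_real[of "4 / (T * ?s\<^sup>2)" x y] xy by (simp add: mult.commute)
    hence "integral {x..y} (fejer T) \<le> 4 / (T * ?s\<^sup>2) * (y - x)"
    proof (rule has_integral_le[OF integrable_integral[OF fejer_integrable[OF T]]])
      fix w assume w: "w \<in> {x..y}"
      have "fejer T w \<le> 4 / (T * w\<^sup>2)" using w x0 T by (intro fejer_le_tail) auto
      also have "\<dots> \<le> 4 / (T * ?s\<^sup>2)"
        using w s T by (intro divide_left_mono mult_left_mono power_mono mult_pos_pos) auto
      finally show "fejer T w \<le> 4 / (T * ?s\<^sup>2)" .
    qed
    also have "\<dots> \<le> 4 / (T * ?s\<^sup>2) * 1" using xy T by (intro mult_left_mono) auto
    also have "\<dots> \<le> 4 / (T * \<eta> * ?s\<^sup>2)"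
      using T \<eta> s by (simp add: divide_simps mult_le_cancel_left1)
    finally show ?thesis using False xy by simp
  qed
qed

text \<open>Averaging the Fejer kernel over a window approximates the indicator of that window, so two weights
  with nearly equal smoothed sums have nearly equal sums over sharp windows.\<close>

lemma window_transfer:
  assumes T: "T > 0" and \<alpha>: "\<alpha> \<le> \<beta>" "\<beta> \<le> \<alpha> + 1" and \<eta>: "0 < \<eta>" "\<eta> \<le> 1"
    and m: "mass_bounded m B" "mass_bounded m' B" and \<delta>: "\<delta> > 0"
    and sm: "\<And>a. 0 < a \<Longrightarrow> a \<le> \<delta> \<Longrightarrow> summable (\<lambda>n. m n * real n powr (- a))"
      "\<And>a. 0 < a \<Longrightarrow> a \<le> \<delta> \<Longrightarrow> summable (\<lambda>n. m' n * real n powr (- a))"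
    and E: "E \<ge> 0" "\<And>a. 0 < a \<Longrightarrow> a \<le> \<delta> \<Longrightarrow> \<exists>S. (\<lambda>n. (m n - m' n) * real n powr (- a) * fejer_int T \<alpha> \<beta> (ln (real n))) sums S \<and> S \<le> E"
    and F: "finite F" "\<And>n. n \<in> F \<Longrightarrow> n > 0 \<and> \<alpha> + \<eta> \<le> ln (real n) \<and> ln (real n) \<le> \<beta> - \<eta>"
    and G: "finite G" "\<And>n. n > 0 \<Longrightarrow> \<alpha> - \<eta> \<le> ln (real n) \<Longrightarrow> ln (real n) \<le> \<beta> + \<eta> \<Longrightarrow> n \<in> G"
  shows "(\<Sum>n\<in>F. m n) * (1 - 8 / (T * \<eta>)) \<le> (\<Sum>n\<in>G. m' n) + 32 * B / (T * \<eta>) + E"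
proof -
  obtain c where c: "c \<ge> 1" "\<And>x y. integral {x..y} (fejer T) \<le> c"
    "\<And>x y z. 0 < z \<Longrightarrow> x \<le> -z \<Longrightarrow> z \<le> y \<Longrightarrow> c - 8 / (T * z) \<le> integral {x..y} (fejer T)"
    using fejer_integral_const[OF T] by blast
  define J where "J = (\<lambda>n. fejer_int T \<alpha> \<beta> (ln (real n)))"
  have J0: "J n \<ge> 0" for n unfolding J_def fejer_int_def
    by (intro integral_nonneg) (auto intro!: fejer_nonneg T integrable_continuous_interval
      continuous_on_compose2[OF fejer_continuous[OF T, of UNIV]] continuous_intros)
  have Jc: "J n \<le> c" for n unfolding J_def fejer_int_eq by (rule c(2))
  have m0: "m n \<ge> 0" "m' n \<ge> 0" for n using m by (auto simp: mass_bounded_def)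
  have B0: "B \<ge> 0" using mass_bounded_nonneg[OF m(1)] .
  define U where "U = c * (\<Sum>n\<in>G. m' n) + 4 / (T * \<eta>) * (8 * B) + E"
  have main: "(\<Sum>n\<in>F. m n * real n powr (- a) * J n) \<le> U" if a: "0 < a" "a \<le> \<delta>" for a
  proof -
    have sJ: "summable (\<lambda>n. f n * real n powr (- a) * J n)"
      if "summable (\<lambda>n. f n * real n powr (- a))" "\<And>n. f n \<ge> 0" for f :: "nat \<Rightarrow> real"
    proof (rule summable_comparison_test)
      show "summable (\<lambda>n. f n * real n powr (- a) * c)" using that(1) by (rule summable_mult2)
      show "\<exists>N. \<forall>n\<ge>N. norm (f n * real n powr (- a) * J n) \<le> f n * real n powr (- a) * c"
        using that(2) J0 Jc c(1) by (auto intro!: mult_left_mono simp: abs_mult)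
    qed
    note s1 = sJ[OF sm(1)[OF a] m0(1)] and s2 = sJ[OF sm(2)[OF a] m0(2)]
    obtain S where S: "(\<lambda>n. (m n - m' n) * real n powr (- a) * J n) sums S" "S \<le> E"
      using E(2)[OF a] unfolding J_def by blast
    have "(\<Sum>n\<in>F. m n * real n powr (- a) * J n) \<le> (\<Sum>n. m n * real n powr (- a) * J n)"
      using s1 m0 J0 F(1) by (intro sum_le_suminf) auto
    also have "\<dots> = (\<Sum>n. m' n * real n powr (- a) * J n) + S"
      using suminf_diff[OF s1 s2] S(1) by (simp add: sums_iff algebra_simps)
    \<comment> \<open>Terms with n in G are charged the full mass c; all others lie outside the
      enlarged window, where \<open>fejer_int_tail\<close> and \<open>mass_tail\<close> control them
      together.\<close>
    also have "(\<Sum>n. m' n * real n powr (- a) * J n) \<le> c * (\<Sum>n\<in>G. m' n) + 4 / (T * \<eta>) * (8 * B)"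
    proof (rule suminf_le_const[OF s2])
      fix N
      have pw: "real n powr (- a) \<le> 1" if "n > 0" for n
        using that a powr_mono[of "- a" 0 "real n"] by simp
      have "(\<Sum>n<N. m' n * real n powr (- a) * J n) \<le>
        (\<Sum>n<N. if n \<in> G then m' n * c else if n = 0 then 0 else 4 / (T * \<eta>) * (m' n / (max 1 (\<bar>ln (real n) - \<alpha>\<bar> - 1))\<^sup>2))"
      proof (intro sum_mono)
        fix n
        show "m' n * real n powr (- a) * J n \<le>
          (if n \<in> G then m' n * c else if n = 0 then 0 else 4 / (T * \<eta>) * (m' n / (max 1 (\<bar>ln (real n) - \<alpha>\<bar> - 1))\<^sup>2))"
        proof (cases "n = 0")
          case True
          thus ?thesis using m(2) by (auto simp: mass_bounded_def)
        next
          case False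
          have "m' n * real n powr (- a) * J n \<le> m' n * 1 * J n"
            using pw[of n] False J0 m0 by (intro mult_right_mono mult_left_mono) auto
          hence 1: "m' n * real n powr (- a) * J n \<le> m' n * J n" by simp
          show ?thesis
          proof (cases "n \<in> G")
            case True
            thus ?thesis using 1 mult_left_mono[OF Jc[of n] m0(2)[of n]] by simp
          next
            case nG: False
            have "ln (real n) < \<alpha> - \<eta> \<or> \<beta> + \<eta> < ln (real n)" using G(2)[of n] nG False by force
            from fejer_int_tail[OF T \<alpha> \<eta> this]
            have "m' n * J n \<le> m' n * (4 / (T * \<eta>) / (max 1 (\<bar>ln (real n) - \<alpha>\<bar> - 1))\<^sup>2)"
              unfolding J_def using m0(2) by (intro mult_left_mono) auto
            thus ?thesis using 1 nG False by (simp add: mult_ac)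
          qed
        qed
      qed
      also have "\<dots> \<le> (\<Sum>n\<in>G. m' n * c) +
          (\<Sum>n\<in>{0<..<N} - G. 4 / (T * \<eta>) * (m' n / (max 1 (\<bar>ln (real n) - \<alpha>\<bar> - 1))\<^sup>2))"
      proof -
        let ?t = "\<lambda>n. 4 / (T * \<eta>) * (m' n / (max 1 (\<bar>ln (real n) - \<alpha>\<bar> - 1))\<^sup>2)"
        have "(\<Sum>n<N. if n \<in> G then m' n * c else if n = 0 then 0 else ?t n)
          = (\<Sum>n\<in>{..<N} \<inter> G. m' n * c) + (\<Sum>n\<in>{..<N} \<inter> - G. if n = 0 then 0 else ?t n)"
          by (subst sum.If_cases) auto
        also have "(\<Sum>n\<in>{..<N} \<inter> - G. if n = 0 then 0 else ?t n) = (\<Sum>n\<in>{0<..<N} - G. ?t n)"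
          by (intro sum.mono_neutral_cong_right) auto
        also have "(\<Sum>n\<in>{..<N} \<inter> G. m' n * c) \<le> (\<Sum>n\<in>G. m' n * c)"
          using G(1) m0 c(1) by (intro sum_mono2) auto
        finally show ?thesis by simp
      qed
      also have "\<dots> = c * (\<Sum>n\<in>G. m' n) +
          4 / (T * \<eta>) * (\<Sum>n\<in>{0<..<N} - G. m' n / (max 1 (\<bar>ln (real n) - \<alpha>\<bar> - 1))\<^sup>2)"
        by (simp add: sum_distrib_left mult.commute)
      also have "\<dots> \<le> c * (\<Sum>n\<in>G. m' n) + 4 / (T * \<eta>) * (8 * B)"
        using T \<eta> by (intro add_left_mono mult_left_mono mass_tail m(2)) auto
      finally show "(\<Sum>n<N. m' n * real n powr (- a) * J n) \<le> c * (\<Sum>n\<in>G. m' n) + 4 / (T * \<eta>) * (8 * B)" .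
    qed
    finally show ?thesis using S(2) by (simp add: U_def)
  qed
  \<comment> \<open>The factor n^(-a) was there for convergence. Now a tends to 0: the left side is
    a finite sum and U does not depend on a.\<close>
  have "(\<Sum>n\<in>F. m n * J n) \<le> U"
  proof (rule tendsto_upperbound)
    have "((\<lambda>a. \<Sum>n\<in>F. m n * real n powr (- a) * J n) \<longlongrightarrow> (\<Sum>n\<in>F. m n * real n powr (- 0) * J n)) (at_right 0)"
      using F(2) by (intro tendsto_intros) auto
    moreover have "(\<Sum>n\<in>F. m n * real n powr (- 0) * J n) = (\<Sum>n\<in>F. m n * J n)"
      using F(2) by (intro sum.cong) auto
    ultimately show "((\<lambda>a. \<Sum>n\<in>F. m n * real n powr (- a) * J n) \<longlongrightarrow> (\<Sum>n\<in>F. m n * J n)) (at_right 0)" by simp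
    show "\<forall>\<^sub>F a in at_right 0. (\<Sum>n\<in>F. m n * real n powr (- a) * J n) \<le> U"
      unfolding eventually_at_right_field using \<delta> main by (intro exI[of _ \<delta>]) auto
  qed auto
  moreover have "(\<Sum>n\<in>F. m n * (c - 8 / (T * \<eta>))) \<le> (\<Sum>n\<in>F. m n * J n)"
  proof (intro sum_mono mult_left_mono m0)
    fix n assume "n \<in> F"
    thus "c - 8 / (T * \<eta>) \<le> J n"
      unfolding J_def fejer_int_eq using F(2)[of n] \<eta> by (intro c(3)) linarith+
  qed
  ultimately have "(\<Sum>n\<in>F. m n) * (c - 8 / (T * \<eta>)) \<le> U" by (simp add: sum_distrib_right)
  moreover have F0: "(\<Sum>n\<in>F. m n) \<ge> 0" using m0 by (intro sum_nonneg) auto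
  \<comment> \<open>Because c >= 1, it may be pulled out of c - 8/(T \<eta>) and inserted in the
    error terms of U; then it cancels.\<close>
  have "c * ((\<Sum>n\<in>F. m n) * (1 - 8 / (T * \<eta>))) \<le> (\<Sum>n\<in>F. m n) * (c - 8 / (T * \<eta>))"
  proof -
    have "c * (1 - 8 / (T * \<eta>)) \<le> c - 8 / (T * \<eta>)"
      using mult_right_mono[OF c(1), of "8 / (T * \<eta>)"] T \<eta> by (simp add: algebra_simps)
    from mult_left_mono[OF this F0] show ?thesis by (simp add: mult_ac)
  qed
  moreover have "U \<le> c * ((\<Sum>n\<in>G. m' n) + 32 * B / (T * \<eta>) + E)"
    using mult_right_mono[OF c(1), of "32 * B / (T * \<eta>)"] mult_right_mono[OF c(1) E(1)] T \<eta> B0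
    by (simp add: U_def algebra_simps)
  ultimately have "c * ((\<Sum>n\<in>F. m n) * (1 - 8 / (T * \<eta>))) \<le> c * ((\<Sum>n\<in>G. m' n) + 32 * B / (T * \<eta>) + E)"
    by linarith
  thus ?thesis using c(1) by simp
qed

section \<open>Chebyshev's upper bound and sharp windows for the von Mangoldt function\<close>

definition psi :: "nat \<Rightarrow> real" where "psi N = (\<Sum>n=1..N. mangoldt n)"

lemma ln_fact_eq_mangoldt: "ln (fact N :: real) = (\<Sum>m=1..N. mangoldt m * real (N div m))"
proof -
  have "ln (fact N :: real) = (\<Sum>k=1..N. ln (real k))"
    by (induction N) (simp_all add: ln_mult)
  also have "\<dots> = (\<Sum>k=1..N. \<Sum>m | m dvd k. mangoldt m)"
    by (intro sum.cong refl) (use mangoldt_sum[where 'a = real] in auto)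
  also have "\<dots> = (\<Sum>m=1..N. \<Sum>n=1..N div m. mangoldt m)"
    by (rule sum_divisors_swap)
  finally show ?thesis by (simp add: mult.commute)
qed

text \<open>Chebyshev's argument: in the logarithm of the central binomial coefficient, \<Lambda>(m)
  carries the coefficient [2M/m] - 2 [M/m]. It is never negative and equals 1 for M < m <= 2M, while
  the coefficient itself is at most 4^M.\<close>

lemma psi_double: "psi (2 * M) - psi M \<le> 2 * real M * ln 2"
proof -
  have ext: "ln (fact M :: real) = (\<Sum>m=1..2*M. mangoldt m * real (M div m))"
    unfolding ln_fact_eq_mangoldt by (rule sum.mono_neutral_left) auto
  have "psi (2 * M) - psi M = (\<Sum>m=1..2*M. if m \<le> M then 0 else mangoldt m)"
  proof -
    have "psi (2 * M) = (\<Sum>m=1..2*M. if m \<le> M then mangoldt m else 0) + (\<Sum>m=1..2*M. if m \<le> M then 0 else mangoldt m)"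
      unfolding psi_def sum.distrib[symmetric] by (intro sum.cong) auto
    also have "(\<Sum>m=1..2*M. if m \<le> M then mangoldt m else 0) = psi M"
      unfolding psi_def by (rule sum.mono_neutral_cong_right) auto
    finally show ?thesis by simp
  qed
  also have "\<dots> \<le> (\<Sum>m=1..2*M. mangoldt m * (real (2 * M div m) - 2 * real (M div m)))"
  proof (intro sum_mono)
    fix m assume m: "m \<in> {1..2*M}"
    show "(if m \<le> M then 0 else mangoldt m) \<le> mangoldt m * (real (2 * M div m) - 2 * real (M div m))"
    proof (cases "m \<le> M")
      case True
      have "2 * (M div m) \<le> 2 * M div m"
        using m by (simp add: less_eq_div_iff_mult_less_eq)
      hence "2 * real (M div m) \<le> real (2 * M div m)" by (metis of_nat_le_iff of_nat_mult of_nat_numeral)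
      thus ?thesis using True mangoldt_nonneg[of m] by simp
    next
      case False
      hence "M div m = 0" "2 * M div m \<ge> 1" using m by (auto simp: Suc_le_eq div_greater_zero_iff)
      thus ?thesis using False mangoldt_nonneg[of m] mult_left_mono[of 1 "real (2 * M div m)" "mangoldt m"] by simp
    qed
  qed
  also have "\<dots> = ln (fact (2 * M) :: real) - 2 * ln (fact M)"
    unfolding ext ln_fact_eq_mangoldt[of "2 * M"] by (simp add: sum_subtractf sum_distrib_left algebra_simps)
  also have "\<dots> = ln (real (2 * M choose M))"
  proof -
    have "(fact (2 * M) :: real) = fact M * fact M * real (2 * M choose M)"
      using binomial_fact_lemma[of M "2 * M"] by (metis add_diff_cancel_left' le_add1 mult_2 of_nat_fact of_nat_mult)
    moreover have "real (2 * M choose M) > 0" by (simp add: zero_less_binomial_iff)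
    ultimately show ?thesis by (simp add: ln_mult)
  qed
  also have "\<dots> \<le> ln (2 ^ (2 * M))"
  proof (subst ln_le_cancel_iff)
    show "real (2 * M choose M) > 0" by (simp add: zero_less_binomial_iff)
    show "real (2 * M choose M) \<le> 2 ^ (2 * M)"
      using binomial_le_pow2[of "2 * M" M] by (metis of_nat_le_iff of_nat_numeral of_nat_power)
  qed simp
  also have "\<dots> = 2 * real M * ln 2" by (simp add: ln_realpow)
  finally show ?thesis .
qed

lemma psi_mono: "M \<le> N \<Longrightarrow> psi M \<le> psi N"
  unfolding psi_def by (intro sum_mono2) (auto simp: mangoldt_nonneg)

text \<open>Halving: a bound 3 M at M gives 4.4 M at 2 M. The slack against 6 M pays for rounding an
  odd N up to 2 (M + 1).\<close>

lemma psi_le: "psi N \<le> 3 * real N"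
proof (induction N rule: less_induct)
  case (less N)
  have ln2: "ln 2 \<le> (7/10 :: real)" using ln2_le_25_over_36 by simp
  have step: "psi (2 * M) \<le> 3 * real M + 2 * real M * (7/10)" if "psi M \<le> 3 * real M" for M
    using psi_double[of M] that mult_left_mono[OF ln2, of "2 * real M"] by simp
  consider "N \<le> 1" | M where "N = 2 * M" "M \<ge> 1" | M where "N = 2 * M + 1" "M \<ge> 1"
    by (metis One_nat_def Suc_leI div_greater_zero_iff evenE not_less_eq_eq numeral_2_eq_2 oddE
        bot_nat_0.not_eq_extremum mult_0_right mult_2 nat_le_linear add_0)
  thus ?case
  proof cases
    case 1
    hence "N = 0 \<or> N = 1" by auto
    thus ?thesis by (auto simp: psi_def)
  next
    case 2
    thus ?thesis using step[of M] less[of M] by simp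
  next
    case 3
    have "psi N \<le> psi (2 * (M + 1))" using 3 by (intro psi_mono) auto
    also have "\<dots> \<le> 3 * real (M + 1) + 2 * real (M + 1) * (7/10)" using 3 by (intro step less) auto
    also have "\<dots> \<le> 3 * real N" using 3 by simp
    finally show ?thesis .
  qed
qed

text \<open>In a unit window starting at u, the weight 1/n is at most exp(-u) and n is at most exp(u
  + 1), so a partial-sum bound 3 N yields mass at most 3 e <= 9.\<close>

lemma mass_bounded_windows:
  "mass_bounded (\<lambda>n. mangoldt n / real n) 9" "mass_bounded (\<lambda>n. one_coeff n / real n) 9"
proof -
  have e: "3 * exp (1::real) \<le> 9" using exp_le by simp
  have F: "(\<Sum>n\<in>F. f n / real n) \<le> 9"
    if F: "finite F" "\<forall>n\<in>F. n > 0 \<and> u \<le> ln (real n) \<and> ln (real n) \<le> u + 1"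
      and f: "\<And>n. f n \<ge> 0" "\<And>N. (\<Sum>n=1..N. f n) \<le> 3 * real N" for F u and f :: "nat \<Rightarrow> real"
  proof -
    define N where "N = nat \<lfloor>exp (u + 1)\<rfloor>"
    have n: "n \<ge> 1" "exp u \<le> real n" "n \<le> N" if "n \<in> F" for n
    proof -
      have n0: "real n > 0" and l: "u \<le> ln (real n)" "ln (real n) \<le> u + 1" using F(2) that by auto
      show "n \<ge> 1" using n0 by simp
      show "exp u \<le> real n" using exp_le_cancel_iff[of u "ln (real n)"] l n0 by simp
      have "real n \<le> exp (u + 1)" using exp_le_cancel_iff[of "ln (real n)" "u + 1"] l n0 by simp
      thus "n \<le> N" by (simp add: N_def le_nat_floor)
    qed
    have "(\<Sum>n\<in>F. f n / real n) \<le> (\<Sum>n\<in>F. f n / exp u)"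
      using n f by (intro sum_mono divide_left_mono) (auto intro!: mult_pos_pos simp: Suc_le_eq)
    also have "\<dots> = (\<Sum>n\<in>F. f n) / exp u" by (simp add: sum_divide_distrib)
    also have "(\<Sum>n\<in>F. f n) \<le> (\<Sum>n=1..N. f n)" using n f by (intro sum_mono2) auto
    also have "\<dots> \<le> 3 * real N" by (rule f)
    also have "\<dots> \<le> 3 * exp (u + 1)" unfolding N_def by simp
    also have "3 * exp (u + 1) / exp u = 3 * exp 1" by (simp add: exp_add)
    finally show ?thesis using e by (simp add: divide_right_mono)
  qed
  have "(\<Sum>n=1..N. one_coeff n) \<le> 3 * real N" for N
    by (simp add: one_coeff_def)
  note one = this
  have mb: "mass_bounded (\<lambda>n. f n / real n) 9"
    if f: "\<And>n. f n \<ge> 0" "\<And>N. (\<Sum>n=1..N. f n) \<le> 3 * real N" for f :: "nat \<Rightarrow> real"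
    unfolding mass_bounded_def by (intro conjI allI impI) (use f in \<open>auto intro: F[OF _ _ f]\<close>)
  show "mass_bounded (\<lambda>n. mangoldt n / real n) 9"
    using psi_le by (intro mb) (auto simp: mangoldt_nonneg psi_def)
  show "mass_bounded (\<lambda>n. one_coeff n / real n) 9"
    by (rule mb[OF _ one]) (simp add: one_coeff_def)
qed

lemma harmonic_sum_ge: "a \<ge> 1 \<Longrightarrow> ln (real b + 1) - ln (real a) \<le> (\<Sum>n=a..b. 1 / real n)"
proof (induction b)
  case 0
  have "ln 1 \<le> ln (real a)" using 0 by (subst ln_le_cancel_iff) auto
  thus ?case using 0 by simp
next
  case (Suc b)
  show ?case
  proof (cases "a \<le> Suc b")
    case True
    have "ln (1 + 1 / (real b + 1)) \<le> 1 / (real b + 1)" by (rule ln_add_one_self_le_self) simp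
    also have "1 + 1 / (real b + 1) = (real b + 2) / (real b + 1)" by (simp add: field_simps)
    finally have "ln (real b + 2) - ln (real b + 1) \<le> 1 / (real b + 1)" by (simp add: ln_div)
    thus ?thesis using Suc True by (simp add: add.commute)
  next
    case False
    have "ln (real (Suc b) + 1) \<le> ln (real a)" using False by (subst ln_le_cancel_iff) auto
    thus ?thesis using False by simp
  qed
qed

lemma harmonic_sum_le: "a \<ge> 1 \<Longrightarrow> a \<le> b \<Longrightarrow> (\<Sum>n=a..b. 1 / real n) \<le> 1 / real a + ln (real b) - ln (real a)"
proof (induction b)
  case (Suc b)
  show ?case
  proof (cases "a = Suc b")
    case False
    hence ab: "a \<le> b" "b > 0" using Suc by auto
    have "ln (1 + (- (1 / (real b + 1)))) \<le> - (1 / (real b + 1))"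
      by (rule ln_add_one_self_le_self2) (use ab in \<open>simp add: field_simps\<close>)
    also have "1 + (- (1 / (real b + 1))) = real b / (real b + 1)" by (simp add: field_simps)
    finally have "ln (real b) - ln (real b + 1) \<le> - (1 / (real b + 1))" using ab by (simp add: ln_div)
    thus ?thesis using Suc ab by (simp add: add.commute)
  qed simp
qed simp

lemma window_finite: "finite {n::nat. n > 0 \<and> ln (real n) \<le> \<beta>}"
proof (rule finite_subset)
  show "{n::nat. n > 0 \<and> ln (real n) \<le> \<beta>} \<subseteq> {..nat \<lfloor>exp \<beta>\<rfloor>}"
  proof
    fix n :: nat assume "n \<in> {n. n > 0 \<and> ln (real n) \<le> \<beta>}"
    hence "real n \<le> exp \<beta>" using exp_le_cancel_iff[of "ln (real n)" \<beta>] by simp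
    thus "n \<in> {..nat \<lfloor>exp \<beta>\<rfloor>}" by (simp add: le_nat_floor)
  qed
qed simp

text \<open>For the weight 1/n the window mass is explicit by comparison with the logarithm;
  rounding the ends to integers costs one boundary term of size exp(-\<alpha>).\<close>

lemma harmonic_window:
  assumes "0 \<le> \<alpha>" "\<alpha> \<le> \<beta>"
  shows "\<bar>(\<Sum>n | n > 0 \<and> \<alpha> \<le> ln (real n) \<and> ln (real n) \<le> \<beta>. one_coeff n / real n) - (\<beta> - \<alpha>)\<bar> \<le> exp (- \<alpha>)"
proof -
  define a b where "a = nat \<lceil>exp \<alpha>\<rceil>" "b = nat \<lfloor>exp \<beta>\<rfloor>"
  have e1: "exp \<alpha> \<ge> 1" "exp \<beta> \<ge> 1" using assms by auto
  have a: "exp \<alpha> \<le> real a" "real a \<le> exp \<alpha> + 1" "a \<ge> 1"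
    using e1 unfolding a_b_def by (linarith+)
  have b: "real b \<le> exp \<beta>" "exp \<beta> \<le> real b + 1" "b \<ge> 1"
    using e1 unfolding a_b_def by (linarith+)
  have set: "{n. n > 0 \<and> \<alpha> \<le> ln (real n) \<and> ln (real n) \<le> \<beta>} = {a..b}"
  proof -
    have cond: "(n > 0 \<and> \<alpha> \<le> ln (real n) \<and> ln (real n) \<le> \<beta>) \<longleftrightarrow> a \<le> n \<and> n \<le> b" for n :: nat
    proof (cases "n = 0")
      case False
      have "\<alpha> \<le> ln (real n) \<longleftrightarrow> exp \<alpha> \<le> real n" using False by (metis exp_le_cancel_iff exp_ln of_nat_0_less_iff not_gr_zero)
      moreover have "ln (real n) \<le> \<beta> \<longleftrightarrow> real n \<le> exp \<beta>" using False by (metis exp_le_cancel_iff exp_ln of_nat_0_less_iff not_gr_zero)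
      moreover have "exp \<alpha> \<le> real n \<longleftrightarrow> a \<le> n" unfolding a_b_def by linarith
      moreover have "real n \<le> exp \<beta> \<longleftrightarrow> n \<le> b"
        by (simp add: a_b_def le_nat_iff le_floor_iff)
      ultimately show ?thesis using False by simp
    qed (use a in auto)
    show ?thesis
    proof (rule Set.set_eqI)
      fix n show "n \<in> {n. n > 0 \<and> \<alpha> \<le> ln (real n) \<and> ln (real n) \<le> \<beta>} \<longleftrightarrow> n \<in> {a..b}"
        using cond[of n] unfolding mem_Collect_eq atLeastAtMost_iff .
    qed
  qed
  have eq: "(\<Sum>n | n > 0 \<and> \<alpha> \<le> ln (real n) \<and> ln (real n) \<le> \<beta>. one_coeff n / real n) = (\<Sum>n=a..b. 1 / real n)"
    unfolding set using a by (intro sum.cong) (auto simp: one_coeff_def)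
  have la: "\<alpha> \<le> ln (real a)" using a by (subst ln_ge_iff) auto
  have "ln (real b) \<le> ln (exp \<beta>)" using b by (subst ln_le_cancel_iff) auto
  hence lb: "ln (real b) \<le> \<beta>" by simp
  have "\<beta> \<le> ln (real b + 1)" using b by (subst ln_ge_iff) auto
  moreover have "ln (real a) \<le> \<alpha> + exp (- \<alpha>)"
  proof -
    have "ln (real a) \<le> ln (exp \<alpha> * (1 + exp (- \<alpha>)))"
      using a by (subst ln_le_cancel_iff) (auto simp: algebra_simps exp_minus intro!: mult_pos_pos add_pos_pos)
    also have "\<dots> = \<alpha> + ln (1 + exp (- \<alpha>))"
    proof -
      have "1 + exp (- \<alpha>) > 0" by (simp add: add_pos_pos)
      thus ?thesis by (subst ln_mult) auto
    qed
    also have "ln (1 + exp (- \<alpha>)) \<le> exp (- \<alpha>)" by (intro ln_add_one_self_le_self) auto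
    finally show ?thesis by simp
  qed
  ultimately have lower: "\<beta> - \<alpha> - exp (- \<alpha>) \<le> (\<Sum>n=a..b. 1 / real n)"
    using harmonic_sum_ge[of a b] a by linarith
  have upper: "(\<Sum>n=a..b. 1 / real n) \<le> \<beta> - \<alpha> + exp (- \<alpha>)"
  proof (cases "a \<le> b")
    case True
    have "1 / real a \<le> 1 / exp \<alpha>" using a by (intro divide_left_mono) auto
    hence "1 / real a \<le> exp (- \<alpha>)" by (simp add: exp_minus inverse_eq_divide)
    thus ?thesis using harmonic_sum_le[OF a(3) True] la lb by linarith
  qed (use assms in simp)
  show ?thesis unfolding eq using lower upper by linarith
qed

lemma summable_window_masses:
  assumes "a > 0"
  shows "summable (\<lambda>n. mangoldt n / real n * real n powr (- a))"
    and "summable (\<lambda>n. one_coeff n / real n * real n powr (- a))"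
proof -
  have "summable (\<lambda>n. f n / real n * real n powr (- a))" if f: "log_bounded f" for f
  proof (rule summable_comparison_test[OF _ summable_log_majorant[of "1 + a"]])
    show "\<exists>N. \<forall>n\<ge>N. norm (f n / real n * real n powr (- a)) \<le> log_majorant (1 + a) n"
    proof (intro exI[of _ 1] allI impI)
      fix n :: nat assume n: "1 \<le> n"
      have "norm (f n / real n * real n powr (- a)) = \<bar>f n\<bar> * real n powr (- (1 + a))"
        using n by (simp add: abs_mult powr_diff powr_minus field_simps)
      also have "\<dots> \<le> (1 + ln (real n)) * real n powr (- (1 + a))"
        using f n by (intro mult_right_mono) (auto simp: log_bounded_def)
      finally show "norm (f n / real n * real n powr (- a)) \<le> log_majorant (1 + a) n"
        using n by (simp add: log_majorant_def)
    qed
  qed (use assms in auto)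
  thus "summable (\<lambda>n. mangoldt n / real n * real n powr (- a))"
    "summable (\<lambda>n. one_coeff n / real n * real n powr (- a))" by auto
qed

definition window :: "real \<Rightarrow> real \<Rightarrow> nat set" where
  "window x d = {n. n > 0 \<and> x < ln (real n) \<and> ln (real n) \<le> x + d}"

lemma finite_window: "finite (window x d)"
  using window_finite[of "x + d"] by (rule finite_subset[rotated]) (auto simp: window_def)

text \<open>With \<open>T = d ^ (-4)\<close> and smoothing margin \<open>d\<^sup>2\<close>, the analytic error \<open>T ^ 21 d / x\<close> is at most \<open>d\<^sup>2\<close>
  once \<open>x\<close> exceeds a multiple of \<open>d ^ (-86)\<close>.\<close>

lemma prime_windows:
  obtains K where "K \<ge> 1" "\<And>d x. 0 < d \<Longrightarrow> d \<le> 1/8 \<Longrightarrow> x \<ge> K / d ^ 86 \<Longrightarrow>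
    \<bar>(\<Sum>n\<in>window x d. mangoldt n / real n) - d\<bar> \<le> K * d\<^sup>2"
proof (rule prime_defect_windows)
  fix C :: real assume C: "C > 0" "\<And>T. T \<ge> 1 \<Longrightarrow> \<exists>\<delta>>0. \<forall>a \<alpha> \<beta>. 0 < a \<and> a \<le> \<delta> \<and> 0 < \<alpha> \<and> \<alpha> \<le> \<beta> \<longrightarrow>
    (\<exists>S. (\<lambda>n. (mangoldt n - one_coeff n) * real n powr (- 1 - a) * fejer_int T \<alpha> \<beta> (ln (real n))) sums S \<and>
     \<bar>S\<bar> \<le> C * T ^ 21 / \<alpha> * (\<beta> - \<alpha>))"
  define K where "K = 4 * C + 800"
  show ?thesis
  proof (rule that[of K])
    show "K \<ge> 1" using C by (simp add: K_def)
    fix d x :: real assume d: "0 < d" "d \<le> 1/8" and x: "x \<ge> K / d ^ 86"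
    define T where "T = 1 / d ^ 4"
    define \<eta> where "\<eta> = d\<^sup>2"
    have d4: "d ^ 4 \<le> 1" using d by (intro power_le_one) auto
    have T: "T \<ge> 1" "T > 0" using d d4 by (auto simp: T_def)
    have \<eta>: "0 < \<eta>" "8 * \<eta> \<le> d" "\<eta> \<le> 1/64"
    proof -
      show "0 < \<eta>" using d by (simp add: \<eta>_def)
      have "8 * \<eta> = (8 * d) * d" by (simp add: \<eta>_def power2_eq_square)
      also have "\<dots> \<le> 1 * d" using d by (intro mult_right_mono) auto
      finally show "8 * \<eta> \<le> d" by simp
      thus "\<eta> \<le> 1/64" using d by simp
    qed
    \<comment> \<open>With these choices every smoothing error, a multiple of 1/(T \<eta>), becomes
      a multiple of \<eta> = d^2.\<close>
    have T\<eta>: "T * \<eta> = 1 / \<eta>" using d by (simp add: T_def \<eta>_def field_simps flip: power_add)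
    have pw: "1 / d ^ k \<le> 1 / d ^ 86" if "k \<le> 86" for k
      using d that by (intro divide_left_mono power_decreasing) auto
    have xbig: "x \<ge> c / d ^ k" if "k \<le> 86" "0 \<le> c" "c \<le> K" for c k
    proof -
      have "c / d ^ k \<le> K * (1 / d ^ 86)" using mult_mono[OF that(3) pw[OF that(1)]] that d by simp
      thus ?thesis using x by simp
    qed
    have x800: "x \<ge> 800" using xbig[of 0 800] C by (simp add: K_def)
    obtain \<delta> where \<delta>: "\<delta> > 0" "\<forall>a \<alpha> \<beta>. 0 < a \<and> a \<le> \<delta> \<and> 0 < \<alpha> \<and> \<alpha> \<le> \<beta> \<longrightarrow>
      (\<exists>S. (\<lambda>n. (mangoldt n - one_coeff n) * real n powr (- 1 - a) * fejer_int T \<alpha> \<beta> (ln (real n))) sums S \<and>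
       \<bar>S\<bar> \<le> C * T ^ 21 / \<alpha> * (\<beta> - \<alpha>))"
      using C(2)[OF T(1)] by (elim exE conjE) (rule that)
    have powr_eq: "(mangoldt n - one_coeff n) * real n powr (- 1 - a) =
        (mangoldt n / real n - one_coeff n / real n) * real n powr (- a)" for n a
      by (cases "n = 0") (auto simp: powr_diff powr_minus field_simps)
    have S: "\<exists>S. (\<lambda>n. (mangoldt n / real n - one_coeff n / real n) * real n powr (- a) * fejer_int T \<alpha> \<beta> (ln (real n))) sums S
        \<and> \<bar>S\<bar> \<le> \<eta>" if a: "0 < a" "a \<le> \<delta>" and \<alpha>: "x / 2 \<le> \<alpha>" "\<alpha> \<le> \<beta>" "\<beta> - \<alpha> \<le> 2 * d" for a \<alpha> \<beta>
    proof -
      have \<alpha>0: "\<alpha> > 0" using \<alpha> x800 by simp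
      have "C * T ^ 21 / \<alpha> * (\<beta> - \<alpha>) \<le> C * T ^ 21 / (x / 2) * (2 * d)"
        using \<alpha> \<alpha>0 C(1) T x800 by (intro mult_mono divide_left_mono) auto
      also have "\<dots> = 4 * C / d ^ 85 * d\<^sup>2 / x"
        using d x800 by (simp add: T_def field_simps flip: power_mult power_add power_Suc)
      also have "\<dots> \<le> x * d\<^sup>2 / x"
        using xbig[of 85 "4 * C"] C(1) x800 by (intro divide_right_mono mult_right_mono) (auto simp: K_def)
      also have "\<dots> = \<eta>" using x800 by (simp add: \<eta>_def)
      finally have "C * T ^ 21 / \<alpha> * (\<beta> - \<alpha>) \<le> \<eta>" .
      moreover obtain s where "(\<lambda>n. (mangoldt n - one_coeff n) * real n powr (- 1 - a) *
          fejer_int T \<alpha> \<beta> (ln (real n))) sums s" "\<bar>s\<bar> \<le> C * T ^ 21 / \<alpha> * (\<beta> - \<alpha>)"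
        using \<delta>(2)[rule_format, of a \<alpha> \<beta>] a \<alpha>0 \<alpha>(2) by blast
      ultimately show ?thesis unfolding powr_eq by (intro exI[of _ s]) simp
    qed
    have small: "exp (- y) \<le> \<eta>" if "y \<ge> x / 2" for y
    proof -
      have y0: "y > 0" using that x800 by simp
      have "y \<le> exp y" using exp_ge_add_one_self[of y] by linarith
      have "exp (- y) = 1 / exp y" by (simp add: exp_minus field_simps)
      also have "\<dots> \<le> 1 / y" using y0 \<open>y \<le> exp y\<close> by (intro divide_left_mono) auto
      also have "\<dots> \<le> 1 / (1 / d\<^sup>2)"
      proof (intro divide_left_mono)
        show "1 / d\<^sup>2 \<le> y" using xbig[of 2 2] C that by (simp add: K_def)
      qed (use y0 d in auto)
      finally show ?thesis by (simp add: \<eta>_def)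
    qed
    have err: "8 / (T * \<eta>) = 8 * \<eta>" "32 * 9 / (T * \<eta>) = 288 * \<eta>" unfolding T\<eta> by simp_all
    let ?M = "\<Sum>n\<in>window x d. mangoldt n / real n"
    have M0: "?M \<ge> 0" by (intro sum_nonneg) (auto simp: mangoldt_nonneg)
    \<comment> \<open>Upper bound: the smoothing interval exceeds the window by \<eta> on both
      sides, and the comparison sum over 1/n by another \<eta>.\<close>
    let ?G = "{n. n > 0 \<and> x - 2 * \<eta> \<le> ln (real n) \<and> ln (real n) \<le> x + d + 2 * \<eta>}"
    have "?M * (1 - 8 / (T * \<eta>)) \<le> (\<Sum>n\<in>?G. one_coeff n / real n) + 32 * 9 / (T * \<eta>) + \<eta>"
    proof (rule window_transfer[OF T(2), where \<alpha> = "x - \<eta>" and \<beta> = "x + d + \<eta>" and \<delta> = \<delta>])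
      show "\<exists>S. (\<lambda>n. (mangoldt n / real n - one_coeff n / real n) * real n powr (- a) *
          fejer_int T (x - \<eta>) (x + d + \<eta>) (ln (real n))) sums S \<and> S \<le> \<eta>" if "0 < a" "a \<le> \<delta>" for a
        using S[OF that, of "x - \<eta>" "x + d + \<eta>"] x800 \<eta> d by fastforce
      show "finite ?G" using window_finite[of "x + d + 2 * \<eta>"] by (rule finite_subset[rotated]) auto
    qed (use \<eta> d \<delta>(1) x800 in \<open>auto simp: window_def mass_bounded_windows
        intro: summable_window_masses[unfolded times_divide_eq_left] finite_window[unfolded window_def]\<close>)
    moreover have "(\<Sum>n\<in>?G. one_coeff n / real n) \<le> (d + 4 * \<eta>) + \<eta>"
      using harmonic_window[of "x - 2 * \<eta>" "x + d + 2 * \<eta>"] small[of "x - 2 * \<eta>"] \<eta> x800 d by simp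
    ultimately have u1: "?M * (1 - 8 * \<eta>) \<le> d + 294 * \<eta>" unfolding err by simp
    \<comment> \<open>A crude bound first, so that the factor 1 - 8 \<eta> can be traded for an
      additive error.\<close>
    have "?M \<le> 10"
    proof -
      have "?M * (1/2) \<le> ?M * (1 - 8 * \<eta>)" using \<eta> M0 by (intro mult_left_mono) auto
      thus ?thesis using u1 \<eta> d by simp
    qed
    hence "?M * (8 * \<eta>) \<le> 10 * (8 * \<eta>)" using \<eta> by (intro mult_right_mono) auto
    hence upper: "?M \<le> d + 374 * \<eta>" using u1 by (simp add: algebra_simps)
    \<comment> \<open>Lower bound: the two weights exchange roles and the window shrinks. The
      additional \<eta> at the left end keeps the enlarged interval away from x, which
      \<open>window\<close> excludes.\<close>
    let ?F = "{n. n > 0 \<and> x + 3 * \<eta> \<le> ln (real n) \<and> ln (real n) \<le> x + d - 2 * \<eta>}"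
    have finF: "finite ?F" using window_finite[of "x + d - 2 * \<eta>"] by (rule finite_subset[rotated]) auto
    have "(\<Sum>n\<in>?F. one_coeff n / real n) * (1 - 8 / (T * \<eta>)) \<le> ?M + 32 * 9 / (T * \<eta>) + \<eta>"
    proof (rule window_transfer[OF T(2), where \<alpha> = "x + 2 * \<eta>" and \<beta> = "x + d - \<eta>" and \<delta> = \<delta>])
      fix a assume a: "0 < a" "a \<le> \<delta>"
      obtain s where s: "(\<lambda>n. (mangoldt n / real n - one_coeff n / real n) * real n powr (- a) *
          fejer_int T (x + 2 * \<eta>) (x + d - \<eta>) (ln (real n))) sums s" "\<bar>s\<bar> \<le> \<eta>"
        using S[OF a, of "x + 2 * \<eta>" "x + d - \<eta>"] x800 \<eta> d by force
      have "(\<lambda>n. (one_coeff n / real n - mangoldt n / real n) * real n powr (- a) *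
          fejer_int T (x + 2 * \<eta>) (x + d - \<eta>) (ln (real n))) sums (- s)"
        using sums_minus[OF s(1)] by (simp add: algebra_simps)
      thus "\<exists>S. (\<lambda>n. (one_coeff n / real n - mangoldt n / real n) * real n powr (- a) *
          fejer_int T (x + 2 * \<eta>) (x + d - \<eta>) (ln (real n))) sums S \<and> S \<le> \<eta>" using s(2) by force
    qed (use \<eta> d \<delta>(1) x800 finF in \<open>auto simp: window_def mass_bounded_windows
        intro: summable_window_masses[unfolded times_divide_eq_left] finite_window[unfolded window_def]\<close>)
    moreover have F1: "d - 6 * \<eta> \<le> (\<Sum>n\<in>?F. one_coeff n / real n)"
      using harmonic_window[of "x + 3 * \<eta>" "x + d - 2 * \<eta>"] small[of "x + 3 * \<eta>"] \<eta> x800 d by simp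
    moreover have "(d - 6 * \<eta>) * (1 - 8 * \<eta>) \<le> (\<Sum>n\<in>?F. one_coeff n / real n) * (1 - 8 * \<eta>)"
      using F1 \<eta> by (intro mult_right_mono) auto
    ultimately have "(d - 6 * \<eta>) * (1 - 8 * \<eta>) \<le> ?M + 289 * \<eta>" unfolding err by linarith
    moreover have "(d - 6 * \<eta>) * (1 - 8 * \<eta>) \<ge> d - 6 * \<eta> - 8 * \<eta>"
    proof -
      have "(d - 6 * \<eta>) * (8 * \<eta>) \<le> 1 * (8 * \<eta>)" using \<eta> d by (intro mult_right_mono) auto
      thus ?thesis by (simp add: algebra_simps)
    qed
    ultimately have lower: "d - 303 * \<eta> \<le> ?M" by simp
    have "\<bar>?M - d\<bar> \<le> 374 * \<eta>" using upper lower \<eta>(1) by (simp add: abs_le_iff)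
    also have "\<dots> \<le> K * \<eta>" using C \<eta> by (intro mult_right_mono) (auto simp: K_def)
    finally show "\<bar>?M - d\<bar> \<le> K * d\<^sup>2" by (simp add: \<eta>_def)
  qed
qed

subsection \<open>The prime number theorem with a weak error term\<close>

definition Psi :: "real \<Rightarrow> real" where
  "Psi y = (\<Sum>n | n > 0 \<and> ln (real n) \<le> y. mangoldt n)"

lemma ln_le_iff_le_exp: "n > 0 \<Longrightarrow> ln (real n) \<le> y \<longleftrightarrow> real n \<le> exp y"
  using exp_le_cancel_iff[of "ln (real n)" y] by simp

lemma Psi_step: "d \<ge> 0 \<Longrightarrow> Psi (y + d) = Psi y + (\<Sum>n\<in>window y d. mangoldt n)"
proof -
  assume d: "d \<ge> 0"
  have eq: "{n. n > 0 \<and> ln (real n) \<le> y + d} = {n. n > 0 \<and> ln (real n) \<le> y} \<union> window y d"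
    using d by (auto simp: window_def)
  have "{n. n > 0 \<and> ln (real n) \<le> y} \<inter> window y d = {}" by (auto simp: window_def)
  thus ?thesis
    unfolding Psi_def eq by (rule sum.union_disjoint[OF window_finite finite_window])
qed

lemma Psi_nonneg: "Psi y \<ge> 0"
  unfolding Psi_def by (intro sum_nonneg) (auto simp: mangoldt_nonneg)

lemma Psi_le: "Psi y \<le> 3 * exp y"
proof -
  define N where "N = nat \<lfloor>exp y\<rfloor>"
  have "Psi y \<le> psi N"
    unfolding Psi_def psi_def
  proof (intro sum_mono2)
    show "{n. n > 0 \<and> ln (real n) \<le> y} \<subseteq> {1..N}"
      using ln_le_iff_le_exp by (auto simp: N_def le_nat_floor)
  qed (auto simp: mangoldt_nonneg)
  also have "\<dots> \<le> 3 * real N" by (rule psi_le)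
  also have "\<dots> \<le> 3 * exp y" by (simp add: N_def)
  finally show ?thesis .
qed

lemma window_sum_bounds:
  "(\<Sum>n\<in>window y d. mangoldt n) \<le> exp (y + d) * (\<Sum>n\<in>window y d. mangoldt n / real n)"
  "exp y * (\<Sum>n\<in>window y d. mangoldt n / real n) \<le> (\<Sum>n\<in>window y d. mangoldt n)"
proof -
  have n: "n > 0" "exp y \<le> real n" "real n \<le> exp (y + d)" if "n \<in> window y d" for n
    using that ln_le_iff_le_exp[of n "y + d"] ln_ge_iff[of "real n" y] by (auto simp: window_def)
  have "mangoldt n \<le> exp (y + d) * (mangoldt n / real n)" if "n \<in> window y d" for n
    using mult_right_mono[OF n(3)[OF that], of "mangoldt n / real n"] n(1)[OF that] by (simp add: mangoldt_nonneg)
  thus "(\<Sum>n\<in>window y d. mangoldt n) \<le> exp (y + d) * (\<Sum>n\<in>window y d. mangoldt n / real n)"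
    unfolding sum_distrib_left by (rule sum_mono)
  have "exp y * (mangoldt n / real n) \<le> mangoldt n" if "n \<in> window y d" for n
    using mult_right_mono[OF n(2)[OF that], of "mangoldt n / real n"] n(1)[OF that] by (simp add: mangoldt_nonneg)
  thus "exp y * (\<Sum>n\<in>window y d. mangoldt n / real n) \<le> (\<Sum>n\<in>window y d. mangoldt n)"
    unfolding sum_distrib_left by (rule sum_mono)
qed

text \<open>The logarithmic interval from about L/2 to L is cut into windows of length d, each with
  relative error O(d). The increments grow geometrically with ratio e^d, so the errors do not
  accumulate: the induction reproduces a bound A e^y up to the contribution of the start, which is
  at most 3 exp(y0) <= 3 d exp(L).\<close>

lemma Psi_asymp:
  obtains K where "K \<ge> 1" "\<And>d L. 0 < d \<Longrightarrow> d \<le> 1/8 \<Longrightarrow> L \<ge> K / d ^ 86 \<Longrightarrow> \<bar>Psi L - exp L\<bar> \<le> K * d * exp L"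
proof (rule prime_windows)
  fix K :: real
  assume K: "K \<ge> 1" and win: "\<And>d x. 0 < d \<Longrightarrow> d \<le> 1/8 \<Longrightarrow> x \<ge> K / d ^ 86 \<Longrightarrow>
    \<bar>(\<Sum>n\<in>window x d. mangoldt n / real n) - d\<bar> \<le> K * d\<^sup>2"
  show thesis
  proof (rule that[of "2 * K + 4"])
    fix d L :: real assume d: "0 < d" "d \<le> 1/8" and L: "L \<ge> (2 * K + 4) / d ^ 86"
    have d86: "d ^ 86 > 0" "d ^ 86 \<le> d ^ 1" using d power_decreasing[of 1 86 d] by auto
    have L1: "L / 2 \<ge> K / d ^ 86"
      using L d86 by (simp add: field_simps)
    have "4 / d \<le> (2 * K + 4) / d ^ 86" using d86 d K by (intro frac_le) auto
    hence L2: "4 / d \<le> L" using L by simp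
    have "32 \<le> 4 / d" using d by (simp add: field_simps)
    hence L4: "L \<ge> 32" using L2 by linarith
    \<comment> \<open>The integer J is chosen so that J windows of length d end exactly at L and
      begin no lower than L/2, where the window estimate holds.\<close>
    define J where "J = nat \<lfloor>L / (2 * d)\<rfloor>"
    define y0 where "y0 = L - real J * d"
    have J: "real J \<le> L / (2 * d)" "L / (2 * d) \<le> real J + 1"
      unfolding J_def using L4 d by (auto intro: of_nat_floor divide_nonneg_nonneg)
    have "real J * d \<le> L / 2" "L / 2 \<le> real J * d + d"
      using mult_right_mono[OF J(1), of d] mult_right_mono[OF J(2), of d] d by (auto simp: algebra_simps)
    hence y0: "L / 2 \<le> y0" "y0 \<le> L / 2 + d" by (auto simp: y0_def)
    have w: "\<bar>(\<Sum>n\<in>window (y0 + real j * d) d. mangoldt n / real n) - d\<bar> \<le> K * d\<^sup>2" for j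
    proof (intro win d)
      have "0 \<le> real j * d" using d by simp
      thus "K / d ^ 86 \<le> y0 + real j * d" using L1 y0 by linarith
    qed
    have y_Suc: "y0 + real (Suc j) * d = y0 + real j * d + d" for j by (simp add: algebra_simps)
    have e0: "exp y0 \<le> d * exp L"
    proof -
      have "L / 4 + 1 \<le> exp (L / 4)" using exp_ge_add_one_self[of "L / 4"] by linarith
      hence "1 / d \<le> exp (L / 4)" using L2 d by simp
      hence "1 \<le> d * exp (L / 4)" using d by (simp add: field_simps)
      moreover have "exp y0 \<le> exp (L - L / 4)" using y0 d L4 by (subst exp_le_cancel_iff) auto
      ultimately have "1 * exp y0 \<le> (d * exp (L / 4)) * exp (L - L / 4)" using d by (intro mult_mono) auto
      also have "\<dots> = d * exp (L / 4 + (L - L / 4))" unfolding exp_add by (simp only: mult.assoc)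
      also have "L / 4 + (L - L / 4) = L" by simp
      finally show ?thesis by simp
    qed
    \<comment> \<open>With exp(-d) <= 1/(1 + d), this A is the fixed point of the recursion A ->
      A/(1 + d) + d + K d^2.\<close>
    define A where "A = (1 + K * d) * (1 + d)"
    have A: "A * exp (- d) + (d + K * d\<^sup>2) \<le> A"
    proof -
      have "exp (- d) \<le> 1 / (1 + d)"
        using exp_ge_add_one_self[of d] d by (simp add: exp_minus inverse_eq_divide divide_left_mono)
      hence "A * exp (- d) \<le> A * (1 / (1 + d))" using K d by (intro mult_left_mono) (auto simp: A_def)
      also have "\<dots> = 1 + K * d" using d by (simp add: A_def)
      finally show ?thesis by (simp add: A_def algebra_simps power2_eq_square)
    qed
    have up: "Psi (y0 + real j * d) \<le> A * exp (y0 + real j * d) + Psi y0" for j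
    proof (induction j)
      case 0
      show ?case using K d by (simp add: A_def)
    next
      case (Suc j)
      let ?y = "y0 + real j * d"
      have "Psi (?y + d) \<le> A * exp ?y + Psi y0 + exp (?y + d) * (d + K * d\<^sup>2)"
      proof -
        have "(\<Sum>n\<in>window ?y d. mangoldt n / real n) \<le> d + K * d\<^sup>2" using w[of j] by linarith
        hence "exp (?y + d) * (\<Sum>n\<in>window ?y d. mangoldt n / real n) \<le> exp (?y + d) * (d + K * d\<^sup>2)"
          by (intro mult_left_mono) auto
        thus ?thesis using Psi_step[of d ?y] d Suc window_sum_bounds(1)[of ?y d] by linarith
      qed
      also have "A * exp ?y = exp (?y + d) * (A * exp (- d))" by (simp add: exp_add exp_minus)
      also have "exp (?y + d) * (A * exp (- d)) + Psi y0 + exp (?y + d) * (d + K * d\<^sup>2) =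
          exp (?y + d) * (A * exp (- d) + (d + K * d\<^sup>2)) + Psi y0" by (simp add: algebra_simps)
      also have "\<dots> \<le> exp (?y + d) * A + Psi y0" using A by (intro add_right_mono mult_left_mono) auto
      finally show ?case unfolding y_Suc by (simp add: mult.commute)
    qed
    have yJ: "y0 + real J * d = L" by (simp add: y0_def)
    have "Psi L \<le> A * exp L + 3 * exp y0" using up[of J] Psi_le[of y0] unfolding yJ by linarith
    also have "\<dots> \<le> A * exp L + 3 * (d * exp L)" using e0 by simp
    also have "\<dots> = (A + 3 * d) * exp L" by (simp add: algebra_simps)
    also have "A + 3 * d \<le> 1 + (2 * K + 4) * d"
    proof -
      have "K * d * d \<le> K * d * 1" using K d by (intro mult_left_mono) auto
      thus ?thesis by (simp add: A_def algebra_simps)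
    qed
    finally have upper: "Psi L \<le> (1 + (2 * K + 4) * d) * exp L" by simp
    have lower: "(1 - (2 * K + 4) * d) * exp L \<le> Psi L"
    proof (cases "K * d \<le> 1")
      case False
      hence "1 - (2 * K + 4) * d \<le> 0" using d K by (simp add: algebra_simps)
      hence "(1 - (2 * K + 4) * d) * exp L \<le> 0" by (intro mult_nonpos_nonneg) auto
      thus ?thesis using Psi_nonneg[of L] by linarith
    next
      case True
      \<comment> \<open>Counterpart of A for the lower bound, using e^d - 1 <= d (1 + d). Comparing
        with exp(y) - exp(y0) makes the induction start at 0.\<close>
      define B where "B = (1 - K * d) / (1 + d)"
      have "0 \<le> K * d" using d K by simp
      hence B0: "0 \<le> B" "B \<le> 1" using True d by (auto simp: B_def divide_simps)
      have B: "B * (exp d - 1) \<le> d - K * d\<^sup>2"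
      proof -
        have "exp d - 1 \<le> d * (1 + d)" using exp_bound[of d] d by (simp add: algebra_simps power2_eq_square)
        hence "B * (exp d - 1) \<le> B * (d * (1 + d))" using B0 by (intro mult_left_mono)
        also have "\<dots> = d * (1 - K * d)" using d by (simp add: B_def)
        finally show ?thesis by (simp add: algebra_simps power2_eq_square)
      qed
      have lo: "B * (exp (y0 + real j * d) - exp y0) \<le> Psi (y0 + real j * d)" for j
      proof (induction j)
        case 0
        show ?case using Psi_nonneg by simp
      next
        case (Suc j)
        let ?y = "y0 + real j * d"
        have "d - K * d\<^sup>2 \<le> (\<Sum>n\<in>window ?y d. mangoldt n / real n)" using w[of j] by linarith
        hence "exp ?y * (d - K * d\<^sup>2) \<le> exp ?y * (\<Sum>n\<in>window ?y d. mangoldt n / real n)"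
          by (intro mult_left_mono) auto
        hence "B * (exp ?y - exp y0) + exp ?y * (d - K * d\<^sup>2) \<le> Psi (?y + d)"
          using Psi_step[of d ?y] d Suc window_sum_bounds(2)[of ?y d] by linarith
        moreover have "exp ?y * (B * (exp d - 1)) \<le> exp ?y * (d - K * d\<^sup>2)" using B by (intro mult_left_mono) auto
        moreover have "B * (exp (?y + d) - exp y0) = B * (exp ?y - exp y0) + exp ?y * (B * (exp d - 1))"
          by (simp add: exp_add algebra_simps)
        ultimately show ?case unfolding y_Suc by linarith
      qed
      have "1 - K * d - d \<le> B"
      proof -
        have "(1 - K * d - d) * (1 + d) \<le> 1 - K * d"
          using K d mult_nonneg_nonneg[of d "K * d + d"] by (simp add: algebra_simps)
        thus ?thesis using d by (simp add: B_def pos_le_divide_eq)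
      qed
      hence "(1 - K * d - d) * exp L \<le> B * exp L" by (intro mult_right_mono) auto
      moreover have "B * exp y0 \<le> 1 * (d * exp L)" using B0 e0 by (intro mult_mono) auto
      moreover have "B * (exp L - exp y0) \<le> Psi L" using lo[of J] unfolding yJ .
      ultimately have "(1 - K * d - d) * exp L - d * exp L \<le> Psi L" by (simp add: algebra_simps)
      moreover have "(1 - (2 * K + 4) * d) * exp L \<le> ((1 - K * d - d) - d) * exp L"
        using d K by (intro mult_right_mono) (auto simp: algebra_simps)
      ultimately show ?thesis by (simp add: algebra_simps)
    qed
    show "\<bar>Psi L - exp L\<bar> \<le> (2 * K + 4) * d * exp L"
      using upper lower by (simp add: abs_le_iff algebra_simps)
  qed (use K in simp)
qed

definition prime_count :: "real \<Rightarrow> real" where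
  "prime_count x = real (card {p. prime p \<and> real p \<le> x})"

lemma finite_primes_le: "finite {p. prime p \<and> real p \<le> x}"
  by (rule finite_subset[of _ "{..nat \<lfloor>x\<rfloor>}"]) (auto simp: le_nat_floor)

text \<open>The choice d = 1/log log z satisfies the condition of \<open>Psi_asymp\<close>, which
  becomes log z >= K (log log z)^86 and holds for large z.\<close>

lemma Psi_asymp_eventually:
  obtains K where "K \<ge> 1" "\<forall>\<^sub>F z in at_top. \<bar>Psi (ln z) - z\<bar> \<le> K * z / ln (ln z)"
proof (rule Psi_asymp)
  fix K :: real
  assume K: "K \<ge> 1" and *: "\<And>d L. 0 < d \<Longrightarrow> d \<le> 1/8 \<Longrightarrow> L \<ge> K / d ^ 86 \<Longrightarrow> \<bar>Psi L - exp L\<bar> \<le> K * d * exp L"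
  show thesis
  proof (rule that[OF K])
    have "\<forall>\<^sub>F z::real in at_top. ln (ln z) \<ge> 8" by real_asymp
    moreover have "\<forall>\<^sub>F z::real in at_top. K * ln (ln z) ^ 86 \<le> ln z" using K by real_asymp
    moreover have "\<forall>\<^sub>F z::real in at_top. z > 0" by (rule eventually_gt_at_top)
    ultimately show "\<forall>\<^sub>F z in at_top. \<bar>Psi (ln z) - z\<bar> \<le> K * z / ln (ln z)"
    proof eventually_elim
      case (elim z)
      have "\<bar>Psi (ln z) - exp (ln z)\<bar> \<le> K * (1 / ln (ln z)) * exp (ln z)"
        using elim by (intro *) (auto simp: divide_simps power_divide)
      thus ?case using elim by simp
    qed
  qed
qed

text \<open>Primes up to w = z/(log z)^2 are counted trivially. Each larger prime contributes at
  least log w = log z - 2 log log z to \<open>Psi\<close>, and replacing log w by log z is a smaller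
  relative error than 1/log log z.\<close>

lemma prime_count_upper:
  obtains C where "C \<ge> 1" "\<forall>\<^sub>F z in at_top. prime_count z \<le> z / ln z + C * z / (ln z * ln (ln z))"
proof (rule Psi_asymp_eventually)
  fix K :: real
  assume K: "K \<ge> 1" and *: "\<forall>\<^sub>F z in at_top. \<bar>Psi (ln z) - z\<bar> \<le> K * z / ln (ln z)"
  have "\<forall>\<^sub>F l::real in at_top. 1 / l\<^sup>2 + (1 + K / ln l) / (l - 2 * ln l) \<le> 1 / l + (K + 1) / (l * ln l)"
    using K by real_asymp
  hence ev: "\<forall>\<^sub>F z::real in at_top. 1 / (ln z)\<^sup>2 + (1 + K / ln (ln z)) / (ln z - 2 * ln (ln z))
      \<le> 1 / ln z + (K + 1) / (ln z * ln (ln z))"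
    using eventually_compose_filterlim[OF _ ln_at_top] by blast
  have ev1: "\<forall>\<^sub>F z::real in at_top. ln z - 2 * ln (ln z) \<ge> 1" by real_asymp
  have ev2: "\<forall>\<^sub>F z::real in at_top. ln z \<ge> 1" by real_asymp
  show thesis
  proof (rule that[of "K + 1"])
    from * ev ev1 ev2 eventually_gt_at_top[of "1::real"]
    show "\<forall>\<^sub>F z in at_top. prime_count z \<le> z / ln z + (K + 1) * z / (ln z * ln (ln z))"
    proof eventually_elim
      case (elim z)
      define w where "w = z / (ln z)\<^sup>2"
      have w0: "w > 0" using elim by (simp add: w_def)
      have lnw: "ln w = ln z - 2 * ln (ln z)" using elim by (simp add: w_def ln_div ln_realpow)
      have lw: "ln w \<ge> 1" using elim lnw by simp
      let ?P = "{p. prime p \<and> real p \<le> z}" and ?Q = "{p. prime p \<and> w < real p \<and> real p \<le> z}"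
      have finQ: "finite ?Q" using finite_primes_le[of z] by (rule finite_subset[rotated]) auto
      have "?P \<subseteq> {0<..nat \<lfloor>w\<rfloor>} \<union> ?Q"
      proof
        fix p assume "p \<in> ?P"
        thus "p \<in> {0<..nat \<lfloor>w\<rfloor>} \<union> ?Q"
          by (cases "real p \<le> w") (auto simp: le_nat_floor prime_gt_0_nat)
      qed
      hence "card ?P \<le> card ({0<..nat \<lfloor>w\<rfloor>} \<union> ?Q)" using finQ by (intro card_mono) auto
      also have "\<dots> \<le> nat \<lfloor>w\<rfloor> + card ?Q" using card_Un_le[of "{0<..nat \<lfloor>w\<rfloor>}" ?Q] by simp
      finally have "prime_count z \<le> real (nat \<lfloor>w\<rfloor>) + real (card ?Q)" unfolding prime_count_def by linarith
      also have "real (nat \<lfloor>w\<rfloor>) \<le> w" using w0 by simp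
      also have "real (card ?Q) \<le> Psi (ln z) / ln w"
      proof -
        have "real (card ?Q) * ln w = (\<Sum>p\<in>?Q. ln w)" by simp
        also have "\<dots> \<le> (\<Sum>p\<in>?Q. mangoldt p)"
        proof (intro sum_mono)
          fix p assume p: "p \<in> ?Q"
          have "ln w \<le> ln (real p)" using p w0 by (subst ln_le_cancel_iff) auto
          thus "ln w \<le> mangoldt p" using p by simp
        qed
        also have "\<dots> \<le> Psi (ln z)" unfolding Psi_def
        proof (intro sum_mono2 window_finite)
          show "?Q \<subseteq> {n. n > 0 \<and> ln (real n) \<le> ln z}" using elim by (auto simp: prime_gt_0_nat)
        qed (auto simp: mangoldt_nonneg)
        finally show ?thesis using lw by (simp add: pos_le_divide_eq)
      qed
      also have "w + Psi (ln z) / ln w \<le> w + (z + K * z / ln (ln z)) / ln w"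
        using elim lw by (intro add_left_mono divide_right_mono) linarith+
      also have "\<dots> = z * (1 / (ln z)\<^sup>2 + (1 + K / ln (ln z)) / (ln z - 2 * ln (ln z)))"
        unfolding lnw unfolding w_def by (simp add: algebra_simps add_divide_distrib)
      also have "\<dots> \<le> z * (1 / ln z + (K + 1) / (ln z * ln (ln z)))"
        using elim by (intro mult_left_mono) auto
      also have "\<dots> = z / ln z + (K + 1) * z / (ln z * ln (ln z))" by (simp add: algebra_simps)
      finally show ?case by simp
    qed
  qed (use K in simp)
qed

text \<open>A proper prime power p^k <= z has p <= sqrt z and k <= log z / log 2, so there are few
  of them, each with \<Lambda> at most log z.\<close>

lemma prime_powers_bound:
  assumes z: "z \<ge> 1"
  shows "Psi (ln z) \<le> prime_count z * ln z + (sqrt z + 1) * (ln z / ln 2 + 1) * ln z"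
proof -
  let ?N = "{n. n > 0 \<and> ln (real n) \<le> ln z}"
  let ?P = "{p. prime p \<and> real p \<le> z}"
  let ?A = "{n\<in>?N. \<not> prime n \<and> primepow n}"
  define s t where "s = nat \<lfloor>sqrt z\<rfloor>" "t = nat \<lfloor>ln z / ln 2\<rfloor>"
  have nz: "real n \<le> z" if "n \<in> ?N" for n
    using that z ln_le_iff_le_exp[of n "ln z"] by simp
  have mz: "mangoldt n \<le> ln z" if "n \<in> ?N" for n
    using mangoldt_le_ln[of n] that by auto
  have sub: "?A \<subseteq> (\<lambda>(p, k). p ^ k) ` ({..s} \<times> {..t})"
  proof
    fix n assume n: "n \<in> ?A"
    then obtain p k where pk: "prime p" "k > 0" "n = p ^ k" by (auto simp: primepow_def)
    have "k \<noteq> 1" using n pk by auto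
    hence k: "k \<ge> 2" using pk by simp
    have p2: "p \<ge> 2" using pk prime_ge_2_nat by blast
    have "p ^ 2 \<le> n" unfolding pk(3) using k p2 by (intro power_increasing) auto
    hence "(real p)\<^sup>2 \<le> z" using nz[of n] n by (metis (no_types, lifting) mem_Collect_eq of_nat_le_iff of_nat_power order_trans)
    hence "p \<le> s" unfolding s_t_def by (intro le_nat_floor) (simp add: real_le_rsqrt)
    moreover have "(2::nat) ^ k \<le> n" unfolding pk(3) using p2 by (intro power_mono) auto
    hence "(2::real) ^ k \<le> z" using nz[of n] n by (metis (no_types, lifting) mem_Collect_eq of_nat_le_iff of_nat_numeral of_nat_power order_trans)
    hence "ln ((2::real) ^ k) \<le> ln z" using z by (subst ln_le_cancel_iff) auto
    hence "real k \<le> ln z / ln 2" by (simp add: ln_realpow pos_le_divide_eq)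
    hence "k \<le> t" unfolding s_t_def by (rule le_nat_floor)
    ultimately show "n \<in> (\<lambda>(p, k). p ^ k) ` ({..s} \<times> {..t})" using pk(3) by auto
  qed
  have finA: "finite ?A" by (rule finite_subset[OF sub]) auto
  have "card ?A \<le> card ((\<lambda>(p, k). p ^ k) ` ({..s} \<times> {..t}))" by (intro card_mono sub) auto
  also have "\<dots> \<le> card ({..s} \<times> {..t})" by (rule card_image_le) auto
  also have "\<dots> = (s + 1) * (t + 1)" by simp
  finally have "real (card ?A) \<le> real ((s + 1) * (t + 1))" by (simp only: of_nat_le_iff)
  also have "\<dots> = (real s + 1) * (real t + 1)" by (simp add: algebra_simps)
  also have "\<dots> \<le> (sqrt z + 1) * (ln z / ln 2 + 1)"
    using z unfolding s_t_def by (intro mult_mono add_right_mono) auto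
  finally have cA: "real (card ?A) \<le> (sqrt z + 1) * (ln z / ln 2 + 1)" .
  have "Psi (ln z) \<le> (\<Sum>n\<in>?P \<union> ?A. mangoldt n)"
    unfolding Psi_def
  proof (rule order_trans[OF eq_refl sum_mono2[OF _ _ mangoldt_nonneg]])
    show "(\<Sum>n\<in>?N. mangoldt n) = (\<Sum>n\<in>(?P \<inter> ?N) \<union> ?A. mangoldt n)"
      by (rule sum.mono_neutral_right) (use nz in \<open>auto simp: mangoldt_def window_finite\<close>)
  qed (use finite_primes_le finA in auto)
  also have "\<dots> \<le> (\<Sum>n\<in>?P. mangoldt n) + (\<Sum>n\<in>?A. mangoldt n)"
    using finite_primes_le finA by (subst sum.union_disjoint) auto
  also have "(\<Sum>n\<in>?P. mangoldt n) \<le> (\<Sum>n\<in>?P. ln z)"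
    using z by (intro sum_mono mz) (auto simp: prime_gt_0_nat)
  also have "(\<Sum>n\<in>?A. mangoldt n) \<le> (\<Sum>n\<in>?A. ln z)" by (intro sum_mono mz) auto
  also have "(\<Sum>n\<in>?P. ln z) + (\<Sum>n\<in>?A. ln z) = prime_count z * ln z + real (card ?A) * ln z"
    by (simp add: prime_count_def)
  also have "\<dots> \<le> prime_count z * ln z + (sqrt z + 1) * (ln z / ln 2 + 1) * ln z"
    using cA z by (intro add_left_mono mult_right_mono) auto
  finally show ?thesis by simp
qed

lemma prime_count_lower:
  obtains C where "C \<ge> 1" "\<forall>\<^sub>F z in at_top. prime_count z \<ge> z / ln z - C * z / (ln z * ln (ln z))"
proof (rule Psi_asymp_eventually)
  fix K :: real
  assume K: "K \<ge> 1" and *: "\<forall>\<^sub>F z in at_top. \<bar>Psi (ln z) - z\<bar> \<le> K * z / ln (ln z)"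
  have ev: "\<forall>\<^sub>F z::real in at_top. (sqrt z + 1) * (ln z / ln 2 + 1) * ln z \<le> z / ln (ln z)"
    by real_asymp
  have ev2: "\<forall>\<^sub>F z::real in at_top. ln z \<ge> 1" by real_asymp
  show thesis
  proof (rule that[of "K + 1"])
    from * ev ev2 eventually_gt_at_top[of "1::real"]
    show "\<forall>\<^sub>F z in at_top. prime_count z \<ge> z / ln z - (K + 1) * z / (ln z * ln (ln z))"
    proof eventually_elim
      case (elim z)
      have "z - K * z / ln (ln z) \<le> prime_count z * ln z + z / ln (ln z)"
        using prime_powers_bound[of z] elim by linarith
      hence "(z - (K + 1) * (z / ln (ln z))) / ln z \<le> prime_count z"
        using elim by (simp add: pos_divide_le_eq algebra_simps add_divide_distrib)
      thus ?case by (simp add: diff_divide_distrib mult.commute)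
    qed
  qed (use K in simp)
qed

subsection \<open>Mertens' theorems\<close>

definition plog :: "nat \<Rightarrow> real" where
  "plog N = (\<Sum>p | prime p \<and> p \<le> N. ln (real p) / real p)"

definition precip :: "nat \<Rightarrow> real" where
  "precip N = (\<Sum>p | prime p \<and> p \<le> N. 1 / real p)"

lemma finite_primes_nat_le: "finite {p::nat. prime p \<and> p \<le> N}"
  by (rule finite_subset[of _ "{..N}"]) auto

lemma ln_fact_ge: "N \<ge> 1 \<Longrightarrow> real N * ln (real N) - real N \<le> ln (fact N)"
proof (induction N rule: dec_induct)
  case (step N)
  have N: "N \<ge> 1" using step by simp
  have "ln (1 + 1 / real N) \<le> 1 / real N" by (rule ln_add_one_self_le_self) simp
  also have "1 + 1 / real N = (real N + 1) / real N" using N by (simp add: field_simps)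
  finally have "real N * (ln (real N + 1) - ln (real N)) \<le> 1" using N by (simp add: ln_div field_simps)
  moreover have "ln (fact (Suc N) :: real) = ln (real N + 1) + ln (fact N)"
  proof -
    have eq: "(fact (Suc N) :: real) = (real N + 1) * fact N" by (simp add: algebra_simps)
    show ?thesis unfolding eq by (subst ln_mult) auto
  qed
  moreover have "real (Suc N) = real N + 1" by simp
  ultimately show ?case using step.IH by (simp only: algebra_simps)
qed simp

lemma ln_fact_le: "N \<ge> 1 \<Longrightarrow> ln (fact N) \<le> real N * ln (real N)"
proof -
  assume N: "N \<ge> 1"
  have "ln (fact N :: real) \<le> ln (real N ^ N)"
    using fact_le_power[of N, where 'a = real] N by (subst ln_le_cancel_iff) auto
  thus ?thesis using N by (simp add: ln_realpow)
qed

text \<open>Both sides are read off from log N!, the sum of \<Lambda>(m) [N/m]: dropping the floors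
  costs at most \<psi>(N) <= 3 N, and log N! is N log N up to N.\<close>

lemma mangoldt_mertens:
  assumes N: "N \<ge> 1"
  shows "\<bar>(\<Sum>m=1..N. mangoldt m / real m) - ln (real N)\<bar> \<le> 3"
proof -
  let ?S = "\<Sum>m=1..N. mangoldt m / real m"
  have "ln (fact N) \<le> (\<Sum>m=1..N. mangoldt m * (real N / real m))"
    unfolding ln_fact_eq_mangoldt
    by (intro sum_mono mult_left_mono mangoldt_nonneg) (rule of_nat_div_le_of_nat)
  also have "\<dots> = real N * ?S" by (simp add: sum_distrib_left mult_ac)
  finally have "real N * (ln (real N) - 1) \<le> real N * ?S" using ln_fact_ge[OF N] by (simp add: algebra_simps)
  hence 1: "ln (real N) - 1 \<le> ?S" using N by simp
  have "real N * ?S - psi N = (\<Sum>m=1..N. mangoldt m * (real N / real m - 1))"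
    by (simp add: psi_def sum_distrib_left algebra_simps sum_subtractf)
  also have "\<dots> \<le> ln (fact N)" unfolding ln_fact_eq_mangoldt
  proof (intro sum_mono mult_left_mono mangoldt_nonneg)
    fix m
    have "real N / real m < real (N div m) + 1"
      by (metis floor_divide_of_nat_eq of_int_of_nat_eq real_of_int_floor_add_one_gt)
    thus "real N / real m - 1 \<le> real (N div m)" by simp
  qed
  also have "\<dots> \<le> real N * ln (real N)" by (rule ln_fact_le[OF N])
  finally have "real N * ?S \<le> real N * (ln (real N) + 3)" using psi_le[of N] by (simp add: algebra_simps)
  hence "?S \<le> ln (real N) + 3" using N by simp
  thus ?thesis using 1 by (simp add: abs_le_iff)
qed

lemma sum_image_le_sum:
  fixes f :: "'b \<Rightarrow> real"
  assumes "finite A" "\<And>x. x \<in> A \<Longrightarrow> f (g x) \<ge> 0"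
  shows "(\<Sum>y\<in>g ` A. f y) \<le> (\<Sum>x\<in>A. f (g x))"
  using sum_image_le[of A f g] assms by (simp add: o_def)

lemma geometric_tail: "p \<ge> 2 \<Longrightarrow> (\<Sum>k=2..N. 1 / real p ^ k) \<le> 2 / (real p)\<^sup>2"
proof -
  assume p: "p \<ge> 2"
  have "(\<Sum>k=2..N. 1 / real p ^ k) \<le> 2 / (real p)\<^sup>2 - 1 / real p ^ N" if "N \<ge> 2"
    using that
  proof (induction N rule: dec_induct)
    case base
    thus ?case by (simp add: power2_eq_square)
  next
    case (step N)
    have "2 / real p ^ Suc N \<le> 1 / real p ^ N" using p by (simp add: divide_simps)
    thus ?case using step by simp
  qed
  moreover have "1 / real p ^ N \<ge> 0" by simp
  ultimately show ?thesis by (cases "N \<ge> 2") (linarith, simp)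
qed

text \<open>Higher prime powers contribute at most twice the sum of (1 + log p)/p^2, bounded by the
  convergent series of \<open>log_majorant 2\<close>.\<close>

lemma plog_mertens:
  obtains C where "C \<ge> 1" "\<And>N. N \<ge> 1 \<Longrightarrow> \<bar>plog N - ln (real N)\<bar> \<le> C"
proof -
  define C0 where "C0 = (\<Sum>n. log_majorant 2 n)"
  have sm: "summable (log_majorant 2)" by (rule summable_log_majorant) simp
  have lm0: "log_majorant 2 n \<ge> 0" for n by (cases "n = 0") (auto simp: log_majorant_def)
  have C0: "C0 \<ge> 0" unfolding C0_def by (intro suminf_nonneg sm lm0)
  show ?thesis
  proof (rule that[of "3 + 2 * C0"])
    fix N :: nat assume N: "N \<ge> 1"
    let ?P = "{p. prime p \<and> p \<le> N}"
    let ?A = "{n\<in>{1..N}. primepow n \<and> \<not> prime n}"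
    have "(\<Sum>m=1..N. mangoldt m / real m) = (\<Sum>m\<in>?P \<union> ?A. mangoldt m / real m)"
      by (rule sum.mono_neutral_right) (auto simp: mangoldt_def prime_gt_0_nat Suc_le_eq)
    also have "\<dots> = (\<Sum>m\<in>?P. mangoldt m / real m) + (\<Sum>m\<in>?A. mangoldt m / real m)"
      using finite_primes_nat_le by (intro sum.union_disjoint) auto
    also have "(\<Sum>m\<in>?P. mangoldt m / real m) = plog N" unfolding plog_def by (intro sum.cong) auto
    finally have eq: "(\<Sum>m=1..N. mangoldt m / real m) = plog N + (\<Sum>m\<in>?A. mangoldt m / real m)" .
    have A0: "(\<Sum>m\<in>?A. mangoldt m / real m) \<ge> 0" by (intro sum_nonneg) (auto simp: mangoldt_nonneg)
    let ?B = "{p. prime p \<and> p \<le> N} \<times> {2..N}"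
    have sub: "?A \<subseteq> (\<lambda>(p, k). p ^ k) ` ?B"
    proof
      fix n assume n: "n \<in> ?A"
      then obtain p k where pk: "prime p" "k > 0" "n = p ^ k" by (auto simp: primepow_def)
      have "k \<noteq> 1" using n pk by auto
      hence k: "k \<ge> 2" using pk by simp
      have p2: "p \<ge> 2" using pk prime_ge_2_nat by blast
      have "p ^ 1 \<le> n" unfolding pk(3) using k p2 by (intro power_increasing) auto
      moreover have "(2::nat) ^ k \<le> n" unfolding pk(3) using p2 by (intro power_mono) auto
      hence "k \<le> n" using less_exp[of k] by linarith
      ultimately have "p \<le> N" "k \<le> N" using n by auto
      thus "n \<in> (\<lambda>(p, k). p ^ k) ` ?B" using pk k by auto
    qed
    have finB: "finite ?B" using finite_primes_nat_le by auto
    have "(\<Sum>m\<in>?A. mangoldt m / real m) \<le> (\<Sum>m\<in>(\<lambda>(p, k). p ^ k) ` ?B. mangoldt m / real m)"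
      using finB sub by (intro sum_mono2) (auto simp: mangoldt_nonneg)
    also have "\<dots> \<le> (\<Sum>x\<in>?B. mangoldt ((\<lambda>(p, k). p ^ k) x) / real ((\<lambda>(p, k). p ^ k) x))"
      using finB by (intro sum_image_le_sum) (auto simp: mangoldt_nonneg)
    also have "\<dots> = (\<Sum>(p, k)\<in>?B. ln (real p) * (1 / real p ^ k))"
      by (intro sum.cong refl) (auto simp: mangoldt_primepow)
    also have "\<dots> = (\<Sum>p\<in>?P. ln (real p) * (\<Sum>k=2..N. 1 / real p ^ k))"
      by (simp add: sum.cartesian_product[symmetric] sum_distrib_left)
    also have "\<dots> \<le> (\<Sum>p\<in>?P. 2 * log_majorant 2 p)"
    proof (intro sum_mono)
      fix p assume p: "p \<in> ?P"
      hence p2: "p \<ge> 2" using prime_ge_2_nat by auto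
      have "ln (real p) * (\<Sum>k=2..N. 1 / real p ^ k) \<le> (1 + ln (real p)) * (2 / (real p)\<^sup>2)"
        using p2 by (intro mult_mono geometric_tail) (auto intro: sum_nonneg)
      also have "\<dots> = 2 * log_majorant 2 p"
        using p2 by (simp add: log_majorant_def powr_minus powr_numeral field_simps)
      finally show "ln (real p) * (\<Sum>k=2..N. 1 / real p ^ k) \<le> 2 * log_majorant 2 p" .
    qed
    also have "\<dots> = 2 * (\<Sum>p\<in>?P. log_majorant 2 p)" by (simp add: sum_distrib_left)
    also have "\<dots> \<le> 2 * C0" unfolding C0_def
      by (intro mult_left_mono sum_le_suminf sm finite_primes_nat_le) (auto simp: lm0)
    finally show "\<bar>plog N - ln (real N)\<bar> \<le> 3 + 2 * C0"
      using mangoldt_mertens[OF N] A0 unfolding eq by linarith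
  qed (use C0 in simp)
qed

text \<open>Partial summation in discrete form. Subtracting \<open>plog N / ln N\<close> cancels the
  jumps at the primes, so R grows by plog(N) (1/log N - 1/log(N + 1)). This matches the increment of
  log log N up to a multiple of the decrease of 1/log N, and these errors telescope.\<close>

lemma precip_mertens:
  obtains C where "C \<ge> 1" "\<And>N. N \<ge> 2 \<Longrightarrow> \<bar>precip N - ln (ln (real N))\<bar> \<le> C"
proof (rule plog_mertens)
  fix C :: real assume C: "C \<ge> 1" "\<And>N. N \<ge> 1 \<Longrightarrow> \<bar>plog N - ln (real N)\<bar> \<le> C"
  define R where "R = (\<lambda>N. precip N - plog N / ln (real N))"
  define \<delta> where "\<delta> = (\<lambda>N. 1 / ln (real N))"
  have R_Suc: "R (Suc N) - R N = plog N * (\<delta> N - \<delta> (Suc N))" if N: "N \<ge> 2" for N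
  proof (cases "prime (Suc N)")
    case True
    have "{p. prime p \<and> p \<le> Suc N} = insert (Suc N) {p. prime p \<and> p \<le> N}" using True by auto
    hence "precip (Suc N) = precip N + 1 / real (Suc N)" "plog (Suc N) = plog N + ln (real (Suc N)) / real (Suc N)"
      unfolding precip_def plog_def using finite_primes_nat_le[of N] by simp_all
    moreover define l s where "l = ln (real (Suc N))" "s = real (Suc N)"
    moreover have "l > 0" unfolding l_s_def using N by (intro ln_gt_zero) auto
    hence "(plog N + l / s) / l = plog N / l + 1 / s" by (simp add: add_divide_distrib)
    ultimately show ?thesis by (simp only: R_def \<delta>_def) (simp add: algebra_simps)
  next
    case False
    have "{p. prime p \<and> p \<le> Suc N} = {p. prime p \<and> p \<le> N}" using False le_Suc_eq by auto
    hence "precip (Suc N) = precip N" "plog (Suc N) = plog N" unfolding precip_def plog_def by simp_all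
    thus ?thesis by (simp add: R_def \<delta>_def algebra_simps)
  qed
  have key: "\<bar>(R (Suc N) - R N) - (ln (ln (real (Suc N))) - ln (ln (real N)))\<bar> \<le> (C + 1) * (\<delta> N - \<delta> (Suc N))"
    if N: "N \<ge> 2" for N
  proof -
    define a b where "a = ln (real N)" "b = ln (real (Suc N))"
    have a0: "a > 0" unfolding a_b_def using N by (intro ln_gt_zero) auto
    have ab: "a \<le> b" unfolding a_b_def using N by (subst ln_le_cancel_iff) auto
    have b1: "b - a \<le> 1"
    proof -
      have "1 + 1 / real N = real (Suc N) / real N" using N by (simp add: field_simps)
      moreover have "ln (real (Suc N) / real N) = b - a" unfolding a_b_def using N by (subst ln_div) auto
      ultimately have "b - a = ln (1 + 1 / real N)" by (simp only:)
      also have "\<dots> \<le> 1 / real N" by (rule ln_add_one_self_le_self) simp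
      also have "\<dots> \<le> 1" using N by simp
      finally show ?thesis .
    qed
    have "\<delta> N - \<delta> (Suc N) = 1 / a - 1 / b" by (simp add: \<delta>_def a_b_def)
    also have "\<dots> = (b - a) / (a * b)" using a0 ab by (simp add: field_simps)
    finally have d: "\<delta> N - \<delta> (Suc N) = (b - a) / (a * b)" .
    have d0: "\<delta> N - \<delta> (Suc N) \<ge> 0" unfolding d using a0 ab by simp
    have "\<bar>plog N * (\<delta> N - \<delta> (Suc N)) - a * (\<delta> N - \<delta> (Suc N))\<bar> = \<bar>plog N - a\<bar> * (\<delta> N - \<delta> (Suc N))"
      using d0 by (simp add: abs_mult left_diff_distrib[symmetric])
    also have "\<dots> \<le> C * (\<delta> N - \<delta> (Suc N))" using C(2)[of N] N d0 unfolding a_b_def by (intro mult_right_mono) auto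
    finally have 1: "\<bar>(R (Suc N) - R N) - a * (\<delta> N - \<delta> (Suc N))\<bar> \<le> C * (\<delta> N - \<delta> (Suc N))"
      unfolding R_Suc[OF N] .
    have "a * (\<delta> N - \<delta> (Suc N)) = (b - a) / b" unfolding d using a0 by simp
    moreover have "(b - a) / b \<le> ln b - ln a"
    proof -
      have "ln (1 + (a / b - 1)) \<le> a / b - 1"
        using a0 ab by (intro ln_add_one_self_le_self2) (auto simp: field_simps)
      thus ?thesis using a0 ab by (simp add: ln_div diff_divide_distrib)
    qed
    moreover have "ln b - ln a \<le> (b - a) / b + (b - a) / (a * b)"
    proof -
      have "ln (1 + (b - a) / a) \<le> (b - a) / a" using a0 ab by (intro ln_add_one_self_le_self) auto
      also have "1 + (b - a) / a = b / a" using a0 by (simp add: field_simps)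
      also have "(b - a) / a = (b - a) / b + (b - a) * ((b - a) / (a * b))" using a0 ab by (simp add: field_simps)
      also have "\<dots> \<le> (b - a) / b + 1 * ((b - a) / (a * b))"
        using a0 ab b1 by (intro add_left_mono mult_right_mono) auto
      finally show ?thesis using a0 ab by (simp add: ln_div)
    qed
    ultimately have "\<bar>a * (\<delta> N - \<delta> (Suc N)) - (ln b - ln a)\<bar> \<le> \<delta> N - \<delta> (Suc N)" unfolding d by linarith
    thus ?thesis using 1 unfolding a_b_def[symmetric] by (simp add: algebra_simps)
  qed
  have tel: "\<bar>(R N - R 2) - (ln (ln (real N)) - ln (ln 2))\<bar> \<le> (C + 1) * (\<delta> 2 - \<delta> N)" if "N \<ge> 2" for N
    using that
  proof (induction N rule: dec_induct)
    case (step N)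
    have "(C + 1) * (\<delta> 2 - \<delta> (Suc N)) = (C + 1) * (\<delta> 2 - \<delta> N) + (C + 1) * (\<delta> N - \<delta> (Suc N))"
      by (simp add: algebra_simps)
    thus ?case using step key[of N] by linarith
  qed simp
  have ln2: "ln (2::real) > 0" by simp
  show thesis
  proof (rule that[of "\<bar>R 2 - ln (ln 2)\<bar> + (C + 1) * \<delta> 2 + 1 + C * \<delta> 2 + 1"])
    show "1 \<le> \<bar>R 2 - ln (ln 2)\<bar> + (C + 1) * \<delta> 2 + 1 + C * \<delta> 2 + 1"
      using C ln2 by (simp add: \<delta>_def)
    fix N :: nat assume N: "N \<ge> 2"
    have lnN: "ln (real N) \<ge> ln 2" using N by (subst ln_le_cancel_iff) auto
    have lnN0: "ln (real N) > 0" using lnN ln2 by linarith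
    have \<delta>N: "0 \<le> \<delta> N" "\<delta> N \<le> \<delta> 2"
      using lnN lnN0 by (auto simp: \<delta>_def intro!: divide_left_mono mult_pos_pos)
    have "\<bar>plog N / ln (real N) - 1\<bar> \<le> C * \<delta> N"
    proof -
      have "plog N / ln (real N) - 1 = (plog N - ln (real N)) * \<delta> N" using lnN0 by (simp add: \<delta>_def field_simps)
      thus ?thesis using C(2)[of N] N \<delta>N by (simp add: abs_mult mult_right_mono)
    qed
    also have "C * \<delta> N \<le> C * \<delta> 2" using \<delta>N C by (intro mult_left_mono) auto
    finally have 1: "\<bar>plog N / ln (real N) - 1\<bar> \<le> C * \<delta> 2" .
    have "(C + 1) * (\<delta> 2 - \<delta> N) \<le> (C + 1) * \<delta> 2" using C \<delta>N by (intro mult_left_mono) auto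
    moreover have "precip N = R N + plog N / ln (real N)" by (simp add: R_def)
    ultimately show "\<bar>precip N - ln (ln (real N))\<bar> \<le> \<bar>R 2 - ln (ln 2)\<bar> + (C + 1) * \<delta> 2 + 1 + C * \<delta> 2 + 1"
      using tel[OF N] 1 by linarith
  qed
qed

subsection \<open>Counting products of two primes\<close>

text \<open>The order p <= q makes (p, q) -> p q injective, so that integers can be counted as
  pairs. The symmetric variant \<open>ordered_pairs\<close> is the one in which sums over one
  coordinate become sums weighted by \<open>prime_count (x / p)\<close>.\<close>

definition prime_pairs :: "real \<Rightarrow> (nat \<times> nat) set" where
  "prime_pairs x = {(p, q). prime p \<and> prime q \<and> p \<le> q \<and> real (p * q) \<le> x}"

definition ordered_pairs :: "real \<Rightarrow> (nat \<times> nat) set" where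
  "ordered_pairs x = {(p, q). prime p \<and> prime q \<and> real (p * q) \<le> x}"

lemma ordered_pairs_eq_Sigma:
  "ordered_pairs x = Sigma {p. prime p \<and> real p \<le> x} (\<lambda>p. {q. prime q \<and> real q \<le> x / real p})"
proof -
  have "real p \<le> x" if "prime p" "prime q" "real (p * q) \<le> x" for p q
  proof -
    have "p * 1 \<le> p * q" using prime_gt_0_nat[OF that(2)] by (intro mult_le_mono) auto
    hence "real p \<le> real (p * q)" by (simp only: of_nat_le_iff mult_1_right)
    thus ?thesis using that(3) by linarith
  qed
  moreover have "real (p * q) \<le> x \<longleftrightarrow> real q \<le> x / real p" if "prime p" for p q
    using prime_gt_0_nat[OF that] by (simp add: pos_le_divide_eq mult.commute)
  ultimately show ?thesis unfolding ordered_pairs_def by blast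
qed

lemma finite_ordered_pairs: "finite (ordered_pairs x)"
  unfolding ordered_pairs_eq_Sigma by (intro finite_SigmaI finite_primes_le)

lemma prime_pairs_subset: "prime_pairs x \<subseteq> ordered_pairs x"
  by (auto simp: prime_pairs_def ordered_pairs_def)

lemma finite_prime_pairs: "finite (prime_pairs x)"
  using prime_pairs_subset finite_ordered_pairs finite_subset by blast

lemma inj_prime_pairs: "inj_on (\<lambda>(p, q). p * q) (prime_pairs x)"
proof (rule inj_onI, clarify)
  fix p q p' q'
  assume "(p, q) \<in> prime_pairs x" "(p', q') \<in> prime_pairs x" and eq: "p * q = p' * q'"
  hence pr: "prime p" "prime q" "prime p'" "prime q'" and le: "p \<le> q" "p' \<le> q'"
    by (auto simp: prime_pairs_def)
  have pos: "p > 0" "q > 0" "p' > 0" using pr prime_gt_0_nat by auto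
  have "p dvd p' * q'" using eq by (metis dvd_triv_left)
  hence "p = p' \<or> p = q'" using pr by (metis prime_dvd_mult_iff primes_dvd_imp_eq)
  thus "p = p' \<and> q = q'"
  proof
    assume "p = p'"
    thus ?thesis using eq pos by simp
  next
    assume "p = q'"
    moreover from this have "q = p'" using eq pos by (simp add: mult.commute)
    ultimately show ?thesis using le by simp
  qed
qed

lemma semiprime_count_eq:
  assumes "\<And>p q. R p q \<Longrightarrow> R q p"
  shows "semiprime_count x R = card {(p, q) \<in> prime_pairs x. R p q}"
proof -
  have "{n. \<exists>p q. prime p \<and> prime q \<and> n = p * q \<and> real n \<le> x \<and> R p q} =
      (\<lambda>(p, q). p * q) ` {(p, q) \<in> prime_pairs x. R p q}"
  proof (intro Set.set_eqI iffI)
    fix n assume "n \<in> {n. \<exists>p q. prime p \<and> prime q \<and> n = p * q \<and> real n \<le> x \<and> R p q}"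
    then obtain p q where pq: "prime p" "prime q" "n = p * q" "real n \<le> x" "R p q" by blast
    show "n \<in> (\<lambda>(p, q). p * q) ` {(p, q) \<in> prime_pairs x. R p q}"
    proof (cases "p \<le> q")
      case True
      thus ?thesis using pq by (intro image_eqI[of _ _ "(p, q)"]) (auto simp: prime_pairs_def)
    next
      case False
      thus ?thesis using pq assms[OF pq(5)]
        by (intro image_eqI[of _ _ "(q, p)"]) (auto simp: prime_pairs_def mult.commute)
    qed
  qed (auto simp: prime_pairs_def)
  moreover have "inj_on (\<lambda>(p, q). p * q) {(p, q) \<in> prime_pairs x. R p q}"
    by (rule inj_on_subset[OF inj_prime_pairs[of x]]) auto
  ultimately show ?thesis unfolding semiprime_count_def by (simp add: card_image)
qed

lemma sum_ordered_pairs: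
  "(\<Sum>(p, q)\<in>ordered_pairs x. f p) = (\<Sum>p | prime p \<and> real p \<le> x. f p * prime_count (x / real p))"
  for f :: "nat \<Rightarrow> real"
proof -
  have "(\<Sum>(p, q)\<in>ordered_pairs x. f p) =
      (\<Sum>p | prime p \<and> real p \<le> x. \<Sum>q | prime q \<and> real q \<le> x / real p. f p)"
    unfolding ordered_pairs_eq_Sigma by (intro sum.Sigma[symmetric]) (auto simp: finite_primes_le)
  thus ?thesis by (simp add: prime_count_def mult.commute)
qed

text \<open>The ordered pairs are the union of the pairs with p <= q and their mirror images, which
  overlap exactly in the diagonal; this accounts for the sum over squares.\<close>

lemma sum_prime_pairs:
  fixes f :: "nat \<Rightarrow> real"
  shows "(\<Sum>(p, q)\<in>prime_pairs x. f p + f q) =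
    (\<Sum>(p, q)\<in>ordered_pairs x. f p) + (\<Sum>p | prime p \<and> real (p * p) \<le> x. f p)"
proof -
  let ?S = "prod.swap ` prime_pairs x"
  have un: "ordered_pairs x = prime_pairs x \<union> ?S"
    by (force simp: ordered_pairs_def prime_pairs_def image_iff mult.commute)
  have "(\<Sum>z\<in>prime_pairs x. f (fst z)) + (\<Sum>z\<in>?S. f (fst z)) =
      (\<Sum>z\<in>ordered_pairs x. f (fst z)) + (\<Sum>z\<in>prime_pairs x \<inter> ?S. f (fst z))"
    unfolding un by (intro sum.union_inter[symmetric] finite_imageI finite_prime_pairs)
  moreover have "prime_pairs x \<inter> ?S = (\<lambda>p. (p, p)) ` {p. prime p \<and> real (p * p) \<le> x}"
    by (auto simp: prime_pairs_def image_iff)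
  hence "(\<Sum>z\<in>prime_pairs x \<inter> ?S. f (fst z)) = (\<Sum>p | prime p \<and> real (p * p) \<le> x. f p)"
    by (simp add: sum.reindex inj_on_def)
  moreover have "(\<Sum>z\<in>?S. f (fst z)) = (\<Sum>z\<in>prime_pairs x. f (snd z))"
    by (subst sum.reindex) (auto simp: inj_on_def)
  ultimately show ?thesis by (simp add: sum.distrib case_prod_unfold)
qed

lemma card_squares_le: "x \<ge> 0 \<Longrightarrow> real (card {p. prime p \<and> real (p * p) \<le> x}) \<le> sqrt x"
proof -
  assume x: "x \<ge> 0"
  have "{p. prime p \<and> real (p * p) \<le> x} \<subseteq> {0<..nat \<lfloor>sqrt x\<rfloor>}"
  proof
    fix p assume p: "p \<in> {p. prime p \<and> real (p * p) \<le> x}"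
    hence "(real p)\<^sup>2 \<le> x" by (simp add: power2_eq_square)
    hence "real p \<le> sqrt x" by (rule real_le_rsqrt)
    thus "p \<in> {0<..nat \<lfloor>sqrt x\<rfloor>}" using p by (auto simp: le_nat_floor prime_gt_0_nat)
  qed
  hence "card {p. prime p \<and> real (p * p) \<le> x} \<le> nat \<lfloor>sqrt x\<rfloor>"
    using card_mono[of "{0<..nat \<lfloor>sqrt x\<rfloor>}"] by simp
  thus ?thesis using x by (meson of_nat_floor of_nat_le_iff order_trans real_sqrt_ge_zero)
qed

text \<open>Expands \<open>(1 + \<eta> a) (1 + \<eta> b)\<close>; the subtracted terms account for the primes dividing the conductor.\<close>

lemma indicator_expansion:
  fixes a b \<eta> :: int
  assumes "a \<in> {-1, 0, 1}" "b \<in> {-1, 0, 1}" "\<eta> \<in> {-1, 1}"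
  shows "(if a \<noteq> 0 \<and> b \<noteq> 0 then 1 else 0) + \<eta> * (a + b) + a * b - ((if a = 0 then 1 else 0) + (if b = 0 then 1 else 0))
    \<le> 4 * (if a = \<eta> \<and> b = \<eta> then 1 else 0 :: int)"
  using assms by auto

text \<open>The pointwise inequality \<open>indicator_expansion\<close> is summed over all pairs.
  The diagonal of the linear term costs at most sqrt x; the subtracted terms count, with
  multiplicity, pairs containing a prime divisor of d.\<close>

lemma char_count_lower:
  assumes d: "d > 0" and x: "x \<ge> 0" and \<eta>: "\<eta> \<in> {-1, 1 :: int}"
  defines "f \<equiv> (\<lambda>p. real_of_int (jac d (int p)))"
  defines "Num \<equiv> card {(p, q) \<in> prime_pairs x. jac d (int p) = \<eta> \<and> jac d (int q) = \<eta>}"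
  defines "N0 \<equiv> card {(p, q) \<in> prime_pairs x. coprime (p * q) d}"
  shows "4 * real Num \<ge> real N0 + of_int \<eta> * (\<Sum>p | prime p \<and> real p \<le> x. f p * prime_count (x / real p)) +
    (\<Sum>(p, q)\<in>prime_pairs x. f p * f q) - sqrt x - 2 * (\<Sum>r\<in>prime_factors d. prime_count (x / real r))"
    and "Num \<le> N0"
proof -
  have f0: "jac d (int p) = 0 \<longleftrightarrow> \<not> coprime p d" for p
    using jac_eq_0_iff[OF d, of "int p"] by (simp add: coprime_int_iff)
  have fle: "\<bar>f p\<bar> \<le> 1" for p using jac_values[of d "int p"] by (auto simp: f_def)
  let ?z = "\<lambda>p. if jac d (int p) = 0 then 1 else 0 :: real"
  have pt: "(if coprime (p * q) d then 1 else 0) + of_int \<eta> * (f p + f q) + f p * f q - (?z p + ?z q)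
      \<le> 4 * (if jac d (int p) = \<eta> \<and> jac d (int q) = \<eta> then 1 else 0)" for p q
  proof -
    have "real_of_int ((if jac d (int p) \<noteq> 0 \<and> jac d (int q) \<noteq> 0 then 1 else 0) + \<eta> * (jac d (int p) + jac d (int q)) +
        jac d (int p) * jac d (int q) - ((if jac d (int p) = 0 then 1 else 0) + (if jac d (int q) = 0 then 1 else 0)))
      \<le> real_of_int (4 * (if jac d (int p) = \<eta> \<and> jac d (int q) = \<eta> then 1 else 0))"
      unfolding of_int_le_iff by (rule indicator_expansion[OF jac_values jac_values \<eta>])
    moreover have "coprime (p * q) d \<longleftrightarrow> jac d (int p) \<noteq> 0 \<and> jac d (int q) \<noteq> 0" using f0 by simp
    ultimately show ?thesis unfolding f_def by (simp only: of_int_add of_int_diff of_int_mult of_int_1 of_int_0 of_int_numeral if_distrib[of real_of_int] cong: if_cong)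
  qed
  have cnt: "(\<Sum>(p, q)\<in>prime_pairs x. if R p q then 1 else 0) = real (card {(p, q) \<in> prime_pairs x. R p q})" for R
  proof -
    have "{(p, q) \<in> prime_pairs x. R p q} = {z \<in> prime_pairs x. case z of (p, q) \<Rightarrow> R p q}" by auto
    moreover have "(\<Sum>(p, q)\<in>prime_pairs x. if R p q then 1 else 0) =
        (\<Sum>z\<in>prime_pairs x. if (case z of (p, q) \<Rightarrow> R p q) then 1 else 0 :: real)"
      by (intro sum.cong) auto
    ultimately show ?thesis using finite_prime_pairs by (simp add: sum.If_cases Int_def)
  qed
  have "(\<Sum>(p, q)\<in>prime_pairs x. (if coprime (p * q) d then 1 else 0) + of_int \<eta> * (f p + f q) + f p * f q - (?z p + ?z q))
    \<le> (\<Sum>(p, q)\<in>prime_pairs x. 4 * (if jac d (int p) = \<eta> \<and> jac d (int q) = \<eta> then 1 else 0))"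
    using pt by (intro sum_mono) auto
  also have "\<dots> = 4 * real Num"
    unfolding Num_def cnt[symmetric] by (simp add: sum_distrib_left case_prod_unfold)
  also have "(\<Sum>(p, q)\<in>prime_pairs x. (if coprime (p * q) d then 1 else 0) + of_int \<eta> * (f p + f q) + f p * f q - (?z p + ?z q))
    = real N0 + of_int \<eta> * (\<Sum>(p, q)\<in>prime_pairs x. f p + f q) + (\<Sum>(p, q)\<in>prime_pairs x. f p * f q) -
      (\<Sum>(p, q)\<in>prime_pairs x. ?z p + ?z q)"
    unfolding N0_def cnt[symmetric]
    by (simp add: sum.distrib sum_subtractf case_prod_unfold distrib_left flip: sum_distrib_left)
  also have "(\<Sum>(p, q)\<in>prime_pairs x. f p + f q) =
      (\<Sum>p | prime p \<and> real p \<le> x. f p * prime_count (x / real p)) + (\<Sum>p | prime p \<and> real (p * p) \<le> x. f p)"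
    unfolding sum_prime_pairs sum_ordered_pairs ..
  finally have 1: "real N0 + of_int \<eta> * ((\<Sum>p | prime p \<and> real p \<le> x. f p * prime_count (x / real p)) +
      (\<Sum>p | prime p \<and> real (p * p) \<le> x. f p)) + (\<Sum>(p, q)\<in>prime_pairs x. f p * f q) -
      (\<Sum>(p, q)\<in>prime_pairs x. ?z p + ?z q) \<le> 4 * real Num" .
  have 2: "\<bar>of_int \<eta> * (\<Sum>p | prime p \<and> real (p * p) \<le> x. f p)\<bar> \<le> sqrt x"
  proof -
    have "\<bar>of_int \<eta> * (\<Sum>p | prime p \<and> real (p * p) \<le> x. f p)\<bar> = \<bar>\<Sum>p | prime p \<and> real (p * p) \<le> x. f p\<bar>"
      using \<eta> by (auto simp: abs_mult)
    also have "\<dots> \<le> (\<Sum>p | prime p \<and> real (p * p) \<le> x. 1)"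
      by (rule order_trans[OF sum_abs sum_mono]) (rule fle)
    also have "\<dots> \<le> sqrt x" using card_squares_le[OF x] by simp
    finally show ?thesis .
  qed
  have 3: "(\<Sum>(p, q)\<in>prime_pairs x. ?z p + ?z q) \<le> 2 * (\<Sum>r\<in>prime_factors d. prime_count (x / real r))"
  proof -
    have pc0: "prime_count y \<ge> 0" for y by (simp add: prime_count_def)
    have "(\<Sum>p | prime p \<and> real p \<le> x. ?z p * prime_count (x / real p))
       \<le> (\<Sum>r\<in>prime_factors d. prime_count (x / real r))"
    proof -
      have "(\<Sum>p | prime p \<and> real p \<le> x. ?z p * prime_count (x / real p)) =
          (\<Sum>p | prime p \<and> real p \<le> x \<and> p dvd d. prime_count (x / real p))"
      proof (rule sum.mono_neutral_cong_right)
        show "\<forall>p\<in>{p. prime p \<and> real p \<le> x} - {p. prime p \<and> real p \<le> x \<and> p dvd d}. ?z p * prime_count (x / real p) = 0"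
          using f0 prime_imp_coprime by auto
        show "?z p * prime_count (x / real p) = prime_count (x / real p)"
          if "p \<in> {p. prime p \<and> real p \<le> x \<and> p dvd d}" for p
          using that f0[of p] not_prime_unit by (auto dest: coprime_common_divisor[of p d p])
      qed (auto simp: finite_primes_le)
      also have "\<dots> \<le> (\<Sum>r\<in>prime_factors d. prime_count (x / real r))"
        using d pc0 by (intro sum_mono2) (auto simp: in_prime_factors_iff)
      finally show ?thesis .
    qed
    moreover have "(\<Sum>(p, q)\<in>ordered_pairs x. ?z p) = (\<Sum>p | prime p \<and> real p \<le> x. ?z p * prime_count (x / real p))"
      by (rule sum_ordered_pairs)
    moreover have "(\<Sum>(p, q)\<in>prime_pairs x. ?z p + ?z q) \<le> 2 * (\<Sum>(p, q)\<in>ordered_pairs x. ?z p)"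
    proof -
      have "(\<Sum>p | prime p \<and> real (p * p) \<le> x. ?z p) = (\<Sum>z\<in>(\<lambda>p. (p, p)) ` {p. prime p \<and> real (p * p) \<le> x}. ?z (fst z))"
        by (simp add: sum.reindex inj_on_def)
      also have "\<dots> \<le> (\<Sum>z\<in>ordered_pairs x. ?z (fst z))"
        by (intro sum_mono2 finite_ordered_pairs) (auto simp: ordered_pairs_def)
      finally show ?thesis unfolding sum_prime_pairs by (simp add: case_prod_unfold)
    qed
    ultimately show ?thesis by linarith
  qed
  show "4 * real Num \<ge> real N0 + of_int \<eta> * (\<Sum>p | prime p \<and> real p \<le> x. f p * prime_count (x / real p)) +
    (\<Sum>(p, q)\<in>prime_pairs x. f p * f q) - sqrt x - 2 * (\<Sum>r\<in>prime_factors d. prime_count (x / real r))"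
    using 1 2 3 unfolding distrib_left by linarith
  show "Num \<le> N0" unfolding Num_def N0_def
  proof (intro card_mono)
    show "finite {(p, q) \<in> prime_pairs x. coprime (p * q) d}"
      by (rule finite_subset[OF _ finite_prime_pairs[of x]]) auto
    show "{(p, q) \<in> prime_pairs x. jac d (int p) = \<eta> \<and> jac d (int q) = \<eta>} \<subseteq> {(p, q) \<in> prime_pairs x. coprime (p * q) d}"
    proof -
      have "coprime p d" if "jac d (int p) = \<eta>" for p using f0[of p] \<eta> that by auto
      thus ?thesis by auto
    qed
  qed
qed

lemma card_prime_pairs_le:
  "real (card (prime_pairs x)) \<le> (\<Sum>p | prime p \<and> real (p * p) \<le> x. prime_count (x / real p))"
proof -
  have sub: "prime_pairs x \<subseteq> Sigma {p. prime p \<and> real (p * p) \<le> x} (\<lambda>p. {q. prime q \<and> real q \<le> x / real p})"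
  proof (clarsimp simp: prime_pairs_def)
    fix p q :: nat assume pq: "prime p" "prime q" "p \<le> q" "real p * real q \<le> x"
    have "real p * real p \<le> real p * real q" using pq by (intro mult_left_mono) auto
    hence "real p * real p \<le> x" using pq by linarith
    thus "real p * real p \<le> x \<and> real q \<le> x / real p"
      using pq prime_gt_0_nat[of p] by (simp add: pos_le_divide_eq mult.commute)
  qed
  have fin: "finite {p. prime p \<and> real (p * p) \<le> x}"
  proof (rule finite_subset[OF _ finite_primes_le[of x]], clarsimp)
    fix p assume p: "prime p" "real p * real p \<le> x"
    have "real p * 1 \<le> real p * real p" using prime_gt_0_nat[OF p(1)] by (intro mult_left_mono) auto
    thus "real p \<le> x" using p by linarith
  qed
  have "card (prime_pairs x) \<le> card (Sigma {p. prime p \<and> real (p * p) \<le> x} (\<lambda>p. {q. prime q \<and> real q \<le> x / real p}))"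
    using fin by (intro card_mono sub finite_SigmaI finite_primes_le) auto
  also have "\<dots> = (\<Sum>p | prime p \<and> real (p * p) \<le> x. card {q. prime q \<and> real q \<le> x / real p})"
    using fin finite_primes_le by (intro card_SigmaI) auto
  finally have "real (card (prime_pairs x)) \<le>
      real (\<Sum>p | prime p \<and> real (p * p) \<le> x. card {q. prime q \<and> real q \<le> x / real p})"
    by (simp only: of_nat_le_iff)
  thus ?thesis unfolding prime_count_def of_nat_sum .
qed

text \<open>For t <= sqrt x the logarithm of z = x/t lies between (log x)/2 and log x, so one error
  term serves all t. The correction 2 log t/(log x)^2 is retained because, summed over t = p against
  1/p, it meets the bound for the sum of (log p)/p and contributes only O(1/log x).\<close>

lemma prime_count_bounds:
  obtains C where "C \<ge> 1" "\<forall>\<^sub>F x in at_top. \<forall>t. 1 \<le> t \<and> t \<le> sqrt x \<longrightarrow>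
     prime_count (x / t) \<le> x / t * (1 / ln x + 2 * ln t / (ln x)\<^sup>2) * (1 + C / ln (ln x)) \<and>
     prime_count (x / t) \<ge> x / t / ln x * (1 - C / ln (ln x)) \<and>
     prime_count (x / t) \<le> 4 * (x / t) / ln x"
proof (rule prime_count_upper, rule prime_count_lower)
  fix C1 C2 :: real
  assume C1: "C1 \<ge> 1" "\<forall>\<^sub>F z in at_top. prime_count z \<le> z / ln z + C1 * z / (ln z * ln (ln z))"
    and C2: "C2 \<ge> 1" "\<forall>\<^sub>F z in at_top. prime_count z \<ge> z / ln z - C2 * z / (ln z * ln (ln z))"
  define C where "C = 2 * C1 + 2 * C2"
  obtain z0 where z0: "\<And>z. z \<ge> z0 \<Longrightarrow> prime_count z \<le> z / ln z + C1 * z / (ln z * ln (ln z)) \<and>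
      prime_count z \<ge> z / ln z - C2 * z / (ln z * ln (ln z))"
    using eventually_conj[OF C1(2) C2(2)] unfolding eventually_at_top_linorder by blast
  have "\<forall>\<^sub>F x::real in at_top. sqrt x \<ge> z0" by real_asymp
  moreover have "\<forall>\<^sub>F x::real in at_top. ln (ln x) \<ge> C" by real_asymp
  moreover have "\<forall>\<^sub>F x::real in at_top. ln x \<ge> 4" by real_asymp
  moreover have "\<forall>\<^sub>F x::real in at_top. x > 1" by (rule eventually_gt_at_top)
  ultimately have "\<forall>\<^sub>F x in at_top. \<forall>t. 1 \<le> t \<and> t \<le> sqrt x \<longrightarrow>
     prime_count (x / t) \<le> x / t * (1 / ln x + 2 * ln t / (ln x)\<^sup>2) * (1 + C / ln (ln x)) \<and>
     prime_count (x / t) \<ge> x / t / ln x * (1 - C / ln (ln x)) \<and>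
     prime_count (x / t) \<le> 4 * (x / t) / ln x"
  proof eventually_elim
    case (elim x)
    show ?case
    proof (intro allI impI)
      fix t assume t: "1 \<le> t \<and> t \<le> sqrt x"
      define z L l where "z = x / t" "L = ln x" "l = ln (ln x)"
      have L: "L \<ge> 4" "l \<ge> C" "C \<ge> 4" using elim C1 C2 by (auto simp: z_L_l_def C_def)
      have l0: "l > 0" using L by linarith
      have zsq: "z \<ge> sqrt x"
      proof -
        have "sqrt x * t \<le> sqrt x * sqrt x" using t elim by (intro mult_left_mono) auto
        thus ?thesis using t elim by (simp add: z_L_l_def pos_le_divide_eq)
      qed
      have z_pos: "z > 0" using t elim by (simp add: z_L_l_def)
      have lnz: "ln z = L - ln t" using t elim by (simp add: z_L_l_def ln_div)
      have lt: "0 \<le> ln t" "ln t \<le> L / 2"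
      proof -
        show "0 \<le> ln t" using t by simp
        have "ln t \<le> ln (sqrt x)" using t elim by (subst ln_le_cancel_iff) auto
        thus "ln t \<le> L / 2" using elim by (simp add: ln_sqrt z_L_l_def)
      qed
      have lnz2: "L / 2 \<le> ln z" "ln z \<le> L" "ln z > 0" using lnz lt L by auto
      have llz: "l / 2 \<le> ln (ln z)"
      proof -
        have "ln (sqrt L) \<le> ln (ln z)"
        proof (subst ln_le_cancel_iff)
          have "sqrt L * 2 \<le> sqrt L * sqrt L" using L real_le_rsqrt[of 2 L] by (intro mult_left_mono) auto
          thus "sqrt L \<le> ln z" using lnz2 L by simp
        qed (use L lnz2 in auto)
        thus ?thesis using L by (simp add: ln_sqrt z_L_l_def)
      qed
      have ratio: "c * z / (ln z * ln (ln z)) \<le> z / ln z * (2 * c / l)" if "c \<ge> 0" for c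
      proof -
        have "c / ln (ln z) \<le> c / (l / 2)" using llz l0 that by (intro divide_left_mono mult_pos_pos) auto
        also have "c / (l / 2) = 2 * c / l" by simp
        finally have "c / ln (ln z) \<le> 2 * c / l" .
        hence "z / ln z * (c / ln (ln z)) \<le> z / ln z * (2 * c / l)"
          using z_pos lnz2 by (intro mult_left_mono) auto
        thus ?thesis by (simp add: mult.commute)
      qed
      note z0' = z0[of z]
      have pc: "prime_count z \<le> z / ln z + C1 * z / (ln z * ln (ln z))"
          "prime_count z \<ge> z / ln z - C2 * z / (ln z * ln (ln z))"
        using z0[of z] zsq elim by auto
      have CC: "2 * C1 / l \<le> C / l" "2 * C2 / l \<le> C / l" using C1 C2 l0 by (auto simp: C_def intro!: divide_right_mono)
      have zl0: "z / ln z \<ge> 0" using z_pos lnz2 by simp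
      have "prime_count z \<le> z / ln z * (1 + C / l)"
        using pc(1) ratio[of C1] mult_left_mono[OF CC(1) zl0] C1 by (simp add: algebra_simps)
      moreover have "1 / ln z \<le> 1 / L + 2 * ln t / L\<^sup>2"
      proof -
        have "1 / ln z - 1 / L = ln t / (L * ln z)" using lnz lnz2 L by (simp add: field_simps)
        also have "\<dots> \<le> ln t / (L * (L / 2))" using lt lnz2 L by (intro divide_left_mono mult_left_mono) auto
        also have "ln t / (L * (L / 2)) = 2 * ln t / L\<^sup>2" by (simp add: power2_eq_square)
        finally show ?thesis by linarith
      qed
      hence "z * (1 / ln z) * (1 + C / l) \<le> z * (1 / L + 2 * ln t / L\<^sup>2) * (1 + C / l)"
        using z_pos l0 L by (intro mult_right_mono mult_left_mono) auto
      ultimately have 1: "prime_count z \<le> z * (1 / L + 2 * ln t / L\<^sup>2) * (1 + C / l)" by simp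
      have "prime_count z \<ge> z / ln z * (1 - C / l)"
        using pc(2) ratio[of C2] mult_left_mono[OF CC(2) zl0] C2 by (simp add: algebra_simps)
      moreover have "z / L * (1 - C / l) \<le> z / ln z * (1 - C / l)"
        using z_pos lnz2 L l0 by (intro mult_right_mono divide_left_mono mult_pos_pos) auto
      ultimately have 2: "prime_count z \<ge> z / L * (1 - C / l)" by linarith
      have "2 * ln t / L\<^sup>2 \<le> 1 / L" using lt L by (simp add: power2_eq_square divide_simps)
      hence "z * (1 / L + 2 * ln t / L\<^sup>2) * (1 + C / l) \<le> z * (1 / L + 1 / L) * (1 + 1)"
        using z_pos L l0 lt by (intro mult_mono) auto
      hence 3: "prime_count z \<le> 4 * z / L" using 1 by simp
      show "prime_count (x / t) \<le> x / t * (1 / ln x + 2 * ln t / (ln x)\<^sup>2) * (1 + C / ln (ln x)) \<and>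
        prime_count (x / t) \<ge> x / t / ln x * (1 - C / ln (ln x)) \<and> prime_count (x / t) \<le> 4 * (x / t) / ln x"
        using 1 2 3 unfolding z_L_l_def by blast
    qed
  qed
  moreover have "C \<ge> 1" using C1 C2 by (simp add: C_def)
  ultimately show thesis by (intro that[of C])
qed

text \<open>The smaller prime runs up to sqrt x, and Mertens gives log log x for its reciprocals.
  The relative error C/log log x of the prime count is multiplied by this log log x and so remains a
  constant: here a loss by a constant factor would hide the bias.\<close>

lemma semiprimes_upper:
  obtains K where "K \<ge> 0" "\<forall>\<^sub>F x in at_top. real (card (prime_pairs x)) \<le> x / ln x * (ln (ln x) + K)"
proof (rule prime_count_bounds, rule precip_mertens, rule plog_mertens)
  fix C C1 C2 :: real
  assume C: "C \<ge> 1" "\<forall>\<^sub>F x in at_top. \<forall>t. 1 \<le> t \<and> t \<le> sqrt x \<longrightarrow>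
     prime_count (x / t) \<le> x / t * (1 / ln x + 2 * ln t / (ln x)\<^sup>2) * (1 + C / ln (ln x)) \<and>
     prime_count (x / t) \<ge> x / t / ln x * (1 - C / ln (ln x)) \<and>
     prime_count (x / t) \<le> 4 * (x / t) / ln x"
    and C1: "C1 \<ge> 1" "\<And>N. N \<ge> 2 \<Longrightarrow> \<bar>precip N - ln (ln (real N))\<bar> \<le> C1"
    and C2: "C2 \<ge> 1" "\<And>N. N \<ge> 1 \<Longrightarrow> \<bar>plog N - ln (real N)\<bar> \<le> C2"
  define B where "B = C1 + 2 + 2 * C2"
  define K where "K = C + B * (1 + C)"
  have "\<forall>\<^sub>F x::real in at_top. ln x \<ge> 4" by real_asymp
  moreover have "\<forall>\<^sub>F x::real in at_top. ln (ln x) \<ge> 1" by real_asymp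
  moreover have "\<forall>\<^sub>F x::real in at_top. x \<ge> 4" by (rule eventually_ge_at_top)
  ultimately have "\<forall>\<^sub>F x in at_top. real (card (prime_pairs x)) \<le> x / ln x * (ln (ln x) + K)"
    using C(2)
  proof eventually_elim
    case (elim x)
    define L l N where "L = ln x" "l = ln (ln x)" "N = nat \<lfloor>sqrt x\<rfloor>"
    have L: "L \<ge> 4" "l \<ge> 1" using elim by (auto simp: L_l_N_def)
    have "2 \<le> sqrt x" using elim by (intro real_le_rsqrt) simp
    hence N2: "N \<ge> 2" by (simp add: L_l_N_def le_nat_floor)
    have Nx: "real N \<le> sqrt x" using elim by (simp add: L_l_N_def)
    have iff: "real (p * p) \<le> x \<longleftrightarrow> p \<le> N" for p
    proof -
      have "real (p * p) \<le> x \<longleftrightarrow> real p \<le> sqrt x"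
        by (metis abs_of_nat of_nat_mult power2_eq_square real_sqrt_abs real_sqrt_le_iff)
      also have "\<dots> \<longleftrightarrow> p \<le> N" using elim by (simp add: L_l_N_def le_nat_iff le_floor_iff)
      finally show ?thesis .
    qed
    have pt: "1 \<le> real p \<and> real p \<le> sqrt x" if "p \<in> {p. prime p \<and> p \<le> N}" for p
      using that prime_gt_0_nat[of p] Nx by auto
    have lnN: "ln (real N) \<le> L"
    proof -
      have "ln (real N) \<le> ln (sqrt x)" using Nx N2 elim by (subst ln_le_cancel_iff) auto
      also have "ln (sqrt x) = L / 2" using elim by (simp add: ln_sqrt L_l_N_def(1))
      finally show ?thesis using L by linarith
    qed
    have lnN0: "ln (real N) > 0" using N2 by (intro ln_gt_zero) auto
    have llN: "ln (ln (real N)) \<le> l" unfolding L_l_N_def(2) using lnN lnN0 L unfolding L_l_N_def(1)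
      by (subst ln_le_cancel_iff) auto
    have "real (card (prime_pairs x)) \<le> (\<Sum>p | prime p \<and> p \<le> N. prime_count (x / real p))"
      using card_prime_pairs_le[of x] unfolding iff .
    also have "\<dots> \<le> (\<Sum>p | prime p \<and> p \<le> N. x / real p * (1 / L + 2 * ln (real p) / L\<^sup>2) * (1 + C / l))"
      using elim pt unfolding L_l_N_def(1,2) by (intro sum_mono) blast
    also have "\<dots> = (\<Sum>p | prime p \<and> p \<le> N. x * (1 + C / l) * (1 / real p / L + 2 * (ln (real p) / real p) / L\<^sup>2))"
      by (intro sum.cong refl) (simp add: divide_simps)
    also have "\<dots> = x * (1 + C / l) * (precip N / L + 2 * plog N / L\<^sup>2)"
    proof -
      have e1: "precip N / L = (\<Sum>p | prime p \<and> p \<le> N. 1 / real p / L)"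
        unfolding precip_def by (rule sum_divide_distrib)
      have e2: "2 * plog N / L\<^sup>2 = (\<Sum>p | prime p \<and> p \<le> N. 2 * (ln (real p) / real p) / L\<^sup>2)"
        unfolding plog_def sum_distrib_left sum_divide_distrib ..
      show ?thesis unfolding e1 e2 sum.distrib[symmetric] sum_distrib_left ..
    qed
    also have "\<dots> \<le> x * (1 + C / l) * ((l + C1) / L + 2 * (L + C2) / L\<^sup>2)"
      using C1(2)[OF N2] C2(2)[of N] N2 llN lnN L C elim
      by (intro mult_left_mono add_mono divide_right_mono) auto
    also have "(l + C1) / L + 2 * (L + C2) / L\<^sup>2 \<le> (l + B) / L"
    proof -
      have "2 * (L + C2) / L\<^sup>2 = (2 + 2 * C2 / L) / L" using L by (simp add: field_simps power2_eq_square)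
      also have "\<dots> \<le> (2 + 2 * C2) / L" using L C2 by (intro divide_right_mono add_left_mono) (auto simp: divide_simps)
      finally show ?thesis by (simp add: B_def add_divide_distrib)
    qed
    hence "x * (1 + C / l) * ((l + C1) / L + 2 * (L + C2) / L\<^sup>2) \<le> x * (1 + C / l) * ((l + B) / L)"
      using L C elim by (intro mult_left_mono) auto
    also have "x * (1 + C / l) * ((l + B) / L) = x / L * (l + C + B * (1 + C / l))"
      using L by (simp add: field_simps)
    also have "\<dots> \<le> x / L * (l + K)"
    proof -
      have "C / l \<le> C" using L C by (simp add: divide_simps)
      hence "B * (1 + C / l) \<le> B * (1 + C)" using C1 C2 by (intro mult_left_mono) (auto simp: B_def)
      thus ?thesis using L elim by (intro mult_left_mono) (auto simp: K_def)
    qed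
    finally show ?case unfolding L_l_N_def(1,2) by simp
  qed
  moreover have "K \<ge> 0" using C C1 C2 by (simp add: K_def B_def)
  ultimately show thesis by (intro that[of K])
qed

text \<open>With S = sqrt(log x) = log D(x) this is sqrt S rounded down; the primes up to it have
  product at most exp(sqrt S log S), which is D(x)^o(1).\<close>

definition small_bound :: "real \<Rightarrow> nat" where
  "small_bound x = nat \<lfloor>ln x powr (1 / 4)\<rfloor>"

text \<open>The power of 2 at or above (log x)^(A/2), so that dyadic blocks can start exactly there.
  From this point on, the moments required have k log log x at most (10/A) sqrt(log x) + log log
  x.\<close>

definition mid_exp :: "real \<Rightarrow> real \<Rightarrow> nat" where
  "mid_exp A x = nat \<lceil>log 2 (ln x powr (A / 2))\<rceil>"

text \<open>After rounding, (log x)^(1/8) is a safe lower bound; in the iterated logarithm the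
  smaller exponent costs only the constant ln 8.\<close>

lemma small_bound_eventually:
  "\<forall>\<^sub>F x in at_top. small_bound x \<ge> 3 \<and> real (small_bound x) \<le> sqrt x \<and>
     ln (ln (real (small_bound x))) \<ge> ln (ln (ln x)) - ln 8 \<and> ln (ln (real (small_bound x))) \<le> ln (ln x)"
proof -
  have "\<forall>\<^sub>F x::real in at_top. ln x powr (1 / 8) \<le> ln x powr (1 / 4) - 1" by real_asymp
  moreover have "\<forall>\<^sub>F x::real in at_top. ln x powr (1 / 4) \<ge> 3" by real_asymp
  moreover have "\<forall>\<^sub>F x::real in at_top. ln x powr (1 / 4) \<le> sqrt x" by real_asymp
  moreover have "\<forall>\<^sub>F x::real in at_top. ln (ln x) > 1" by real_asymp
  moreover have "\<forall>\<^sub>F x::real in at_top. ln x > 1" by real_asymp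
  ultimately show ?thesis
  proof eventually_elim
    case (elim x)
    define w where "w = real (small_bound x)"
    have w: "w \<le> ln x powr (1/4)" "ln x powr (1/4) \<le> w + 1"
      using elim unfolding w_def small_bound_def by (auto intro: of_nat_floor)
    have sb: "small_bound x \<ge> 3" using elim by (simp add: small_bound_def le_nat_floor)
    hence w3: "w \<ge> 3" by (simp add: w_def)
    have "ln x powr (1/8) \<le> w" using w elim by linarith
    hence "ln (ln x powr (1/8)) \<le> ln w" using elim w3 by (subst ln_le_cancel_iff) auto
    hence 1: "ln (ln x) / 8 \<le> ln w" using elim by (simp add: ln_powr)
    hence "ln (ln (ln x) / 8) \<le> ln (ln w)" using elim w3 by (subst ln_le_cancel_iff) auto
    moreover have "ln (ln (ln x) / 8) = ln (ln (ln x)) - ln 8" using elim by (subst ln_div) auto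
    moreover have "ln w \<le> ln (ln x powr (1/4))" using w w3 elim by (subst ln_le_cancel_iff) auto
    hence "ln w \<le> ln (ln x)" using elim by (simp add: ln_powr)
    hence "ln w \<le> ln x" using elim ln_bound[of "ln x"] by linarith
    hence "ln (ln w) \<le> ln (ln x)" using elim w3 by (subst ln_le_cancel_iff) auto
    ultimately show ?case using sb w elim unfolding w_def by auto
  qed
qed

text \<open>Rounding up to a power of 2 at most doubles the cutoff, and the resulting ln 2 is
  absorbed by passing from A/2 to A. A fixed power of log x then changes the iterated logarithm only
  by ln A.\<close>

lemma mid_exp_eventually:
  assumes A: "A \<ge> 1"
  shows "\<forall>\<^sub>F x in at_top. ln x powr (A / 2) \<le> 2 ^ mid_exp A x \<and> small_bound x \<le> 2 ^ mid_exp A x \<and>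
    real (2 ^ mid_exp A x) \<le> sqrt x \<and> ln (ln (real (2 ^ mid_exp A x))) \<le> ln (ln (ln x)) + ln A"
proof -
  have "\<forall>\<^sub>F x::real in at_top. ln x powr (A / 2) \<ge> 2" using A by real_asymp
  moreover have "\<forall>\<^sub>F x::real in at_top. 2 * ln x powr (A / 2) \<le> sqrt x" using A by real_asymp
  moreover have "\<forall>\<^sub>F x::real in at_top. ln (ln x) > 2" by real_asymp
  moreover have "\<forall>\<^sub>F x::real in at_top. ln x > 1" by real_asymp
  ultimately show ?thesis
  proof eventually_elim
    case (elim x)
    define Y where "Y = ln x powr (A / 2)"
    define j where "j = mid_exp A x"
    have Y2: "Y \<ge> 2" using elim by (simp add: Y_def)
    have log0: "log 2 Y \<ge> 0" using Y2 by simp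
    have j: "log 2 Y \<le> real j" "real j \<le> log 2 Y + 1"
      unfolding j_def mid_exp_def Y_def[symmetric] using log0 by linarith+
    have "2 powr log 2 Y \<le> 2 powr real j" using j by (intro powr_mono) auto
    hence 1: "Y \<le> 2 ^ j" using Y2 by (simp add: powr_realpow)
    have "2 powr real j \<le> 2 powr (log 2 Y + 1)" using j by (intro powr_mono) auto
    hence 2: "2 ^ j \<le> 2 * Y" using Y2 by (simp add: powr_realpow powr_add)
    have "ln x powr (1/4) \<le> Y" unfolding Y_def using elim A by (intro powr_mono) auto
    moreover have "real (small_bound x) \<le> ln x powr (1/4)"
      unfolding small_bound_def by (intro of_nat_floor) auto
    ultimately have "real (small_bound x) \<le> 2 ^ j" using 1 by linarith
    hence 3: "small_bound x \<le> 2 ^ j" by (metis of_nat_le_iff of_nat_numeral of_nat_power)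
    have "ln ((2::real) ^ j) \<le> ln (2 * Y)" using 2 Y2 by (subst ln_le_cancel_iff) auto
    also have "\<dots> = ln 2 + A / 2 * ln (ln x)" using elim Y2 by (simp add: ln_mult Y_def ln_powr)
    also have "\<dots> \<le> A * ln (ln x)"
    proof -
      have "ln (2::real) \<le> 1" using ln2_le_25_over_36 by simp
      moreover have "1 * 2 \<le> A * ln (ln x)" using A elim by (intro mult_mono) auto
      ultimately show ?thesis by simp
    qed
    finally have 4: "ln ((2::real) ^ j) \<le> A * ln (ln x)" .
    have "ln (2 ^ j) > (0::real)"
    proof (intro ln_gt_zero)
      show "1 < (2::real) ^ j" using 1 Y2 by linarith
    qed
    hence "ln (ln ((2::real) ^ j)) \<le> ln (A * ln (ln x))" using 4 A elim by (subst ln_le_cancel_iff) auto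
    also have "\<dots> = ln (ln (ln x)) + ln A" using A elim by (simp add: ln_mult)
    finally show ?case using 1 2 3 elim unfolding Y_def j_def by auto
  qed
qed

text \<open>The relative error C/log log x multiplies a sum of reciprocals that is crudely at most
  log log x + C1, hence costs a constant.\<close>

lemma main_term_lower:
  obtains K where "K \<ge> 0" "\<forall>\<^sub>F x in at_top. (\<Sum>p | prime p \<and> 2 < p \<and> p \<le> small_bound x. prime_count (x / real p))
    \<ge> x / ln x * (ln (ln (ln x)) - K)"
proof (rule prime_count_bounds, rule precip_mertens)
  fix C C1 :: real
  assume C: "C \<ge> 1" "\<forall>\<^sub>F x in at_top. \<forall>t. 1 \<le> t \<and> t \<le> sqrt x \<longrightarrow>
     prime_count (x / t) \<le> x / t * (1 / ln x + 2 * ln t / (ln x)\<^sup>2) * (1 + C / ln (ln x)) \<and>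
     prime_count (x / t) \<ge> x / t / ln x * (1 - C / ln (ln x)) \<and>
     prime_count (x / t) \<le> 4 * (x / t) / ln x"
    and C1: "C1 \<ge> 1" "\<And>N. N \<ge> 2 \<Longrightarrow> \<bar>precip N - ln (ln (real N))\<bar> \<le> C1"
  define K where "K = ln 8 + C1 + 1 + C * (1 + C1)"
  have "\<forall>\<^sub>F x::real in at_top. ln (ln x) \<ge> 1" by real_asymp
  moreover have "\<forall>\<^sub>F x::real in at_top. ln x > 1" by real_asymp
  moreover have "\<forall>\<^sub>F x::real in at_top. x > 1" by (rule eventually_gt_at_top)
  ultimately have "\<forall>\<^sub>F x in at_top. (\<Sum>p | prime p \<and> 2 < p \<and> p \<le> small_bound x. prime_count (x / real p))
    \<ge> x / ln x * (ln (ln (ln x)) - K)"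
    using C(2) small_bound_eventually
  proof eventually_elim
    case (elim x)
    define w where "w = small_bound x"
    let ?P = "{p. prime p \<and> 2 < p \<and> p \<le> w}"
    define X where "X = (\<Sum>p\<in>?P. 1 / real p)"
    have w3: "w \<ge> 3" using elim by (simp add: w_def)
    have X: "X = precip w - 1 / 2"
    proof -
      have "{p. prime p \<and> p \<le> w} = insert 2 ?P" using w3 by (auto dest: prime_ge_2_nat)
      thus ?thesis unfolding X_def precip_def by simp
    qed
    have pw: "\<bar>precip w - ln (ln (real w))\<bar> \<le> C1" using w3 by (intro C1) auto
    have "(\<Sum>p\<in>?P. prime_count (x / real p)) \<ge> (\<Sum>p\<in>?P. x / real p / ln x * (1 - C / ln (ln x)))"
    proof (intro sum_mono)
      fix p assume p: "p \<in> ?P"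
      have "real p \<le> real w" using p by simp
      hence "1 \<le> real p \<and> real p \<le> sqrt x" using p elim unfolding w_def by auto
      thus "prime_count (x / real p) \<ge> x / real p / ln x * (1 - C / ln (ln x))" using elim by blast
    qed
    also have "(\<Sum>p\<in>?P. x / real p / ln x * (1 - C / ln (ln x))) = x / ln x * ((1 - C / ln (ln x)) * X)"
      unfolding X_def sum_distrib_left by (intro sum.cong refl) simp
    also have "(1 - C / ln (ln x)) * X = X - C * X / ln (ln x)" by (simp add: algebra_simps)
    finally have 1: "x / ln x * (X - C * X / ln (ln x)) \<le> (\<Sum>p\<in>?P. prime_count (x / real p))" .
    have Xl: "X \<le> ln (ln x) + C1" using X pw elim unfolding w_def by linarith
    have "C * X / ln (ln x) \<le> C * (ln (ln x) + C1) / ln (ln x)"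
      using Xl C elim by (intro divide_right_mono mult_left_mono) auto
    also have "\<dots> = C * (1 + C1 / ln (ln x))" using elim by (simp add: field_simps)
    also have "\<dots> \<le> C * (1 + C1)" using C C1 elim by (intro mult_left_mono add_left_mono) (auto simp: divide_simps)
    finally have "C * X / ln (ln x) \<le> C * (1 + C1)" .
    moreover have "ln (ln (ln x)) - ln 8 \<le> ln (ln (real w))" using elim unfolding w_def by blast
    ultimately have "X - C * X / ln (ln x) \<ge> ln (ln (ln x)) - K"
      using X pw unfolding K_def by linarith
    hence "x / ln x * (ln (ln (ln x)) - K) \<le> x / ln x * (X - C * X / ln (ln x))"
      using elim by (intro mult_left_mono) auto
    thus ?case using 1 unfolding w_def by linarith
  qed
  moreover have "K \<ge> 0" using C C1 by (simp add: K_def)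
  ultimately show thesis by (intro that[of K])
qed

text \<open>The iterated logarithms of the two cutoffs differ by at most ln 8 + ln A, so these
  primes can be estimated trivially at a cost of O(x / log x).\<close>

lemma mid_range_reciprocals:
  assumes A: "A \<ge> 1"
  obtains K where "K \<ge> 0" "\<forall>\<^sub>F x in at_top. (\<Sum>p | prime p \<and> small_bound x < p \<and> p \<le> 2 ^ mid_exp A x. 1 / real p) \<le> K"
proof (rule precip_mertens)
  fix C1 :: real
  assume C1: "C1 \<ge> 1" "\<And>N. N \<ge> 2 \<Longrightarrow> \<bar>precip N - ln (ln (real N))\<bar> \<le> C1"
  define K where "K = ln 8 + ln A + 2 * C1"
  have "\<forall>\<^sub>F x in at_top. (\<Sum>p | prime p \<and> small_bound x < p \<and> p \<le> 2 ^ mid_exp A x. 1 / real p) \<le> K"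
    using small_bound_eventually mid_exp_eventually[OF A]
  proof eventually_elim
    case (elim x)
    define w m where "w = small_bound x" "m = (2::nat) ^ mid_exp A x"
    have w: "w \<ge> 2" "w \<le> m" using elim unfolding w_m_def by auto
    have "precip m = precip w + (\<Sum>p | prime p \<and> w < p \<and> p \<le> m. 1 / real p)"
    proof -
      have "{p. prime p \<and> p \<le> m} = {p. prime p \<and> p \<le> w} \<union> {p. prime p \<and> w < p \<and> p \<le> m}" using w by auto
      moreover have "finite {p. prime p \<and> w < p \<and> p \<le> m}"
        by (rule finite_subset[OF _ finite_primes_nat_le[of m]]) auto
      ultimately show ?thesis unfolding precip_def
        by (simp only:) (intro sum.union_disjoint finite_primes_nat_le, auto)
    qed
    moreover have "\<bar>precip w - ln (ln (real w))\<bar> \<le> C1" "\<bar>precip m - ln (ln (real m))\<bar> \<le> C1"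
      using w by (intro C1; simp)+
    ultimately show ?case using elim unfolding K_def w_m_def by linarith
  qed
  moreover have "K \<ge> 0" using A C1 by (simp add: K_def)
  ultimately show thesis by (intro that[of K])
qed

subsection \<open>Bias for generic discriminants\<close>

definition top_exp :: "real \<Rightarrow> nat" where "top_exp x = nat \<lceil>log 2 x\<rceil>"

lemma le_power_top_exp: "x > 0 \<Longrightarrow> x \<le> 2 ^ top_exp x"
proof -
  assume x: "x > 0"
  have "log 2 x \<le> real (top_exp x)" unfolding top_exp_def by linarith
  hence "2 powr log 2 x \<le> 2 powr real (top_exp x)" by (intro powr_mono) auto
  thus ?thesis using x by (simp add: powr_realpow)
qed

lemma top_exp_le: "ln x \<ge> 2 \<Longrightarrow> real (top_exp x) \<le> 2 * ln x"
proof -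
  assume L: "ln x \<ge> 2"
  have log: "log 2 x = ln x / ln 2" by (simp add: log_def)
  hence "log 2 x \<ge> 0" using L by simp
  hence "real (top_exp x) \<le> log 2 x + 1" unfolding top_exp_def by linarith
  also have "log 2 x \<le> ln x / (2/3)"
    unfolding log using L ln2_ge_two_thirds by (intro divide_left_mono) auto
  finally show ?thesis using L by simp
qed

definition dyadic_primes :: "nat \<Rightarrow> nat set" where
  "dyadic_primes j = {p. prime p \<and> 2 ^ j < p \<and> p \<le> 2 ^ (j + 1)}"

lemma finite_dyadic_primes: "finite (dyadic_primes j)"
  by (rule finite_subset[OF _ finite_primes_nat_le[of "2 ^ (j + 1)"]]) (auto simp: dyadic_primes_def)

lemma sum_dyadic_split:
  fixes g :: "nat \<Rightarrow> real"
  assumes "j0 \<le> J"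
  shows "(\<Sum>p | prime p \<and> p \<le> 2 ^ J. g p) =
    (\<Sum>p | prime p \<and> p \<le> 2 ^ j0. g p) + (\<Sum>j=j0..<J. \<Sum>p\<in>dyadic_primes j. g p)"
  using assms
proof (induction J rule: dec_induct)
  case (step J)
  have "(2::nat) ^ J \<le> 2 ^ (J + 1)" by (intro power_increasing) auto
  hence "{p. prime p \<and> p \<le> 2 ^ Suc J} = {p. prime p \<and> p \<le> 2 ^ J} \<union> dyadic_primes J"
    by (auto simp: dyadic_primes_def)
  moreover have "{p. prime p \<and> p \<le> 2 ^ J} \<inter> dyadic_primes J = {}" by (auto simp: dyadic_primes_def)
  ultimately have "(\<Sum>p | prime p \<and> p \<le> 2 ^ Suc J. g p) =
      (\<Sum>p | prime p \<and> p \<le> 2 ^ J. g p) + (\<Sum>p\<in>dyadic_primes J. g p)"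
    by (simp only: sum.union_disjoint[OF finite_primes_nat_le finite_dyadic_primes])
  thus ?case using step by simp
qed simp

lemma card_prime_factors_squarefree:
  assumes "squarefree (d::nat)"
  shows "2 ^ card (prime_factors d) \<le> d"
proof -
  have "(\<Prod>r\<in>prime_factors d. 2) \<le> (\<Prod>r\<in>prime_factors d. r)"
    by (intro prod_mono) (auto intro: prime_ge_2_nat)
  also have "\<dots> = d" using squarefree_eq_prod_prime_factors[OF assms] by simp
  finally show ?thesis by simp
qed

lemma prime_count_le_self: "z \<ge> 0 \<Longrightarrow> prime_count z \<le> z"
proof -
  assume z: "z \<ge> 0"
  have "{p. prime p \<and> real p \<le> z} \<subseteq> {0<..nat \<lfloor>z\<rfloor>}" by (auto simp: le_nat_floor prime_gt_0_nat)
  hence "card {p. prime p \<and> real p \<le> z} \<le> nat \<lfloor>z\<rfloor>"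
    using card_mono[of "{0<..nat \<lfloor>z\<rfloor>}"] by simp
  hence "prime_count z \<le> real (nat \<lfloor>z\<rfloor>)" unfolding prime_count_def by (simp only: of_nat_le_iff)
  also have "\<dots> \<le> z" using z by (rule of_nat_floor)
  finally show ?thesis .
qed

lemma prime_count_nonneg: "prime_count z \<ge> 0"
  by (simp add: prime_count_def)

lemma prime_count_lt_1: "z < 1 \<Longrightarrow> prime_count z = 0"
proof -
  assume z: "z < 1"
  have "{p. prime p \<and> real p \<le> z} = {}" using z by (auto dest: prime_gt_1_nat)
  thus ?thesis unfolding prime_count_def by (simp only: card.empty of_nat_0)
qed

text \<open>Gathers what the deterministic estimate \<open>bias\<close> consumes;
  \<open>card_generic_disc\<close> shows that few d in the residue class fail it. The threshold
  x/(log x)^2 per block leaves O(x/log x) after summing over at most 2 log x blocks.\<close>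

definition generic_disc :: "real \<Rightarrow> int \<Rightarrow> real \<Rightarrow> nat \<Rightarrow> bool" where
  "generic_disc A \<eta> x d \<longleftrightarrow> odd d \<and> squarefree d \<and> d > 1 \<and> real d \<le> exp (sqrt (ln x)) \<and>
     (\<forall>p. prime p \<and> 2 < p \<and> p \<le> small_bound x \<longrightarrow> jac d (int p) = \<eta>) \<and>
     \<bar>\<Sum>(p, q)\<in>prime_pairs x. real_of_int (jac d (int p)) * of_int (jac d (int q))\<bar> \<le> x / ln x \<and>
     (\<forall>j. mid_exp A x \<le> j \<and> j < top_exp x \<longrightarrow>
       \<bar>\<Sum>p\<in>dyadic_primes j. prime_count (x / real p) * of_int (jac d (int p))\<bar> \<le> x / (ln x)\<^sup>2)"

text \<open>In the linear term the odd primes up to the small cutoff all count with sign +1 and give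
  the main term. The prime 2 and the middle range are lost trivially, the dyadic blocks are small by
  genericity. A prime divisor of d has symbol 0, not \<eta>, and therefore lies beyond the small
  cutoff.\<close>

lemma bias:
  assumes A: "A \<ge> 1" and \<eta>: "\<eta> \<in> {-1, 1 :: int}"
  obtains K where "K \<ge> 0" "\<forall>\<^sub>F x in at_top. \<forall>d. generic_disc A \<eta> x d \<longrightarrow>
    4 * real (card {(p, q) \<in> prime_pairs x. jac d (int p) = \<eta> \<and> jac d (int q) = \<eta>}) \<ge>
      real (card {(p, q) \<in> prime_pairs x. coprime (p * q) d}) + x / ln x * (ln (ln (ln x)) - K)"
proof (rule prime_count_bounds, rule main_term_lower, rule mid_range_reciprocals[OF A])
  fix C K0 K1 :: real
  assume C: "C \<ge> 1" "\<forall>\<^sub>F x in at_top. \<forall>t. 1 \<le> t \<and> t \<le> sqrt x \<longrightarrow>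
     prime_count (x / t) \<le> x / t * (1 / ln x + 2 * ln t / (ln x)\<^sup>2) * (1 + C / ln (ln x)) \<and>
     prime_count (x / t) \<ge> x / t / ln x * (1 - C / ln (ln x)) \<and>
     prime_count (x / t) \<le> 4 * (x / t) / ln x"
    and K0: "K0 \<ge> 0" "\<forall>\<^sub>F x in at_top. (\<Sum>p | prime p \<and> 2 < p \<and> p \<le> small_bound x. prime_count (x / real p))
      \<ge> x / ln x * (ln (ln (ln x)) - K0)"
    and K1: "K1 \<ge> 0" "\<forall>\<^sub>F x in at_top. (\<Sum>p | prime p \<and> small_bound x < p \<and> p \<le> 2 ^ mid_exp A x. 1 / real p) \<le> K1"
  define K where "K = K0 + 4 * K1 + 8 * (K1 + 2) + 6"
  have "\<forall>\<^sub>F x::real in at_top. sqrt x \<le> x / ln x" by real_asymp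
  moreover have "\<forall>\<^sub>F x::real in at_top. exp (sqrt (ln x)) \<le> sqrt x" by real_asymp
  moreover have "\<forall>\<^sub>F x::real in at_top. ln x \<ge> 2" by real_asymp
  moreover have "\<forall>\<^sub>F x::real in at_top. x \<ge> 4" by (rule eventually_ge_at_top)
  ultimately have "\<forall>\<^sub>F x in at_top. \<forall>d. generic_disc A \<eta> x d \<longrightarrow>
    4 * real (card {(p, q) \<in> prime_pairs x. jac d (int p) = \<eta> \<and> jac d (int q) = \<eta>}) \<ge>
      real (card {(p, q) \<in> prime_pairs x. coprime (p * q) d}) + x / ln x * (ln (ln (ln x)) - K)"
    using C(2) K0(2) K1(2) small_bound_eventually mid_exp_eventually[OF A]
  proof eventually_elim
    case (elim x)
    show ?case
    proof (intro allI impI)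
      fix d assume gd: "generic_disc A \<eta> x d"
      define L where "L = ln x"
      define w j0 J where "w = small_bound x" "j0 = mid_exp A x" "J = top_exp x"
      define m where "m = (2::nat) ^ j0"
      define c where "c = (\<lambda>p. prime_count (x / real p))"
      define f where "f = (\<lambda>p. real_of_int (jac d (int p)))"
      have d: "odd d" "squarefree d" "d > 1" "real d \<le> exp (sqrt L)"
        "\<And>p. prime p \<Longrightarrow> 2 < p \<Longrightarrow> p \<le> w \<Longrightarrow> jac d (int p) = \<eta>"
        "\<bar>\<Sum>(p, q)\<in>prime_pairs x. f p * f q\<bar> \<le> x / L"
        "\<And>j. j0 \<le> j \<Longrightarrow> j < J \<Longrightarrow> \<bar>\<Sum>p\<in>dyadic_primes j. c p * f p\<bar> \<le> x / L\<^sup>2"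
        using gd unfolding generic_disc_def L_def w_j0_J_def c_def f_def by blast+
      have L: "L \<ge> 2" and x4: "x \<ge> 4" using elim by (auto simp: L_def)
      have xL: "x / L \<ge> 0" using L x4 by simp
      have w: "w \<ge> 3" "w \<le> m" "real m \<le> sqrt x" "sqrt L \<le> real m"
      proof -
        show "w \<ge> 3" "w \<le> m" "real m \<le> sqrt x" using elim unfolding w_j0_J_def m_def by auto
        have "L powr (1/2) \<le> L powr (A / 2)" using L A by (intro powr_mono) auto
        also have "\<dots> \<le> real m" using elim unfolding L_def m_def w_j0_J_def by simp
        finally show "sqrt L \<le> real m" using L by (simp add: powr_half_sqrt)
      qed
      have c0: "c p \<ge> 0" for p unfolding c_def by (rule prime_count_nonneg)
      have c4: "c p \<le> 4 * (x / L) * (1 / real p)" if "1 \<le> p" "real p \<le> sqrt x" for p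
      proof -
        have "1 \<le> real p" using that by simp
        hence "c p \<le> 4 * (x / real p) / ln x" using elim that unfolding c_def by blast
        thus ?thesis by (simp add: L_def mult.commute)
      qed
      have fle: "\<bar>f p\<bar> \<le> 1" for p using jac_values[of d "int p"] by (auto simp: f_def)
      have \<eta>1: "\<bar>real_of_int \<eta>\<bar> = 1" using \<eta> by auto
      define g where "g = (\<lambda>p. of_int \<eta> * (c p * f p))"
      have g_ge: "g p \<ge> - c p" for p
      proof -
        have "\<bar>g p\<bar> = c p * \<bar>f p\<bar>" using \<eta>1 c0[of p] by (simp add: g_def abs_mult)
        also have "\<dots> \<le> c p * 1" using fle c0 by (intro mult_left_mono) auto
        finally show ?thesis by linarith
      qed
      have x_le: "x \<le> 2 ^ J" unfolding w_j0_J_def using x4 by (intro le_power_top_exp) auto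
      have j0J: "j0 \<le> J"
      proof -
        have "sqrt x \<le> x" using x4 by (simp add: real_le_lsqrt power2_eq_square)
        moreover have "real m = 2 ^ j0" by (simp add: m_def)
        ultimately have "(2::real) ^ j0 \<le> 2 ^ J" using w(3) x_le by linarith
        thus ?thesis by simp
      qed
      have J_le: "real J \<le> 2 * L" unfolding w_j0_J_def L_def using elim by (intro top_exp_le) auto
      have "of_int \<eta> * (\<Sum>p | prime p \<and> real p \<le> x. f p * prime_count (x / real p)) = (\<Sum>p | prime p \<and> real p \<le> x. g p)"
        unfolding g_def c_def by (simp add: sum_distrib_left mult.commute)
      \<comment> \<open>For p > x the weight \<open>prime_count (x / p)\<close> is 0, so the range
        may be extended to a full power of 2.\<close>
      also have "\<dots> = (\<Sum>p | prime p \<and> p \<le> 2 ^ J. g p)"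
      proof (rule sum.mono_neutral_left)
        show "{p. prime p \<and> real p \<le> x} \<subseteq> {p. prime p \<and> p \<le> 2 ^ J}"
        proof clarify
          fix p assume "real p \<le> x"
          moreover have "real (2 ^ J) = (2::real) ^ J" by simp
          ultimately have "real p \<le> real (2 ^ J)" using x_le by linarith
          thus "p \<le> 2 ^ J" by (simp only: of_nat_le_iff)
        qed
        show "\<forall>p\<in>{p. prime p \<and> p \<le> 2 ^ J} - {p. prime p \<and> real p \<le> x}. g p = 0"
        proof
          fix p assume "p \<in> {p. prime p \<and> p \<le> 2 ^ J} - {p. prime p \<and> real p \<le> x}"
          hence "x / real p < 1" using x4 by (auto simp: divide_simps)
          thus "g p = 0" by (simp add: g_def c_def prime_count_lt_1)
        qed
      qed (rule finite_primes_nat_le)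
      also have "\<dots> = (\<Sum>p | prime p \<and> p \<le> m. g p) + (\<Sum>j=j0..<J. \<Sum>p\<in>dyadic_primes j. g p)"
        unfolding m_def by (rule sum_dyadic_split[OF j0J])
      finally have T: "of_int \<eta> * (\<Sum>p | prime p \<and> real p \<le> x. f p * prime_count (x / real p)) =
        (\<Sum>p | prime p \<and> p \<le> m. g p) + (\<Sum>j=j0..<J. \<Sum>p\<in>dyadic_primes j. g p)" .
      have blocks: "(\<Sum>j=j0..<J. \<Sum>p\<in>dyadic_primes j. g p) \<ge> - (2 * (x / L))"
      proof -
        have "(\<Sum>j=j0..<J. \<Sum>p\<in>dyadic_primes j. g p) \<ge> (\<Sum>j=j0..<J. - (x / L\<^sup>2))"
        proof (intro sum_mono)
          fix j assume j: "j \<in> {j0..<J}"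
          have "\<bar>\<Sum>p\<in>dyadic_primes j. g p\<bar> = \<bar>\<Sum>p\<in>dyadic_primes j. c p * f p\<bar>"
            unfolding g_def sum_distrib_left[symmetric] abs_mult \<eta>1 by simp
          also have "\<dots> \<le> x / L\<^sup>2" using j by (intro d(7)) auto
          finally show "- (x / L\<^sup>2) \<le> (\<Sum>p\<in>dyadic_primes j. g p)" by linarith
        qed
        moreover have "real (J - j0) * (x / L\<^sup>2) \<le> 2 * L * (x / L\<^sup>2)"
          using J_le x4 j0J by (intro mult_right_mono) auto
        moreover have "2 * L * (x / L\<^sup>2) = 2 * (x / L)" using L by (simp add: power2_eq_square)
        ultimately show ?thesis by simp
      qed
      let ?P1 = "{p. prime p \<and> 2 < p \<and> p \<le> w}" and ?P2 = "{p. prime p \<and> w < p \<and> p \<le> m}"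
      have fin: "finite ?P1" "finite ?P2"
        by (rule finite_subset[OF _ finite_primes_nat_le[of w]], auto)
      have mid: "(\<Sum>p\<in>?P2. 1 / real p) \<le> K1" using elim unfolding w_j0_J_def m_def by blast
      have small: "(\<Sum>p | prime p \<and> p \<le> m. g p) \<ge> x / L * (ln (ln (ln x)) - K0) - 2 * (x / L) - 4 * (x / L) * K1"
      proof -
        have "{p. prime p \<and> p \<le> m} = insert 2 (?P1 \<union> ?P2)"
          using w by (auto dest: prime_ge_2_nat)
        moreover have "2 \<notin> ?P1 \<union> ?P2" using w by auto
        moreover have "(\<Sum>p\<in>?P1 \<union> ?P2. g p) = (\<Sum>p\<in>?P1. g p) + (\<Sum>p\<in>?P2. g p)"
          using fin by (intro sum.union_disjoint) auto
        ultimately have "(\<Sum>p | prime p \<and> p \<le> m. g p) = g 2 + ((\<Sum>p\<in>?P1. g p) + (\<Sum>p\<in>?P2. g p))"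
          using sum.insert[of "?P1 \<union> ?P2" 2 g] fin by (simp only: finite_Un simp_thms if_False)
        moreover have "(\<Sum>p\<in>?P1. g p) = (\<Sum>p\<in>?P1. c p)"
          using \<eta> d(5) by (intro sum.cong) (auto simp: g_def f_def)
        moreover have "(\<Sum>p\<in>?P1. c p) \<ge> x / L * (ln (ln (ln x)) - K0)"
          using elim unfolding L_def c_def w_j0_J_def by blast
        moreover have "g 2 \<ge> - (2 * (x / L))"
        proof -
          have "2 \<le> sqrt x" using x4 by (intro real_le_rsqrt) simp
          thus ?thesis using c4[of 2] g_ge[of 2] by simp
        qed
        moreover have "(\<Sum>p\<in>?P2. g p) \<ge> - (4 * (x / L) * K1)"
        proof -
          have "(\<Sum>p\<in>?P2. - (4 * (x / L) * (1 / real p))) \<le> (\<Sum>p\<in>?P2. g p)"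
          proof (intro sum_mono)
            fix p assume p: "p \<in> ?P2"
            hence "real p \<le> real m" by simp
            hence "real p \<le> sqrt x" "1 \<le> p" using p w by auto
            thus "- (4 * (x / L) * (1 / real p)) \<le> g p" using c4[of p] g_ge[of p] by linarith
          qed
          moreover have "(\<Sum>p\<in>?P2. - (4 * (x / L) * (1 / real p))) = - (4 * (x / L) * (\<Sum>p\<in>?P2. 1 / real p))"
            by (simp only: sum_negf sum_distrib_left)
          moreover have "4 * (x / L) * (\<Sum>p\<in>?P2. 1 / real p) \<le> 4 * (x / L) * K1"
            using mid xL by (intro mult_left_mono) auto
          ultimately show ?thesis by linarith
        qed
        ultimately show ?thesis by linarith
      qed
      \<comment> \<open>Prime divisors of d up to m belong to the middle range, with reciprocal sum
        at most K1. Those above m contribute at most 1/m each, and d has at most 2 sqrt L <= 2 m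
        prime factors because 2 to their number is at most d.\<close>
      have bad: "(\<Sum>r\<in>prime_factors d. prime_count (x / real r)) \<le> 4 * (x / L) * (K1 + 2)"
      proof -
        let ?F = "prime_factors d"
        have r: "prime r" "r > 2" "r > w" "real r \<le> sqrt x" "r \<ge> 1" if "r \<in> ?F" for r
        proof -
          show pr: "prime r" "r > 2" using odd_prime_factor[OF d(1) that] by auto
          have rd: "r dvd d" using that by auto
          show "r > w"
          proof (rule ccontr)
            assume "\<not> r > w"
            hence "jac d (int r) = \<eta>" using pr by (intro d(5)) auto
            hence "coprime (int r) (int d)" using jac_eq_0_iff[of d "int r"] \<eta> d(3) by auto
            thus False using rd pr not_prime_unit by (auto simp: coprime_int_iff dest: coprime_common_divisor[of r d r])
          qed
          have "r \<le> d" using rd d(3) by (intro dvd_imp_le) auto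
          hence "real r \<le> real d" by simp
          thus "real r \<le> sqrt x" using d(4) elim unfolding L_def by linarith
          show "r \<ge> 1" using pr by simp
        qed
        have "(\<Sum>r\<in>?F. 1 / real r) \<le> (\<Sum>r\<in>?F. (if r \<le> m then 1 / real r else 0) + 1 / real m)"
          using w by (intro sum_mono) (auto simp: divide_simps)
        also have "\<dots> = (\<Sum>r\<in>?F. if r \<le> m then 1 / real r else 0) + real (card ?F) / real m"
          by (simp add: sum.distrib)
        also have "(\<Sum>r\<in>?F. if r \<le> m then 1 / real r else 0) = (\<Sum>r\<in>{r\<in>?F. r \<le> m}. 1 / real r)"
          by (simp add: sum.If_cases Int_def)
        also have "\<dots> \<le> (\<Sum>p\<in>?P2. 1 / real p)" using r fin by (intro sum_mono2) auto
        also have "\<dots> \<le> K1" by (rule mid)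
        also have "real (card ?F) / real m \<le> 2"
        proof -
          have "real (2 ^ card ?F) \<le> real d" using card_prime_factors_squarefree[OF d(2)] by (simp only: of_nat_le_iff)
          hence "(2::real) ^ card ?F \<le> exp (sqrt L)" using d(4) by (simp only: of_nat_power of_nat_numeral)
          hence "ln ((2::real) ^ card ?F) \<le> ln (exp (sqrt L))" by (subst ln_le_cancel_iff) auto
          hence "real (card ?F) * ln 2 \<le> sqrt L" by (simp add: ln_realpow)
          moreover have "real (card ?F) * (1/2) \<le> real (card ?F) * ln 2"
            using ln2_ge_two_thirds by (intro mult_left_mono) auto
          ultimately have "real (card ?F) \<le> 2 * real m" using w(4) by linarith
          thus ?thesis using w by (simp add: divide_simps)
        qed
        finally have "4 * (x / L) * (\<Sum>r\<in>?F. 1 / real r) \<le> 4 * (x / L) * (K1 + 2)"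
          using xL by (intro mult_left_mono) auto
        moreover have "(\<Sum>r\<in>?F. prime_count (x / real r)) \<le> (\<Sum>r\<in>?F. 4 * (x / L) * (1 / real r))"
          using c4 r unfolding c_def by (intro sum_mono) blast
        ultimately show ?thesis unfolding sum_distrib_left[symmetric] by linarith
      qed
      have "real (card {(p, q) \<in> prime_pairs x. coprime (p * q) d}) +
        of_int \<eta> * (\<Sum>p | prime p \<and> real p \<le> x. f p * prime_count (x / real p)) +
        (\<Sum>(p, q)\<in>prime_pairs x. f p * f q) - sqrt x - 2 * (\<Sum>r\<in>prime_factors d. prime_count (x / real r))
        \<le> 4 * real (card {(p, q) \<in> prime_pairs x. jac d (int p) = \<eta> \<and> jac d (int q) = \<eta>})"
        using char_count_lower(1)[of d x \<eta>] d(3) x4 \<eta> unfolding f_def by simp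
      moreover have "x / L * (ln (ln (ln x)) - K) = x / L * (ln (ln (ln x)) - K0) - 4 * (x / L) * K1
          - 2 * (4 * (x / L) * (K1 + 2)) - 6 * (x / L)"
        by (simp add: K_def algebra_simps add_divide_distrib)
      moreover have "sqrt x \<le> x / L" using elim by (simp add: L_def)
      ultimately have "real (card {(p, q) \<in> prime_pairs x. coprime (p * q) d}) + x / L * (ln (ln (ln x)) - K)
        \<le> 4 * real (card {(p, q) \<in> prime_pairs x. jac d (int p) = \<eta> \<and> jac d (int q) = \<eta>})"
        using T blocks small bad abs_le_D2[OF d(6)] by argo
      thus "4 * real (card {(p, q) \<in> prime_pairs x. jac d (int p) = \<eta> \<and> jac d (int q) = \<eta>}) \<ge>
        real (card {(p, q) \<in> prime_pairs x. coprime (p * q) d}) + x / ln x * (ln (ln (ln x)) - K)"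
        unfolding L_def .
    qed
  qed
  moreover have "K \<ge> 0" using K0 K1 by (simp add: K_def)
  ultimately show thesis by (intro that[of K])
qed

text \<open>Four times the numerator exceeds N0 by X (l3 - K), so the ratio exceeds 1 by at least
  (l3 - K)/(l2 + K'). Since l3 <= l2, moving K' from the denominator to the numerator only decreases
  this. The bound \<open>Num \<le> N0\<close> makes the denominator positive.\<close>

lemma bias_ratio:
  fixes Num N0 X l2 l3 K K' :: real
  assumes "4 * Num \<ge> N0 + X * (l3 - K)" "Num \<le> N0" "N0 \<le> X * (l2 + K')" "X > 0" "l3 > K" "l2 \<ge> l3" "l2 > 0"
    "K \<ge> 0" "K' \<ge> 0"
  shows "Num / (1 / 4 * N0) \<ge> 1 + (l3 + - (K + K')) / l2"
proof -
  have "X * (l3 - K) > 0" using assms by simp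
  hence N0: "N0 > 0" using assms by linarith
  have "(l3 + - (K + K')) / l2 \<le> (l3 - K) / (l2 + K')"
  proof -
    have "(l3 - K) * K' \<le> l2 * K'" using assms by (intro mult_right_mono) auto
    moreover have "0 \<le> K' * K'" by simp
    moreover have "(l3 + - (K + K')) * (l2 + K') = (l3 - K) * l2 + (l3 - K) * K' - l2 * K' - K' * K'"
      by (simp add: algebra_simps)
    ultimately have "(l3 + - (K + K')) * (l2 + K') \<le> (l3 - K) * l2" by linarith
    thus ?thesis using assms by (simp add: divide_simps mult.commute)
  qed
  also have "\<dots> = X * (l3 - K) / (X * (l2 + K'))" using assms by simp
  also have "\<dots> \<le> X * (l3 - K) / N0"
    using assms(3,4,7,9) N0 \<open>X * (l3 - K) > 0\<close> by (intro divide_left_mono mult_pos_pos) (linarith | assumption)+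
  also have "\<dots> \<le> (4 * Num - N0) / N0" using assms N0 by (intro divide_right_mono) auto
  also have "\<dots> = Num / (1 / 4 * N0) - 1" using N0 by (simp add: field_simps)
  finally show ?thesis by linarith
qed

section \<open>Counting the exceptional discriminants\<close>

lemma exceptional_semiprimes:
  "\<forall>\<^sub>F x in at_top. \<forall>E. finite E \<and> (\<forall>d\<in>E. odd d \<and> squarefree d \<and> real d \<le> exp (sqrt (ln x)) \<and>
     x / ln x \<le> \<bar>\<Sum>(p, q)\<in>prime_pairs x. real_of_int (jac d (int p)) * of_int (jac d (int q))\<bar>) \<longrightarrow>
     real (card E) \<le> 8 * (ln x)\<^sup>2"
proof -
  have "\<forall>\<^sub>F x::real in at_top. 2 * (2 * x) * (exp (sqrt (ln x)))\<^sup>2 \<le> (x / ln x)\<^sup>2" by real_asymp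
  moreover have "\<forall>\<^sub>F x::real in at_top. ln x \<ge> 1" by real_asymp
  moreover have "\<forall>\<^sub>F x::real in at_top. x > 1" by (rule eventually_gt_at_top)
  ultimately show ?thesis
  proof eventually_elim
    case (elim x)
    show ?case
    proof (intro allI impI)
      fix E :: "nat set"
      assume E: "finite E \<and> (\<forall>d\<in>E. odd d \<and> squarefree d \<and> real d \<le> exp (sqrt (ln x)) \<and>
        x / ln x \<le> \<bar>\<Sum>(p, q)\<in>prime_pairs x. real_of_int (jac d (int p)) * of_int (jac d (int q))\<bar>)"
      \<comment> \<open>The coefficients are the indicator of the products p q, and the length x
        already dwarfs exp(2 sqrt(log x)), so \<open>large_values\<close> applies to the sum
        itself.\<close>
      define N where "N = nat \<lfloor>x\<rfloor> + 1"
      define I where "I = (\<lambda>(p, q). p * q) ` prime_pairs x"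
      define a where "a = (\<lambda>n. if n \<in> I then 1 else 0 :: real)"
      have N: "real N \<le> 2 * x" using elim unfolding N_def by linarith
      have IN: "I \<subseteq> {..<N}"
      proof
        fix n assume "n \<in> I"
        hence "real n \<le> x" unfolding I_def by (auto simp: prime_pairs_def)
        thus "n \<in> {..<N}" by (simp add: N_def le_nat_floor less_Suc_eq_le)
      qed
      have sum: "(\<Sum>n<N. a n * of_int (jac d (int n))) =
          (\<Sum>(p, q)\<in>prime_pairs x. real_of_int (jac d (int p)) * of_int (jac d (int q)))" if "odd d" for d
      proof -
        have "(\<Sum>n<N. a n * of_int (jac d (int n))) = (\<Sum>n\<in>I. real_of_int (jac d (int n)))"
          using IN by (intro sum.mono_neutral_cong_right) (auto simp: a_def)
        also have "\<dots> = (\<Sum>(p, q)\<in>prime_pairs x. real_of_int (jac d (int (p * q))))"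
          unfolding I_def by (subst sum.reindex[OF inj_prime_pairs]) (simp add: case_prod_unfold)
        also have "\<dots> = (\<Sum>(p, q)\<in>prime_pairs x. real_of_int (jac d (int p)) * of_int (jac d (int q)))"
          using that by (intro sum.cong) (auto simp: jac_mult)
        finally show ?thesis .
      qed
      have A: "(\<Sum>n<N. (a n)\<^sup>2) \<le> 2 * x"
      proof -
        have "(\<Sum>n<N. (a n)\<^sup>2) \<le> (\<Sum>n<N. 1)" by (intro sum_mono) (simp add: a_def)
        thus ?thesis using N by simp
      qed
      have "real (card E) * (x / ln x)\<^sup>2 \<le> 2 * (\<Sum>n<N. (a n)\<^sup>2) * real N"
      proof (rule large_values[where M = "exp (sqrt (ln x))"])
        have "2 * (\<Sum>n<N. (a n)\<^sup>2) * (exp (sqrt (ln x)))\<^sup>2 \<le> 2 * (2 * x) * (exp (sqrt (ln x)))\<^sup>2"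
          using A by (intro mult_right_mono) auto
        thus "2 * (\<Sum>n<N. (a n)\<^sup>2) * (exp (sqrt (ln x)))\<^sup>2 \<le> (x / ln x)\<^sup>2" using elim by linarith
        show "x / ln x > 0" using elim by (intro divide_pos_pos) auto
      qed (use E sum in auto)
      also have "\<dots> \<le> 2 * (2 * x) * (2 * x)" using A N elim by (intro mult_mono) (auto intro!: sum_nonneg mult_nonneg_nonneg)
      also have "\<dots> = 8 * (ln x)\<^sup>2 * (x / ln x)\<^sup>2" using elim by (simp add: power2_eq_square field_simps)
      finally show "real (card E) \<le> 8 * (ln x)\<^sup>2" using elim by simp
    qed
  qed
qed

text \<open>The moment \<open>k\<close> is the least one for which \<open>2 ^ (j k)\<close> reaches \<open>exp (5 sqrt (ln x))\<close>, long enough for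
  the large values inequality at modulus \<open>exp (sqrt (ln x))\<close>.\<close>

lemma exceptional_blocks:
  assumes A: "A \<ge> 60"
  shows "\<forall>\<^sub>F x in at_top. \<forall>j E. mid_exp A x \<le> j \<and> finite E \<and> (\<forall>d\<in>E. odd d \<and> squarefree d \<and> real d \<le> exp (sqrt (ln x)) \<and>
     x / (ln x)\<^sup>2 \<le> \<bar>\<Sum>p\<in>dyadic_primes j. prime_count (x / real p) * of_int (jac d (int p))\<bar>) \<longrightarrow>
     real (card E) \<le> 4 * exp (60 / A * sqrt (ln x)) * (ln x) ^ 6"
proof -
  have A1: "A \<ge> 1" using A by simp
  have "\<forall>\<^sub>F x::real in at_top. ln 2 + 6 * ln (ln x) \<le> 2 * sqrt (ln x)" by real_asymp
  moreover have "\<forall>\<^sub>F x::real in at_top. sqrt (ln x) + 1 \<le> ln x" by real_asymp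
  moreover have "\<forall>\<^sub>F x::real in at_top. ln x \<ge> 4" by real_asymp
  moreover have "\<forall>\<^sub>F x::real in at_top. ln (ln x) \<ge> 1" by real_asymp
  moreover have "\<forall>\<^sub>F x::real in at_top. x \<ge> 1" by (rule eventually_ge_at_top)
  ultimately show ?thesis using mid_exp_eventually[OF A1]
  proof eventually_elim
    case (elim x)
    show ?case
    proof (intro allI impI)
      fix j and E :: "nat set"
      assume asm: "mid_exp A x \<le> j \<and> finite E \<and> (\<forall>d\<in>E. odd d \<and> squarefree d \<and> real d \<le> exp (sqrt (ln x)) \<and>
        x / (ln x)\<^sup>2 \<le> \<bar>\<Sum>p\<in>dyadic_primes j. prime_count (x / real p) * of_int (jac d (int p))\<bar>)"
      define L S where "L = ln x" "S = sqrt (ln x)"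
      have L: "L \<ge> 4" "ln L \<ge> 1" "S + 1 \<le> L" "S \<ge> 0" using elim by (auto simp: L_S_def)
      define a where "a = real j * ln 2"
      have a: "a \<ge> A / 2 * ln L" "a > 0"
      proof -
        have "L powr (A / 2) \<le> 2 ^ mid_exp A x" using elim by (simp add: L_S_def)
        also have "\<dots> \<le> (2::real) ^ j" using asm by (intro power_increasing) auto
        finally have "ln (L powr (A / 2)) \<le> ln ((2::real) ^ j)" using L by (subst ln_le_cancel_iff) auto
        thus 1: "a \<ge> A / 2 * ln L" using L by (simp add: ln_powr ln_realpow a_def)
        have "A / 2 * ln L > 0" using A L by simp
        thus "a > 0" using 1 by linarith
      qed
      define k where "k = nat \<lceil>5 * S / a\<rceil>"
      have k: "5 * S / a \<le> real k" "real k \<le> 5 * S / a + 1"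
      proof -
        have "5 * S / a \<ge> 0" using L a by simp
        thus "5 * S / a \<le> real k" "real k \<le> 5 * S / a + 1" unfolding k_def by linarith+
      qed
      \<comment> \<open>Since the block starts above L^(A/2), a large A keeps the moment k small: k
        ln L is at most (10/A) S, up to one ln L from rounding.\<close>
      have "5 * S / a \<le> 5 * S / (A / 2 * ln L)" using a L A by (intro divide_left_mono mult_pos_pos) auto
      hence k2: "real k * ln L \<le> 10 / A * S + ln L"
      proof -
        assume h: "5 * S / a \<le> 5 * S / (A / 2 * ln L)"
        have "real k * ln L \<le> (5 * S / (A / 2 * ln L) + 1) * ln L" using k h L by (intro mult_right_mono) auto
        also have "\<dots> = 10 / A * S + ln L" using L A by (simp add: field_simps)
        finally show ?thesis .
      qed
      have kL: "real k \<le> L"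
      proof -
        have "A / 2 * ln L \<ge> 5 * 1" using A L by (intro mult_mono) auto
        hence "5 * S / a \<le> 5 * S / 5" using a L by (intro divide_left_mono) auto
        thus ?thesis using k L by simp
      qed
      have pk: "exp (5 * S) \<le> 2 ^ (j * k)"
      proof -
        have "5 * S \<le> a * real k" using k(1) a by (simp add: divide_simps mult.commute)
        hence "exp (5 * S) \<le> exp (ln 2 * real (j * k))" by (simp add: a_def mult_ac)
        also have "\<dots> = 2 powr real (j * k)" by (simp add: powr_def mult.commute)
        also have "\<dots> = 2 ^ (j * k)" by (rule powr_realpow) simp
        finally show ?thesis .
      qed
      \<comment> \<open>As k <= L and 4 <= L, the three factors are at most L^k, L^k and L^(4k). The
        product L^(6k) = exp(6 k ln L) is where 60/A and L^6 come from.\<close>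
      have fk: "fact k * 4 ^ k * L ^ (4 * k) \<le> exp (60 / A * S) * L ^ 6"
      proof -
        have "(fact k :: real) \<le> real k ^ k" using fact_le_power[of k, where 'a = real] by simp
        also have "\<dots> \<le> L ^ k" using kL by (intro power_mono) auto
        finally have "fact k * 4 ^ k * L ^ (4 * k) \<le> L ^ k * L ^ k * L ^ (4 * k)"
          using L by (intro mult_mono power_mono) auto
        also have "\<dots> = L ^ (6 * k)" by (simp flip: power_add)
        also have "\<dots> = exp (real (6 * k) * ln L)" using L by (simp add: exp_of_nat_mult del: of_nat_mult)
        also have "real (6 * k) * ln L \<le> 60 / A * S + 6 * ln L"
        proof -
          have "real (6 * k) * ln L = 6 * (real k * ln L)" "60 / A * S = 6 * (10 / A * S)" by simp_all
          thus ?thesis using k2 by linarith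
        qed
        hence "exp (real (6 * k) * ln L) \<le> exp (60 / A * S + 6 * ln L)" by simp
        also have "\<dots> = exp (60 / A * S) * L ^ 6" using L by (simp add: exp_add exp_of_nat_mult[of 6, simplified])
        finally show ?thesis .
      qed
      \<comment> \<open>R bounds the primes of the block and their number, c0 the trivial size of
        \<open>prime_count (x / p)\<close> there, and V is the threshold of
        \<open>generic_disc\<close>; note R c0 = 2 x.\<close>
      define R c0 V where "R = (2::real) ^ (j + 1)" "c0 = x / 2 ^ j" "V = x / L\<^sup>2"
      have x1: "x \<ge> 1" using elim by simp
      have pos: "R \<ge> 1" "c0 > 0" "V > 0" using x1 L by (auto simp: R_c0_V_def intro: one_le_power[of "2::real" "j + 1", simplified])
      have Vx: "V ^ (2 * k) * L ^ (4 * k) = x ^ (2 * k)"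
      proof -
        have "V ^ (2 * k) * L ^ (4 * k) = (V * L\<^sup>2) ^ (2 * k)"
          by (simp add: power_mult_distrib flip: power_mult)
        thus ?thesis using L by (simp add: R_c0_V_def)
      qed
      have Rc: "R * c0 = 2 * x" by (simp add: R_c0_V_def)
      have L4: "L ^ (4 * k) > 0" using L by simp
      \<comment> \<open>After division by x^(2k) the claim reads 2 k! 2^k L^(4k) exp(2S) <= 2^(jk).
        The exponent 5 in the choice of k splits as 2 for the modulus, 1 for (60/A) S and 2 for ln 2
        + 6 ln L.\<close>
      have cond: "2 * (fact k * R ^ k * c0 ^ (2 * k)) * (exp S)\<^sup>2 \<le> V ^ (2 * k)"
      proof -
        have Rc2: "R ^ k * c0 ^ (2 * k) * 2 ^ (j * k) = 2 ^ k * x ^ (2 * k)"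
        proof -
          have "R ^ k * c0 ^ (2 * k) * 2 ^ (j * k) = (R * c0\<^sup>2 * 2 ^ j) ^ k"
            by (simp only: power_mult_distrib power_mult)
          also have "R * c0\<^sup>2 * 2 ^ j = 2 * x\<^sup>2" by (simp add: R_c0_V_def power2_eq_square)
          finally show ?thesis by (simp add: power_mult_distrib power_mult)
        qed
        have "2 * (fact k * 2 ^ k * L ^ (4 * k)) * exp (2 * S) \<le> exp (5 * S)"
        proof -
          have "fact k * 2 ^ k * L ^ (4 * k) \<le> fact k * 4 ^ k * L ^ (4 * k)"
            using L by (intro mult_right_mono mult_left_mono power_mono) auto
          hence "2 * (fact k * 2 ^ k * L ^ (4 * k)) * exp (2 * S) \<le> 2 * (exp (60 / A * S) * L ^ 6) * exp (2 * S)"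
            using fk by (intro mult_right_mono mult_left_mono) (linarith | simp)+
          also have "\<dots> = exp (ln 2 + 60 / A * S + 6 * ln L + 2 * S)"
            using L by (simp add: exp_add exp_of_nat_mult[of 6, simplified])
          also have "\<dots> \<le> exp (5 * S)"
          proof (subst exp_le_cancel_iff)
            have "60 / A * S \<le> 1 * S" using A L by (intro mult_right_mono) auto
            thus "ln 2 + 60 / A * S + 6 * ln L + 2 * S \<le> 5 * S" using elim unfolding L_S_def by linarith
          qed
          finally show ?thesis .
        qed
        hence "2 * (fact k * 2 ^ k * L ^ (4 * k)) * exp (2 * S) \<le> 2 ^ (j * k)" using pk by linarith
        hence "(2 * (fact k * 2 ^ k * L ^ (4 * k)) * exp (2 * S)) * x ^ (2 * k) \<le> 2 ^ (j * k) * x ^ (2 * k)"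
          using x1 by (intro mult_right_mono) auto
        hence "(2 * fact k * exp (2 * S)) * (2 ^ k * x ^ (2 * k)) * L ^ (4 * k) \<le> 2 ^ (j * k) * (V ^ (2 * k) * L ^ (4 * k))"
          unfolding Vx by (simp only: mult_ac)
        hence "((2 * fact k * exp (2 * S)) * (R ^ k * c0 ^ (2 * k))) * (2 ^ (j * k) * L ^ (4 * k)) \<le> V ^ (2 * k) * (2 ^ (j * k) * L ^ (4 * k))"
          unfolding Rc2[symmetric] by (simp only: mult_ac)
        hence "(2 * fact k * exp (2 * S)) * (R ^ k * c0 ^ (2 * k)) \<le> V ^ (2 * k)"
          by (rule mult_right_le_imp_le) (use L4 in simp)
        moreover have "(exp S)\<^sup>2 = exp (2 * S)" by (simp add: exp_double)
        ultimately show ?thesis by (simp only: mult_ac)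
      qed
      have Ef: "finite E" "\<And>d. d \<in> E \<Longrightarrow> odd d \<and> squarefree d \<and> real d \<le> exp S \<and>
          V \<le> \<bar>\<Sum>p\<in>dyadic_primes j. prime_count (x / real p) * of_int (jac d (int p))\<bar>"
        using asm unfolding L_S_def R_c0_V_def by blast+
      have "real (card E) * V ^ (2 * k) \<le> 2 * (fact k * R ^ k * c0 ^ (2 * k)) * (R ^ k + 1)"
      proof (rule large_values_primes[where M = "exp S" and B = "dyadic_primes j" and c = "\<lambda>p. prime_count (x / real p)"])
        show "\<And>p. p \<in> dyadic_primes j \<Longrightarrow> prime p" by (simp add: dyadic_primes_def)
        show le: "real p \<le> R" if "p \<in> dyadic_primes j" for p
        proof -
          have "p \<le> 2 ^ (j + 1)" using that by (simp add: dyadic_primes_def)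
          hence "real p \<le> real (2 ^ (j + 1))" by (simp only: of_nat_le_iff)
          thus ?thesis by (simp add: R_c0_V_def)
        qed
        have "dyadic_primes j \<subseteq> {0<..2 ^ (j + 1)}" by (auto simp: dyadic_primes_def)
        hence "card (dyadic_primes j) \<le> card {0<..(2::nat) ^ (j + 1)}" by (intro card_mono finite_greaterThanAtMost)
        hence "card (dyadic_primes j) \<le> 2 ^ (j + 1)" by (simp only: card_greaterThanAtMost diff_zero)
        hence "real (card (dyadic_primes j)) \<le> real (2 ^ (j + 1))" by (simp only: of_nat_le_iff)
        thus "real (card (dyadic_primes j)) \<le> R" by (simp add: R_c0_V_def)
        show "\<bar>prime_count (x / real p)\<bar> \<le> c0" if "p \<in> dyadic_primes j" for p
        proof -
          have "2 ^ j < p" using that by (simp add: dyadic_primes_def)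
          hence "real (2 ^ j) < real p" by (simp only: of_nat_less_iff)
          hence "x / real p \<le> c0" unfolding R_c0_V_def using x1 by (intro divide_left_mono) (auto intro!: mult_pos_pos)
          moreover have "prime_count (x / real p) \<le> x / real p" using x1 by (intro prime_count_le_self) auto
          ultimately show ?thesis using prime_count_nonneg[of "x / real p"] by linarith
        qed
        show "odd d \<and> squarefree d \<and> real d \<le> exp S" if "d \<in> E" for d using Ef(2)[OF that] by blast
        show "V \<le> \<bar>\<Sum>p\<in>dyadic_primes j. prime_count (x / real p) * of_int (jac d (int p))\<bar>" if "d \<in> E" for d
          using Ef(2)[OF that] by blast
      qed (rule Ef finite_dyadic_primes cond pos order.strict_implies_order[OF pos(2)])+
      also have "\<dots> \<le> 2 * (fact k * R ^ k * c0 ^ (2 * k)) * (2 * R ^ k)"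
        using pos one_le_power[of R k] by (intro mult_left_mono) auto
      also have "\<dots> = 4 * fact k * (R * c0) ^ (2 * k)"
      proof -
        have "R ^ (2 * k) = R ^ k * R ^ k" unfolding mult_2 by (rule power_add)
        thus ?thesis by (simp add: power_mult_distrib)
      qed
      also have "\<dots> = 4 * fact k * 4 ^ k * x ^ (2 * k)" unfolding Rc by (simp add: power_mult_distrib power_mult)
      also have "\<dots> = 4 * (fact k * 4 ^ k * L ^ (4 * k)) * V ^ (2 * k)" unfolding Vx[symmetric] by (simp only: mult_ac)
      finally have "real (card E) \<le> 4 * (fact k * 4 ^ k * L ^ (4 * k))"
        by (rule mult_right_le_imp_le) (use pos in simp)
      also have "\<dots> \<le> 4 * (exp (60 / A * S) * L ^ 6)" using fk by simp
      finally show "real (card E) \<le> 4 * exp (60 / A * sqrt (ln x)) * (ln x) ^ 6" by (simp add: L_S_def mult_ac)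
    qed
  qed
qed

text \<open>Each of at most w primes is bounded by w itself; the resulting exponent sqrt S log S is
  o(S).\<close>

lemma prod_small_primes_le:
  assumes "S \<ge> 1" "real w \<le> sqrt S" "w \<ge> 1"
  shows "real (\<Prod>{p. prime p \<and> 2 < p \<and> p \<le> w}) \<le> exp (sqrt S * ln S)"
proof -
  let ?P = "{p. prime p \<and> 2 < p \<and> p \<le> w}"
  have "?P \<subseteq> {1..w}" by auto
  hence card: "card ?P \<le> w" using card_mono[of "{1..w}" ?P] by simp
  have "(\<Prod>p\<in>?P. real p) \<le> (\<Prod>p\<in>?P. real w)" by (intro prod_mono) auto
  hence "real (\<Prod>?P) \<le> real w ^ card ?P" by (simp only: of_nat_prod prod_constant)
  also have "\<dots> \<le> real w ^ w" using card assms by (intro power_increasing) auto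
  also have "\<dots> = exp (real w * ln (real w))" using assms by (simp add: exp_of_nat_mult)
  also have "real w * ln (real w) \<le> sqrt S * ln S"
  proof (intro mult_mono)
    have "sqrt S \<le> S" using assms by (simp add: real_le_lsqrt power2_eq_square)
    thus "ln (real w) \<le> ln S" using assms by (subst ln_le_cancel_iff) auto
  qed (use assms in auto)
  finally show ?thesis by simp
qed

text \<open>The value A = 120/e makes 60/A = e/2 <= 1/8, so all exceptional sets together have at
  most D(x)^(1/8) elements up to powers of log x. The residue class supplies at least 2 D(x)^(1 - e)
  candidates before the rounding errors, and e <= 1/4 keeps this well above what is removed.\<close>

lemma card_generic_disc:
  assumes e: "e > 0" "e \<le> 1 / 4" and \<eta>: "\<eta> \<in> {-1, 1 :: int}"
  shows "\<forall>\<^sub>F x in at_top. finite {d. generic_disc (120 / e) \<eta> x d} \<and>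
    exp ((1 - e) * sqrt (ln x)) \<le> real (card {d. generic_disc (120 / e) \<eta> x d})"
proof -
  define A where "A = 120 / e"
  have A: "A \<ge> 60" using e by (simp add: A_def divide_simps)
  have lim: "filterlim (\<lambda>x::real. sqrt (ln x)) at_top at_top" by real_asymp
  \<comment> \<open>Here 24 = 2 * 4 * 3: a factor 2 to be halved by the errors, 4 from the modulus 4
    times the product of primes, 3 from (2/3) M >= exp(S)/3.\<close>
  have "\<forall>\<^sub>F S::real in at_top. ln 24 + sqrt S * ln S \<le> e * S" using e(1) by real_asymp
  hence 1: "\<forall>\<^sub>F x::real in at_top. ln 24 + sqrt (sqrt (ln x)) * ln (sqrt (ln x)) \<le> e * sqrt (ln x)"
    by (rule eventually_compose_filterlim[OF _ lim])
  \<comment> \<open>All losses at once: 2 from rounding and 1 for d = 1, then sqrt M from the sieve,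
    the exceptions for the quadratic term, and those for the dyadic blocks.\<close>
  have "\<forall>\<^sub>F S::real in at_top. 3 + exp (S / 2) + 8 * S ^ 4 + 8 * S ^ 14 * exp (S / 8) \<le> exp (3 / 4 * S)"
    by real_asymp
  hence 2: "\<forall>\<^sub>F x::real in at_top. 3 + exp (sqrt (ln x) / 2) + 8 * sqrt (ln x) ^ 4 +
      8 * sqrt (ln x) ^ 14 * exp (sqrt (ln x) / 8) \<le> exp (3 / 4 * sqrt (ln x))"
    by (rule eventually_compose_filterlim[OF _ lim])
  have 3: "\<forall>\<^sub>F x::real in at_top. ln x \<ge> 2" by real_asymp
  show ?thesis unfolding A_def[symmetric]
    using 1 2 3 small_bound_eventually exceptional_semiprimes exceptional_blocks[OF A]
  proof eventually_elim
    case (elim x)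
    define S where "S = sqrt (ln x)"
    define w where "w = small_bound x"
    define M where "M = nat \<lfloor>exp S\<rfloor>"
    define P where "P = {p. prime p \<and> 2 < p \<and> p \<le> w}"
    define T where "T = {d\<in>{1..M}. odd d \<and> squarefree d \<and> (\<forall>p\<in>P. jac d (int p) = \<eta>)}"
    define G where "G = {d. generic_disc A \<eta> x d}"
    define E0 where "E0 = {d\<in>T. x / ln x \<le> \<bar>\<Sum>(p, q)\<in>prime_pairs x. real_of_int (jac d (int p)) * of_int (jac d (int q))\<bar>}"
    define E1 where "E1 = (\<lambda>j. {d\<in>T. x / (ln x)\<^sup>2 \<le> \<bar>\<Sum>p\<in>dyadic_primes j. prime_count (x / real p) * of_int (jac d (int p))\<bar>})"
    define I where "I = {mid_exp A x..<top_exp x}"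
    have L: "ln x \<ge> 2" "ln x = S\<^sup>2" using elim by (auto simp: S_def)
    have S1: "S \<ge> 1" using L(1) unfolding S_def by simp
    have M: "real M \<le> exp S" "exp S / 2 \<le> real M" "M \<ge> 1"
    proof -
      have "exp S \<ge> 1 + S" by (rule exp_ge_add_one_self)
      hence h: "exp S \<ge> 2" using S1 by linarith
      thus "real M \<le> exp S" unfolding M_def by simp
      have "real M > exp S - 1" unfolding M_def by linarith
      thus m: "exp S / 2 \<le> real M" using h by linarith
      thus "M \<ge> 1" using h by linarith
    qed
    have dS: "real d \<le> exp S" if "d \<le> M" for d using that M(1) by (meson of_nat_le_iff order_trans)
    have Td: "odd d \<and> squarefree d \<and> real d \<le> exp (sqrt (ln x))" if "d \<in> T" for d
      using that dS[of d] by (simp add: T_def S_def)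
    have fin: "finite T" "finite E0" "\<And>j. finite (E1 j)" by (auto simp: T_def E0_def E1_def)
    have "d \<le> M" if "generic_disc A \<eta> x d" for d
    proof -
      have "real d \<le> exp S" using that by (simp add: generic_disc_def S_def)
      thus ?thesis unfolding M_def by (simp add: le_nat_floor)
    qed
    hence finG: "finite G" by (intro finite_subset[of G "{..M}"]) (auto simp: G_def)
    \<comment> \<open>The element d = 1 is set apart because its symbol is the principal
      character.\<close>
    have sub: "T \<subseteq> G \<union> ({1} \<union> (E0 \<union> (\<Union>j\<in>I. E1 j)))"
    proof
      fix d assume d: "d \<in> T"
      show "d \<in> G \<union> ({1} \<union> (E0 \<union> (\<Union>j\<in>I. E1 j)))"
      proof (rule ccontr)
        assume n: "d \<notin> G \<union> ({1} \<union> (E0 \<union> (\<Union>j\<in>I. E1 j)))"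
        have "\<bar>\<Sum>(p, q)\<in>prime_pairs x. real_of_int (jac d (int p)) * of_int (jac d (int q))\<bar> \<le> x / ln x"
          using n d by (simp add: E0_def)
        moreover have "\<bar>\<Sum>p\<in>dyadic_primes j. prime_count (x / real p) * of_int (jac d (int p))\<bar> \<le> x / (ln x)\<^sup>2"
          if "mid_exp A x \<le> j \<and> j < top_exp x" for j
          using n d that by (force simp: E1_def I_def)
        moreover have "d > 1" using n d by (simp add: T_def)
        moreover have "jac d (int p) = \<eta>" if "prime p \<and> 2 < p \<and> p \<le> small_bound x" for p
          using d that by (simp add: T_def P_def w_def)
        ultimately have "generic_disc A \<eta> x d" using Td[OF d] unfolding generic_disc_def by blast
        thus False using n by (simp add: G_def)
      qed
    qed
    have cE0: "real (card E0) \<le> 8 * S ^ 4"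
    proof -
      have "real (card E0) \<le> 8 * (ln x)\<^sup>2"
        by (rule elim(5)[rule_format]) (use Td fin in \<open>auto simp: E0_def\<close>)
      thus ?thesis by (simp add: L(2) flip: power_mult)
    qed
    have cE1: "real (card (E1 j)) \<le> 4 * exp (S / 8) * S ^ 12" if "j \<in> I" for j
    proof -
      have "real (card (E1 j)) \<le> 4 * exp (60 / A * sqrt (ln x)) * (ln x) ^ 6"
        by (rule elim(6)[rule_format]) (use Td fin that in \<open>auto simp: E1_def I_def\<close>)
      also have "60 / A * sqrt (ln x) \<le> 1 / 8 * S"
        unfolding S_def[symmetric] using e S1 by (intro mult_right_mono) (auto simp: A_def)
      hence "4 * exp (60 / A * sqrt (ln x)) * (ln x) ^ 6 \<le> 4 * exp (1 / 8 * S) * (ln x) ^ 6"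
        using L by (intro mult_right_mono) auto
      also have "\<dots> = 4 * exp (S / 8) * S ^ 12" by (simp add: L(2) flip: power_mult)
      finally show ?thesis .
    qed
    have "card (\<Union>j\<in>I. E1 j) \<le> (\<Sum>j\<in>I. card (E1 j))" by (rule card_UN_le) (simp add: I_def)
    hence "real (card (\<Union>j\<in>I. E1 j)) \<le> (\<Sum>j\<in>I. real (card (E1 j)))" by (simp flip: of_nat_sum)
    also have "\<dots> \<le> real (card I) * (4 * exp (S / 8) * S ^ 12)" using cE1 by (rule sum_bounded_above)
    also have "\<dots> \<le> (2 * S\<^sup>2) * (4 * exp (S / 8) * S ^ 12)"
    proof (intro mult_right_mono)
      have "real (card I) \<le> real (top_exp x)" by (simp add: I_def)
      also have "\<dots> \<le> 2 * S\<^sup>2" using top_exp_le[OF L(1)] L(2) by simp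
      finally show "real (card I) \<le> 2 * S\<^sup>2" .
    qed (use S1 in auto)
    also have "\<dots> = 8 * S ^ 14 * exp (S / 8)" by (simp flip: power_add)
    finally have cE: "real (card (\<Union>j\<in>I. E1 j)) \<le> 8 * S ^ 14 * exp (S / 8)" .
    have "card T \<le> card (G \<union> ({1} \<union> (E0 \<union> (\<Union>j\<in>I. E1 j))))"
      using sub fin finG by (intro card_mono) (auto simp: I_def)
    also have "\<dots> \<le> card G + (1 + (card E0 + card (\<Union>j\<in>I. E1 j)))"
      using card_Un_le[of G "{1} \<union> (E0 \<union> (\<Union>j\<in>I. E1 j))"] card_Un_le[of "{1}" "E0 \<union> (\<Union>j\<in>I. E1 j)"]
        card_Un_le[of E0 "\<Union>j\<in>I. E1 j"] by simp
    finally have "real (card T) \<le> real (card G + (1 + (card E0 + card (\<Union>j\<in>I. E1 j))))"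
      by (simp only: of_nat_le_iff)
    hence cT: "real (card T) \<le> real (card G) + 1 + 8 * S ^ 4 + 8 * S ^ 14 * exp (S / 8)"
      using cE0 cE by simp
    have "real (card T) \<ge> 2 / 3 * real M / real (4 * \<Prod>P) - 2 - sqrt (real M)"
      unfolding T_def P_def using elim(4) M(3) \<eta> by (intro card_discriminants_ge) (auto simp: w_def)
    moreover have "sqrt (real M) \<le> exp (S / 2)"
    proof (rule real_le_lsqrt)
      show "real M \<le> (exp (S / 2))\<^sup>2" using M(1) by (simp flip: exp_double)
    qed auto
    moreover have "2 / 3 * real M / real (4 * \<Prod>P) \<ge> 2 * exp ((1 - e) * S)"
    proof -
      have "w \<ge> 3" using elim(4) by (simp add: w_def)
      have "real w \<le> ln x powr (1/4)" unfolding w_def small_bound_def by simp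
      also have "\<dots> = sqrt S" using L(1)
        by (simp add: S_def powr_half_sqrt[symmetric] powr_powr)
      finally have "real (\<Prod>P) \<le> exp (sqrt S * ln S)" unfolding P_def
        using S1 \<open>w \<ge> 3\<close> by (intro prod_small_primes_le) auto
      hence "2 * exp ((1 - e) * S) * real (4 * \<Prod>P) \<le> 2 * exp ((1 - e) * S) * (4 * exp (sqrt S * ln S))"
        by (intro mult_left_mono) auto
      also have "\<dots> = (24 * exp (sqrt S * ln S)) * exp ((1 - e) * S) / 3" by simp
      also have "24 * exp (sqrt S * ln S) = exp (ln 24 + sqrt S * ln S)" by (simp add: exp_add)
      also have "exp (ln 24 + sqrt S * ln S) * exp ((1 - e) * S) / 3 \<le> exp (e * S) * exp ((1 - e) * S) / 3"
        using elim(1) unfolding S_def by (intro divide_right_mono mult_right_mono) auto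
      also have "\<dots> = exp S / 3" by (simp flip: exp_add add: algebra_simps)
      also have "\<dots> \<le> 2 / 3 * real M" using M(2) by simp
      finally have "2 * exp ((1 - e) * S) * real (4 * \<Prod>P) \<le> 2 / 3 * real M" .
      moreover have "real (4 * \<Prod>P) > 0" by (auto simp: P_def intro!: prod_pos dest: prime_gt_0_nat)
      ultimately show ?thesis by (simp only: pos_le_divide_eq)
    qed
    moreover have "exp (3 / 4 * S) \<le> exp ((1 - e) * S)" using e S1 by simp
    moreover have "3 + exp (S / 2) + 8 * S ^ 4 + 8 * S ^ 14 * exp (S / 8) \<le> exp (3 / 4 * S)"
      using elim(2) unfolding S_def .
    ultimately have "exp ((1 - e) * S) \<le> real (card G)" using cT by linarith
    thus ?case using finG unfolding G_def S_def by blast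
  qed
qed

theorem theorem1p2:
  "\<exists>C::real. C > 0 \<and>
     (\<forall>\<eta>\<in>{-1, 1::complex}. \<forall>\<epsilon>::real. \<epsilon> > 0 \<longrightarrow>
       (\<exists>K::real. \<forall>\<^sub>F x::real in at_top.
          real (card {d::nat. d > 0 \<and> real d \<le> D C x \<and>
            (\<exists>\<chi>. quadratic_char d \<chi> \<and>
              (\<exists>E::real. \<bar>E\<bar> \<le> K \<and>
                real (semiprime_count x (\<lambda>p q. \<chi> (int p) = \<eta> \<and> \<chi> (int q) = \<eta>)) /
                  (1 / 4 * real (semiprime_count x (\<lambda>p q. coprime (p * q) d)))
                \<ge> 1 + (ln (ln (ln x)) + E) / ln (ln x)))})
          \<ge> D C x powr (1 - \<epsilon>)))"
proof (rule exI[of _ 1], intro conjI ballI allI impI)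
  fix \<eta> :: complex and \<epsilon> :: real
  assume \<eta>: "\<eta> \<in> {-1, 1}" and \<epsilon>: "\<epsilon> > 0"
  define s where "s = (if \<eta> = 1 then 1 else -1 :: int)"
  have s: "s \<in> {-1, 1}" "\<eta> = of_int s" using \<eta> by (auto simp: s_def)
  \<comment> \<open>For \<epsilon> > 1/4 the stronger claim with exponent 3/4 is proved, since the
    count of exceptions is compared with D(x)^(3/4).\<close>
  define e where "e = min \<epsilon> (1 / 4)"
  have e: "e > 0" "e \<le> 1 / 4" "e \<le> \<epsilon>" using \<epsilon> by (auto simp: e_def)
  define A where "A = 120 / e"
  have A: "A \<ge> 1" using e by (simp add: A_def divide_simps)
  obtain K where K: "K \<ge> 0" "\<forall>\<^sub>F x in at_top. \<forall>d. generic_disc A s x d \<longrightarrow>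
    4 * real (card {(p, q) \<in> prime_pairs x. jac d (int p) = s \<and> jac d (int q) = s}) \<ge>
      real (card {(p, q) \<in> prime_pairs x. coprime (p * q) d}) + x / ln x * (ln (ln (ln x)) - K)"
    using bias[OF A s(1)] .
  obtain K' where K': "K' \<ge> 0" "\<forall>\<^sub>F x in at_top. real (card (prime_pairs x)) \<le> x / ln x * (ln (ln x) + K')"
    using semiprimes_upper .
  have "\<forall>\<^sub>F x::real in at_top. ln (ln (ln x)) > K" by real_asymp
  moreover have "\<forall>\<^sub>F x::real in at_top. ln (ln (ln x)) \<le> ln (ln x)" by real_asymp
  moreover have "\<forall>\<^sub>F x::real in at_top. ln x > 1" by real_asymp
  moreover have "\<forall>\<^sub>F x::real in at_top. x > 1" by (rule eventually_gt_at_top)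
  ultimately have "\<forall>\<^sub>F x::real in at_top.
      D 1 x powr (1 - \<epsilon>) \<le> real (card {d::nat. d > 0 \<and> real d \<le> D 1 x \<and>
        (\<exists>\<chi>. quadratic_char d \<chi> \<and> (\<exists>E::real. \<bar>E\<bar> \<le> K + K' \<and>
          1 + (ln (ln (ln x)) + E) / ln (ln x) \<le>
            real (semiprime_count x (\<lambda>p q. \<chi> (int p) = \<eta> \<and> \<chi> (int q) = \<eta>)) /
              (1 / 4 * real (semiprime_count x (\<lambda>p q. coprime (p * q) d)))))})"
    using K(2) K'(2) card_generic_disc[OF e(1,2) s(1)]
  proof eventually_elim
    case (elim x)
    let ?G = "{d. generic_disc A s x d}"
    let ?T = "{d::nat. d > 0 \<and> real d \<le> D 1 x \<and>
        (\<exists>\<chi>. quadratic_char d \<chi> \<and> (\<exists>E::real. \<bar>E\<bar> \<le> K + K' \<and>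
          1 + (ln (ln (ln x)) + E) / ln (ln x) \<le>
            real (semiprime_count x (\<lambda>p q. \<chi> (int p) = \<eta> \<and> \<chi> (int q) = \<eta>)) /
              (1 / 4 * real (semiprime_count x (\<lambda>p q. coprime (p * q) d)))))}"
    have D: "D 1 x = exp (sqrt (ln x))" using elim by (simp add: D_def powr_half_sqrt)
    have "?G \<subseteq> ?T"
    proof
      fix d assume "d \<in> ?G"
      hence gd: "generic_disc A s x d" by simp
      hence d: "odd d" "squarefree d" "d > 1" "real d \<le> exp (sqrt (ln x))" by (auto simp: generic_disc_def)
      define \<chi> where "\<chi> = (\<lambda>a. complex_of_int (jac d a))"
      define Num where "Num = card {(p, q) \<in> prime_pairs x. jac d (int p) = s \<and> jac d (int q) = s}"
      define N0 where "N0 = card {(p, q) \<in> prime_pairs x. coprime (p * q) d}"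
      have \<chi>s: "\<chi> a = \<eta> \<longleftrightarrow> jac d a = s" for a unfolding \<chi>_def s(2) by (rule of_int_eq_iff)
      have "semiprime_count x (\<lambda>p q. \<chi> (int p) = \<eta> \<and> \<chi> (int q) = \<eta>) = Num"
        unfolding \<chi>s Num_def by (rule semiprime_count_eq) auto
      moreover have "semiprime_count x (\<lambda>p q. coprime (p * q) d) = N0"
        unfolding N0_def by (rule semiprime_count_eq) (simp add: mult.commute)
      \<comment> \<open>The O(1) is the constant - (K + K'), the same for all x and d.\<close>
      moreover have "1 + (ln (ln (ln x)) + - (K + K')) / ln (ln x) \<le> real Num / (1 / 4 * real N0)"
      proof (rule bias_ratio[where X = "x / ln x"])
        show "real N0 + x / ln x * (ln (ln (ln x)) - K) \<le> 4 * real Num"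
          using elim(5) gd unfolding Num_def N0_def by blast
        have "Num \<le> N0" unfolding Num_def N0_def using d elim s(1) by (intro char_count_lower(2)) auto
        thus "real Num \<le> real N0" by simp
        have "N0 \<le> card (prime_pairs x)" unfolding N0_def by (intro card_mono finite_prime_pairs) auto
        hence "real N0 \<le> real (card (prime_pairs x))" by simp
        thus "real N0 \<le> x / ln x * (ln (ln x) + K')" using elim(6) by linarith
      qed (use elim K(1) K'(1) in auto)
      moreover have "\<bar>- (K + K')\<bar> \<le> K + K'" using K(1) K'(1) by simp
      moreover have "quadratic_char d \<chi>" unfolding \<chi>_def by (rule quadratic_char_jac[OF d(1-3)])
      ultimately have "quadratic_char d \<chi> \<and> (\<exists>E::real. \<bar>E\<bar> \<le> K + K' \<and>
          1 + (ln (ln (ln x)) + E) / ln (ln x) \<le>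
            real (semiprime_count x (\<lambda>p q. \<chi> (int p) = \<eta> \<and> \<chi> (int q) = \<eta>)) /
              (1 / 4 * real (semiprime_count x (\<lambda>p q. coprime (p * q) d))))"
        by (intro conjI exI[of _ "- (K + K')"]) simp_all
      thus "d \<in> ?T" using d D by auto
    qed
    moreover have "finite ?T"
      by (rule finite_subset[of _ "{..nat \<lfloor>D 1 x\<rfloor>}"]) (auto simp: le_nat_floor)
    ultimately have "card ?G \<le> card ?T" by (intro card_mono)
    hence "real (card ?G) \<le> real (card ?T)" by (rule of_nat_mono)
    moreover have "D 1 x powr (1 - \<epsilon>) \<le> exp ((1 - e) * sqrt (ln x))"
      unfolding D using e elim by (simp add: powr_def mult_right_mono)
    ultimately show ?case using elim(7) unfolding A_def by linarith
  qed
  thus "\<exists>K::real. \<forall>\<^sub>F x::real in at_top.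
          real (card {d::nat. d > 0 \<and> real d \<le> D 1 x \<and>
            (\<exists>\<chi>. quadratic_char d \<chi> \<and>
              (\<exists>E::real. \<bar>E\<bar> \<le> K \<and>
                real (semiprime_count x (\<lambda>p q. \<chi> (int p) = \<eta> \<and> \<chi> (int q) = \<eta>)) /
                  (1 / 4 * real (semiprime_count x (\<lambda>p q. coprime (p * q) d)))
                \<ge> 1 + (ln (ln (ln x)) + E) / ln (ln x)))})
          \<ge> D 1 x powr (1 - \<epsilon>)"
    by (intro exI[where x = "K + K'"])
qed simp

end
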